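(* Let $S\subset\mathbb{R}^n$ be a compact convex semialgebraic set with nonempty interior, and let $f^k_i$ ($1\le k\le m$, $1\le i\le L_k$) be a system of intrinsic polynomials of $S$. Assume every $f^k_i$ is nonsingular on $Z(f^k_i)\cap\partial S$ (i.e. $\nabla f^k_i(u)\neq0$ for all $u\in Z(f^k_i)\cap\partial S$), and is strictly quasi-concave at $u\in Z(f^k_i)\cap\partial S$ whenever $f^k_i$ is redundant at $u$. Then: (1) if for each $u\in\partial S$ and each $f^k_i$ satisfying $f^k_i(u)=0$ the polynomial $f^k_i$ is strictly quasi-concave at $u$, then $S$ is SDP representable; (2) if $S$ is SDP representable, then for each $u\in\partial S$ and each $f^k_i$ satisfying $f^k_i(u)=0$ the polynomial $f^k_i$ is quasi-concave at $u$.
   Context: A set $S\subseteq\mathbb{R}^n$ is SDP representable if there are $N\ge 0$ and real symmetric matrices $A_0,A_1,\dots,A_n,B_1,\dots,B_N$ of a common size such that $S=\{x\in\mathbb{R}^n:\exists u\in\mathbb{R}^N,\ A_0+\sum_{i=1}^n x_iA_i+\sum_{j=1}^N u_jB_j\succeq 0\}$, where $\succeq 0$ means positive semidefinite. $Z(f)=\{x\in\mathbb{R}^n:f(x)=0\}$; $B(u,r)$, $\bar B(u,r)$ are the open and closed Euclidean balls. Intrinsic polynomials. A system of intrinsic polynomials of $S$ consists of polynomials $f^k_i$ ($1\le k\le m$, $1\le i\le L_k$) obtained as follows. The interior of $S$ is written as $\overset{\circ}{S}=\bigcup_{k=1}^m T_k$, where each $T_k$ is a bounded basic open semialgebraic set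 $\{x: g^k_1(x)>0,\dots,g^k_{m_k}(x)>0\}$ with polynomials $g^k_j$; $\partial T_k$ denotes the boundary of $\overline{T_k}$. The Zariski closure $\mathcal{V}^k$ of $\partial T_k$ is a union $\mathcal V^k_1\cup\dots\cup\mathcal V^k_{L_k}$ of irreducible real algebraic varieties of dimension $n-1$ such that $\mathcal V^k_i\cap\partial T_k\nsubseteq(\bigcup_{j\ne i}\mathcal V^k_j)\cap\partial T_k$, and $\mathcal V^k_i=Z(f^k_i)$ with $f^k_i$ an irreducible polynomial generating the vanishing ideal $I(\mathcal V^k_i)$. Moreover, with $\mathcal V^{k+}_i=\{x:f^k_i(x)\ge 0\}$, whenever $u\in\partial T_k$ is such that $\nabla f^k_i(u)\neq0$ for every $i$ with $u\in\mathcal V^k_i$, one has for all sufficiently small $r>0$ that $\overline{T_k}\cap\bar B(u,r)=\big(\bigcap_{1\le i\le L_k}\mathcal V^{k+}_i\big)\cap\bar B(u,r)$. Irredundancy. For $u\in\partial S\cap Z(f^k_i)$, $f^k_i$ is irredundant at $u$ if there are a sequence $u_N\in\partial S$ with $u_N\to u$ and numbers $\epsilon_N>0$ such that $S\cap B(u_N,\epsilon_N)=\mathcal V^{k+}_i\cap B(u_N,\epsilon_N)$ for all $N$; otherwise $f^k_i$ is redundant at $u$. A smooth function $f$ is strictly quasi-concave (resp. quasi-concave) at $u$ if $-v^T\nabla^2 f(u)v>0$ (resp. $\ge 0$) for all $0\ne v\in\mathbb{R}^n$ with $\nabla f(u)^Tv=0$. *)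

theory Defs
  imports
    "HOL-Analysis.Analysis"
    "HOL-Library.Poly_Mapping"
    "HOL-Library.Extended_Nat"
    "HOL-Computational_Algebra.Factorial_Ring"
begin

section \<open>Real polynomials in the coordinates of \<open>real ^ 'n\<close>\<close>

text \<open>Finitely supported maps from exponent vectors to coefficients; multiplication in
  \<open>Poly_Mapping\<close> is convolution, so this is the polynomial ring.\<close>

type_synonym 'n real_mpoly = "('n \<Rightarrow>\<^sub>0 nat) \<Rightarrow>\<^sub>0 real"

definition peval :: "'n::finite real_mpoly \<Rightarrow> real ^ 'n \<Rightarrow> real" where
  "peval p x = (\<Sum>e\<in>Poly_Mapping.keys p.
     Poly_Mapping.lookup p e * (\<Prod>i\<in>UNIV. (x $ i) ^ Poly_Mapping.lookup e i))"

definition zeros :: "'n::finite real_mpoly \<Rightarrow> (real ^ 'n) set" where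
  "zeros p = {x. peval p x = 0}"

definition nonneg_set :: "'n::finite real_mpoly \<Rightarrow> (real ^ 'n) set" where
  "nonneg_set p = {x. 0 \<le> peval p x}"


section \<open>Real algebraic varieties\<close>

definition algebraic_set :: "(real ^ 'n::finite) set \<Rightarrow> bool" where
  "algebraic_set V \<longleftrightarrow> (\<exists>P :: 'n real_mpoly set. V = {x. \<forall>p\<in>P. peval p x = 0})"

definition zariski_closure :: "(real ^ 'n::finite) set \<Rightarrow> (real ^ 'n) set" where
  "zariski_closure A = \<Inter> {V. algebraic_set V \<and> A \<subseteq> V}"

definition vanishing_ideal :: "(real ^ 'n::finite) set \<Rightarrow> 'n real_mpoly set" where
  "vanishing_ideal A = {p. \<forall>x\<in>A. peval p x = 0}"

definition irreducible_variety :: "(real ^ 'n::finite) set \<Rightarrow> bool" where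
  "irreducible_variety V \<longleftrightarrow> algebraic_set V \<and> V \<noteq> {} \<and>
     (\<forall>A B. algebraic_set A \<and> algebraic_set B \<and> V = A \<union> B \<longrightarrow> V = A \<or> V = B)"

text \<open>Ideals of a commutative ring are its submodules as a module over itself.\<close>

definition prime_ideal :: "'a::comm_ring_1 set \<Rightarrow> bool" where
  "prime_ideal I \<longleftrightarrow> module.subspace (*) I \<and> I \<noteq> UNIV \<and>
     (\<forall>a b. a * b \<in> I \<longrightarrow> a \<in> I \<or> b \<in> I)"

text \<open>The Krull dimension of the coordinate ring \<open>\<real>[x] / I(V)\<close>, whose prime ideals are the prime
  ideals of \<open>\<real>[x]\<close> containing \<open>I(V)\<close>. The empty set gets the junk value 0.\<close>

definition variety_dim :: "(real ^ 'n::finite) set \<Rightarrow> enat" where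
  "variety_dim V = Sup {enat l | l. \<exists>P :: nat \<Rightarrow> 'n real_mpoly set.
     (\<forall>j\<le>l. prime_ideal (P j) \<and> vanishing_ideal V \<subseteq> P j) \<and> (\<forall>j<l. P j \<subset> P (Suc j))}"


section \<open>Semialgebraic sets\<close>

definition basic_open_semialgebraic :: "(real ^ 'n::finite) set \<Rightarrow> bool" where
  "basic_open_semialgebraic T \<longleftrightarrow>
     (\<exists>G :: 'n real_mpoly set. finite G \<and> T = {x. \<forall>g\<in>G. 0 < peval g x})"

definition semialgebraic :: "(real ^ 'n::finite) set \<Rightarrow> bool" where
  "semialgebraic S \<longleftrightarrow>
     (\<exists>F :: ('n real_mpoly set \<times> 'n real_mpoly set) set. finite F \<and>
        (\<forall>(E, G)\<in>F. finite E \<and> finite G) \<and>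
        S = (\<Union>(E, G)\<in>F. {x. (\<forall>p\<in>E. peval p x = 0) \<and> (\<forall>g\<in>G. 0 < peval g x)}))"


section \<open>Semidefinite representability\<close>

text \<open>A \<open>d \<times> d\<close> matrix is a function \<open>nat \<Rightarrow> nat \<Rightarrow> real\<close> of which only the entries with indices
  below \<open>d\<close> matter, since \<open>d\<close> is existentially quantified in \<open>sdp_representable\<close>.\<close>

definition symmetric_matrix :: "nat \<Rightarrow> (nat \<Rightarrow> nat \<Rightarrow> real) \<Rightarrow> bool" where
  "symmetric_matrix d M \<longleftrightarrow> (\<forall>p<d. \<forall>q<d. M p q = M q p)"

definition psd_matrix :: "nat \<Rightarrow> (nat \<Rightarrow> nat \<Rightarrow> real) \<Rightarrow> bool" where
  "psd_matrix d M \<longleftrightarrow> symmetric_matrix d M \<and>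
     (\<forall>v :: nat \<Rightarrow> real. 0 \<le> (\<Sum>p<d. \<Sum>q<d. v p * M p q * v q))"

definition sdp_representable :: "(real ^ 'n::finite) set \<Rightarrow> bool" where
  "sdp_representable S \<longleftrightarrow>
     (\<exists>(d :: nat) (N :: nat) (A0 :: nat \<Rightarrow> nat \<Rightarrow> real)
        (A :: 'n \<Rightarrow> nat \<Rightarrow> nat \<Rightarrow> real) (B :: nat \<Rightarrow> nat \<Rightarrow> nat \<Rightarrow> real).
        symmetric_matrix d A0 \<and> (\<forall>i. symmetric_matrix d (A i)) \<and>
        (\<forall>j<N. symmetric_matrix d (B j)) \<and>
        S = {x. \<exists>u :: nat \<Rightarrow> real. psd_matrix d
               (\<lambda>p q. A0 p q + (\<Sum>i\<in>UNIV. x $ i * A i p q) + (\<Sum>j<N. u j * B j p q))})"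


section \<open>Quasi-concavity\<close>

definition gradient :: "(real ^ 'n::finite \<Rightarrow> real) \<Rightarrow> real ^ 'n \<Rightarrow> real ^ 'n" where
  "gradient f u = (\<chi> i. frechet_derivative f (at u) (axis i 1))"

definition hessian :: "(real ^ 'n::finite \<Rightarrow> real) \<Rightarrow> real ^ 'n \<Rightarrow> real ^ 'n ^ 'n" where
  "hessian f u = jacobian (gradient f) (at u)"

definition strictly_quasi_concave_at :: "(real ^ 'n::finite \<Rightarrow> real) \<Rightarrow> real ^ 'n \<Rightarrow> bool" where
  "strictly_quasi_concave_at f u \<longleftrightarrow>
     (\<forall>v. v \<noteq> 0 \<and> gradient f u \<bullet> v = 0 \<longrightarrow> 0 < - (v \<bullet> (hessian f u *v v)))"

definition quasi_concave_at :: "(real ^ 'n::finite \<Rightarrow> real) \<Rightarrow> real ^ 'n \<Rightarrow> bool" where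
  "quasi_concave_at f u \<longleftrightarrow>
     (\<forall>v. v \<noteq> 0 \<and> gradient f u \<bullet> v = 0 \<longrightarrow> 0 \<le> - (v \<bullet> (hessian f u *v v)))"


section \<open>Intrinsic polynomials\<close>

text \<open>The conditions on a single piece \<open>T\<close> and its polynomials \<open>f 1, \<dots>, f L\<close>. The components of
  the Zariski closure of the boundary are not named separately: they are the sets \<open>zeros (f i)\<close>.\<close>

definition intrinsic_piece ::
  "(real ^ 'n::finite) set \<Rightarrow> nat \<Rightarrow> (nat \<Rightarrow> 'n real_mpoly) \<Rightarrow> bool" where
  "intrinsic_piece T L f \<longleftrightarrow>
     bounded T \<and> basic_open_semialgebraic T \<and>
     zariski_closure (frontier (closure T)) = (\<Union>i\<in>{1..L}. zeros (f i)) \<and>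
     (\<forall>i\<in>{1..L}.
        irreducible_variety (zeros (f i)) \<and>
        variety_dim (zeros (f i)) = enat (CARD('n) - 1) \<and>
        \<not> zeros (f i) \<inter> frontier (closure T)
            \<subseteq> (\<Union>j\<in>{1..L} - {i}. zeros (f j)) \<inter> frontier (closure T) \<and>
        irreducible (f i) \<and>
        vanishing_ideal (zeros (f i)) = module.span (*) {f i}) \<and>
     (\<forall>u\<in>frontier (closure T).
        (\<forall>i\<in>{1..L}. u \<in> zeros (f i) \<longrightarrow> gradient (peval (f i)) u \<noteq> 0) \<longrightarrow>
        (\<exists>r0>0. \<forall>r. 0 < r \<and> r < r0 \<longrightarrow>
           closure T \<inter> cball u r = (\<Inter>i\<in>{1..L}. nonneg_set (f i)) \<inter> cball u r))"

definition intrinsic_system ::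
  "(real ^ 'n::finite) set \<Rightarrow> nat \<Rightarrow> (nat \<Rightarrow> nat) \<Rightarrow> (nat \<Rightarrow> nat \<Rightarrow> 'n real_mpoly) \<Rightarrow> bool" where
  "intrinsic_system S m L f \<longleftrightarrow>
     (\<exists>T :: nat \<Rightarrow> (real ^ 'n) set.
        interior S = (\<Union>k\<in>{1..m}. T k) \<and>
        (\<forall>k\<in>{1..m}. intrinsic_piece (T k) (L k) (f k)))"

definition irredundant_at :: "(real ^ 'n::finite) set \<Rightarrow> 'n real_mpoly \<Rightarrow> real ^ 'n \<Rightarrow> bool" where
  "irredundant_at S p u \<longleftrightarrow>
     (\<exists>(w :: nat \<Rightarrow> real ^ 'n) (\<epsilon> :: nat \<Rightarrow> real).
        w \<longlonglongrightarrow> u \<and>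
        (\<forall>N. w N \<in> frontier S \<and> 0 < \<epsilon> N \<and>
             S \<inter> ball (w N) (\<epsilon> N) = nonneg_set p \<inter> ball (w N) (\<epsilon> N)))"

end

theory Submission
  imports Defs
begin

text \<open>
  Part (2) needs only convexity: where \<open>S\<close> coincides locally with \<open>{f \<ge> 0}\<close> and \<open>\<nabla>f \<noteq> 0\<close>, convexity
  forces \<open>f\<close> to be quasi-concave, and quasi-concavity passes to limits of such points; at redundant
  points it is assumed.

  For part (1), a strictly quasi-concave \<open>f\<close> may be replaced near a zero \<open>u\<close> by \<open>g = f - M f\<^sup>2\<close>, which has
  the same sign and is strongly concave. On a ball of radius \<open>r\<close> around \<open>u\<close> the moment relaxation of
  \<open>{g \<ge> 0}\<close> is exact for small \<open>r\<close>: for a functional \<open>L\<close> with mean \<open>x\<close> and variance \<open>V\<close>, Taylor expansion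
  of \<open>g\<close> at \<open>u\<close> gives \<open>L g - g x \<le> (C r - c) V\<close>, because the quadratic part contributes at most \<open>- c V\<close>
  (a positive semidefinite form is a sum of squares) while each cubic term \<open>w\<^sub>i w\<^sub>j w\<^sub>k s\<close>, with \<open>w\<close>
  standing for \<open>x - u\<close>, contributes at most \<open>C r V\<close>. No Positivstellensatz is needed. Finally \<open>S\<close> is the
  convex hull of finitely many such local pieces covering its boundary.
\<close>

section \<open>Polynomials and linear functionals\<close>

text \<open>A feasible \<open>L\<close> is not an integral: it is only known to be linear, to have
  first moments \<open>x\<close>, and to be nonnegative on squares, and on the constraints times
  squares, of bounded degree. Whatever a measure would give for free (Cauchy-Schwarz, boundedness on
  the ball, Lipschitz bounds) is rederived from explicit squares, and each derivation consumes
  degree; hence a degree threshold accompanies the bounds. The order of quantifiers carries the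
  argument: thresholds and constants depend on the polynomial and on \<open>u\<close> only, so
  \<open>D\<close> can be fixed first and \<open>r\<close> shrunk afterwards. Gain and loss are both
  measured in multiples of the variance \<open>V\<close>, so their comparison does not depend on
  \<open>L\<close>. Exactness then reads \<open>0 <= L g <= g x\<close>. Convex hulls enter because
  near a boundary point \<open>S\<close> may be a union of several closures of sets
  \<open>T k\<close>, each with its own polynomials; each closure is representable near that point,
  while their union need not be given by one system of inequalities.\<close>

abbreviation cst :: "real \<Rightarrow> 'n::finite real_mpoly" where
  "cst c \<equiv> Poly_Mapping.single 0 c"

definition var :: "'n::finite \<Rightarrow> 'n real_mpoly" where
  "var i = Poly_Mapping.single (Poly_Mapping.single i 1) 1"

text \<open>The Riesz functional of a moment sequence: \<open>y e\<close> is the prescribed value on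
  the monomial with exponent vector \<open>e\<close>.\<close>

definition lin_ext :: "(('n::finite \<Rightarrow>\<^sub>0 nat) \<Rightarrow> real) \<Rightarrow> 'n real_mpoly \<Rightarrow> real" where
  "lin_ext y p = (\<Sum>e\<in>Poly_Mapping.keys p. Poly_Mapping.lookup p e * y e)"

definition functional :: "('n::finite real_mpoly \<Rightarrow> real) \<Rightarrow> bool" where
  "functional L \<longleftrightarrow> (\<forall>p q. L (p + q) = L p + L q) \<and> (\<forall>c p. L (cst c * p) = c * L p)"

lemma functionalD:
  assumes "functional L"
  shows "L (p + q) = L p + L q" "L (cst c * p) = c * L p"
  using assms by (auto simp: functional_def)

lemma lin_ext_superset:
  assumes "finite A" "Poly_Mapping.keys p \<subseteq> A"
  shows "lin_ext y p = (\<Sum>e\<in>A. Poly_Mapping.lookup p e * y e)"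
  unfolding lin_ext_def
  by (rule sum.mono_neutral_left) (use assms in \<open>auto simp: in_keys_iff\<close>)

lemma lookup_cst_mult:
  "Poly_Mapping.lookup (cst c * p) e = c * Poly_Mapping.lookup p e"
  by (simp add: map.rep_eq when_def flip: mult_map_scale_conv_mult)

lemma lin_ext_functional: "functional (lin_ext y)"
  unfolding functional_def
proof (intro conjI allI)
  fix p q :: "'a real_mpoly" and c :: real
  let ?A = "Poly_Mapping.keys p \<union> Poly_Mapping.keys q"
  have "lin_ext y (p + q) = (\<Sum>e\<in>?A. Poly_Mapping.lookup (p + q) e * y e)"
    by (rule lin_ext_superset) (use keys_add[of p q] in auto)
  moreover have "lin_ext y p = (\<Sum>e\<in>?A. Poly_Mapping.lookup p e * y e)"
    by (rule lin_ext_superset) auto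
  moreover have "lin_ext y q = (\<Sum>e\<in>?A. Poly_Mapping.lookup q e * y e)"
    by (rule lin_ext_superset) auto
  ultimately show "lin_ext y (p + q) = lin_ext y p + lin_ext y q"
    by (simp add: lookup_add algebra_simps sum.distrib)
  have "lin_ext y (cst c * p) = (\<Sum>e\<in>Poly_Mapping.keys p. Poly_Mapping.lookup (cst c * p) e * y e)"
    by (rule lin_ext_superset) (auto simp: in_keys_iff lookup_cst_mult)
  also have "\<dots> = c * lin_ext y p"
    by (simp add: lookup_cst_mult lin_ext_def sum_distrib_left mult.assoc)
  finally show "lin_ext y (cst c * p) = c * lin_ext y p" .
qed

lemma lin_ext_single [simp]: "lin_ext y (Poly_Mapping.single e c) = c * y e"
  by (cases "c = 0") (auto simp: lin_ext_def)

lemma sum_single_keys: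
  "p = (\<Sum>e\<in>Poly_Mapping.keys p. Poly_Mapping.single e (Poly_Mapping.lookup p e))"
proof (rule poly_mapping_eqI)
  fix k
  have "Poly_Mapping.lookup (\<Sum>e\<in>Poly_Mapping.keys p. Poly_Mapping.single e (Poly_Mapping.lookup p e)) k
      = (\<Sum>e\<in>Poly_Mapping.keys p. if e = k then Poly_Mapping.lookup p e else 0)"
    by (simp add: lookup_sum lookup_single when_def)
  also have "\<dots> = Poly_Mapping.lookup p k"
    by (auto simp: in_keys_iff)
  finally show "Poly_Mapping.lookup p k
      = Poly_Mapping.lookup (\<Sum>e\<in>Poly_Mapping.keys p. Poly_Mapping.single e (Poly_Mapping.lookup p e)) k"
    by simp
qed

lemma single_eq_cst_mult: "Poly_Mapping.single e c = cst c * Poly_Mapping.single e 1"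
  by (simp add: mult_single)

lemma functional_sum:
  assumes "functional L"
  shows "L 0 = 0" "L (\<Sum>a\<in>A. F a) = (\<Sum>a\<in>A. L (F a))"
proof -
  show 0: "L 0 = 0"
    using functionalD(2)[OF assms, of 0 0] by simp
  show "L (\<Sum>a\<in>A. F a) = (\<Sum>a\<in>A. L (F a))"
    by (induction A rule: infinite_finite_induct) (auto simp: 0 functionalD(1)[OF assms])
qed

lemma functional_minus:
  assumes "functional L"
  shows "L (- p) = - L p" "L (p - q) = L p - L q"
proof -
  have *: "L (- p) = - L p" for p
    using functionalD(1)[OF assms, of p "- p"] functional_sum(1)[OF assms] by simp
  show "L (- p) = - L p" by (rule *)
  show "L (p - q) = L p - L q"
    using functionalD(1)[OF assms, of p "- q"] * by simp
qed

text \<open>Monomials form a basis, so a functional is the same thing as its moment sequence; this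
  lets a quantifier over functionals become one over lifting variables.\<close>

lemma functional_eq_lin_ext:
  assumes "functional L"
  shows "L = lin_ext (\<lambda>e. L (Poly_Mapping.single e 1))"
proof
  fix p
  have "L p = (\<Sum>e\<in>Poly_Mapping.keys p. L (Poly_Mapping.single e (Poly_Mapping.lookup p e)))"
    by (subst sum_single_keys) (rule functional_sum(2)[OF assms])
  also have "\<dots> = lin_ext (\<lambda>e. L (Poly_Mapping.single e 1)) p"
    unfolding lin_ext_def
    by (rule sum.cong[OF refl]) (subst single_eq_cst_mult, rule functionalD(2)[OF assms])
  finally show "L p = lin_ext (\<lambda>e. L (Poly_Mapping.single e 1)) p" .
qed

section \<open>Induction principles for polynomials\<close>

lemma single_induct:
  fixes e :: "'n::finite \<Rightarrow>\<^sub>0 nat"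
  assumes one: "P 1" and var: "\<And>i. P (var i)" and mult: "\<And>p q. P p \<Longrightarrow> P q \<Longrightarrow> P (p * q)"
  shows "P (Poly_Mapping.single e 1 :: 'n real_mpoly)"
proof (induction e rule: update_induct)
  case const
  then show ?case using one by simp
next
  case (update e i b)
  have pow: "P (Poly_Mapping.single (Poly_Mapping.single i b) 1)" for b
  proof (induction b)
    case 0
    then show ?case using one by simp
  next
    case (Suc b)
    have "Poly_Mapping.single (Poly_Mapping.single i (Suc b)) (1::real)
        = var i * Poly_Mapping.single (Poly_Mapping.single i b) 1"
      by (simp add: var_def mult_single flip: single_add)
    then show ?case using mult[OF var Suc] by simp
  qed
  \<comment> \<open>The coordinate \<open>i\<close> does not occur in \<open>e\<close>, so
    overwriting its exponent amounts to adding to it, that is, to multiplying monomials.\<close>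
  have "Poly_Mapping.update i b e = e + Poly_Mapping.single i b"
    by (rule poly_mapping_eqI)
      (use update in \<open>auto simp: lookup_update lookup_add lookup_single in_keys_iff when_def\<close>)
  then have "Poly_Mapping.single (Poly_Mapping.update i b e) (1::real)
      = Poly_Mapping.single e 1 * Poly_Mapping.single (Poly_Mapping.single i b) 1"
    by (simp add: mult_single)
  then show ?case using mult[OF update(3) pow] by simp
qed

text \<open>The induction behind the Taylor expansion, the derivatives and the bounds uniform in
  \<open>L\<close>: each such claim only has to survive sums and products.\<close>

lemma mpoly_induct [case_names cst var add mult]:
  fixes p :: "'n::finite real_mpoly"
  assumes cst: "\<And>c. P (cst c)" and var: "\<And>i. P (var i)"
    and add: "\<And>p q. P p \<Longrightarrow> P q \<Longrightarrow> P (p + q)" and mult: "\<And>p q. P p \<Longrightarrow> P q \<Longrightarrow> P (p * q)"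
  shows "P p"
proof -
  have single: "P (Poly_Mapping.single e c)" for e c
    by (subst single_eq_cst_mult, rule mult[OF cst], rule single_induct)
      (use cst[of 1] in \<open>auto intro: var mult\<close>)
  have "P (\<Sum>e\<in>A. Poly_Mapping.single e (Poly_Mapping.lookup p e))" for A
    by (induction A rule: infinite_finite_induct)
      (use cst[of 0] in \<open>auto intro: add single\<close>)
  then show ?thesis by (subst sum_single_keys)
qed


section \<open>Evaluation\<close>

lemma peval_eq_lin_ext: "peval p x = lin_ext (\<lambda>e. \<Prod>i\<in>UNIV. (x $ i) ^ Poly_Mapping.lookup e i) p"
  by (simp add: peval_def lin_ext_def)

lemma peval_functional: "functional (\<lambda>p. peval p x)"
  unfolding peval_eq_lin_ext by (rule lin_ext_functional)

lemma peval_cst [simp]: "peval (cst c) x = c"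
  by (simp add: peval_eq_lin_ext)

lemma peval_0 [simp]: "peval 0 x = 0" and peval_1 [simp]: "peval 1 x = 1"
  using peval_cst[of 0 x] peval_cst[of 1 x] by (simp_all del: peval_cst)

lemma peval_var [simp]: "peval (var i) x = x $ i"
proof -
  have "(\<Prod>j\<in>UNIV. (x $ j) ^ (if i = j then 1 else 0)) = (\<Prod>j\<in>UNIV. if i = j then x $ j else 1)"
    by (rule prod.cong) auto
  then show ?thesis
    by (simp add: var_def peval_eq_lin_ext lookup_single when_def del: One_nat_def)
qed

lemma peval_add [simp]: "peval (p + q) x = peval p x + peval q x"
  by (rule functionalD(1)[OF peval_functional])

lemma peval_diff [simp]: "peval (p - q) x = peval p x - peval q x"
  by (rule functional_minus(2)[OF peval_functional])

lemma peval_sum [simp]: "peval (\<Sum>a\<in>A. F a) x = (\<Sum>a\<in>A. peval (F a) x)"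
  by (rule functional_sum(2)[OF peval_functional])

lemma peval_single: "peval (Poly_Mapping.single e c) x = c * (\<Prod>i\<in>UNIV. (x $ i) ^ Poly_Mapping.lookup e i)"
  by (simp add: peval_eq_lin_ext)

lemma peval_mult [simp]: "peval (p * q) x = peval p x * peval q x"
proof -
  have single: "peval (Poly_Mapping.single e c * Poly_Mapping.single e' c') x
      = peval (Poly_Mapping.single e c) x * peval (Poly_Mapping.single e' c') x" for e e' c c'
    by (simp add: mult_single peval_single lookup_add power_add prod.distrib)
  have "peval (p * q) x = peval ((\<Sum>e\<in>Poly_Mapping.keys p. Poly_Mapping.single e (Poly_Mapping.lookup p e))
      * (\<Sum>e\<in>Poly_Mapping.keys q. Poly_Mapping.single e (Poly_Mapping.lookup q e))) x"
    by (simp flip: sum_single_keys)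
  also have "\<dots> = peval (\<Sum>e\<in>Poly_Mapping.keys p. Poly_Mapping.single e (Poly_Mapping.lookup p e)) x
      * peval (\<Sum>e\<in>Poly_Mapping.keys q. Poly_Mapping.single e (Poly_Mapping.lookup q e)) x"
    by (simp add: sum_product single)
  finally show ?thesis by (simp flip: sum_single_keys)
qed

lemma continuous_on_peval [continuous_intros]:
  assumes "continuous_on A h"
  shows "continuous_on A (\<lambda>x. peval p (h x))"
  unfolding peval_def by (intro continuous_intros assms)

lemma continuous_peval [continuous_intros]:
  assumes "continuous F h"
  shows "continuous F (\<lambda>x. peval p (h x))"
  unfolding peval_def by (intro continuous_intros assms)

lemma tendsto_peval [tendsto_intros]:
  assumes "(h \<longlongrightarrow> l) F"
  shows "((\<lambda>x. peval p (h x)) \<longlongrightarrow> peval p l) F"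
  unfolding peval_def by (intro tendsto_intros assms)


section \<open>Taylor expansion at a point\<close>

definition vshift :: "real ^ 'n::finite \<Rightarrow> 'n \<Rightarrow> 'n real_mpoly" where
  "vshift u i = var i - cst (u $ i)"

lemma peval_vshift [simp]: "peval (vshift u i) x = x $ i - u $ i"
  by (simp add: vshift_def)

text \<open>Hadamard's lemma: the polynomials vanishing at \<open>u\<close> are generated by the
  \<open>vshift u i\<close>. For products,
  \<open>p q - p(u) q(u) = p(u) (q - q(u)) + (p - p(u)) q\<close>.\<close>

lemma taylor1:
  fixes p :: "'n::finite real_mpoly"
  shows "\<exists>P. p = cst (peval p u) + (\<Sum>i\<in>UNIV. vshift u i * P i)"
proof (induction p rule: mpoly_induct)
  case (cst c)
  show ?case by (rule exI[of _ "\<lambda>_. 0"]) simp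
next
  case (var i)
  have "(\<Sum>j\<in>UNIV. vshift u j * (if j = i then 1 else 0)) = (\<Sum>j\<in>UNIV. if j = i then vshift u j else 0)"
    by (rule sum.cong) auto
  then show ?case
    by (intro exI[of _ "\<lambda>j. if j = i then 1 else 0"]) (simp add: vshift_def)
next
  case (add p q)
  then obtain P Q where PQ: "p = cst (peval p u) + (\<Sum>i\<in>UNIV. vshift u i * P i)"
    "q = cst (peval q u) + (\<Sum>i\<in>UNIV. vshift u i * Q i)" by blast
  have "p + q = cst (peval (p + q) u) + (\<Sum>i\<in>UNIV. vshift u i * (P i + Q i))"
    by (subst (1) PQ(1), subst (1) PQ(2)) (simp add: single_add sum.distrib algebra_simps)
  then show ?case by (rule exI[where x = "\<lambda>i. P i + Q i"])
next
  case (mult p q)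
  then obtain P Q where PQ: "p = cst (peval p u) + (\<Sum>i\<in>UNIV. vshift u i * P i)"
    "q = cst (peval q u) + (\<Sum>i\<in>UNIV. vshift u i * Q i)" by blast
  define A B where "A = (cst (peval p u) :: 'n real_mpoly)" and "B = (cst (peval q u) :: 'n real_mpoly)"
  have AB: "cst (peval (p * q) u) = A * B"
    by (simp add: A_def B_def mult_single)
  have "p * q = A * q + (\<Sum>i\<in>UNIV. vshift u i * P i) * q"
    by (subst (1) PQ(1)) (simp only: A_def distrib_right)
  also have "A * q = A * B + A * (\<Sum>i\<in>UNIV. vshift u i * Q i)"
    by (subst (1) PQ(2)) (simp only: B_def distrib_left)
  also have "A * (\<Sum>i\<in>UNIV. vshift u i * Q i) = (\<Sum>i\<in>UNIV. vshift u i * (A * Q i))"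
    unfolding sum_distrib_left by (intro sum.cong refl mult.left_commute)
  also have "(\<Sum>i\<in>UNIV. vshift u i * P i) * q = (\<Sum>i\<in>UNIV. vshift u i * (P i * q))"
    unfolding sum_distrib_right by (intro sum.cong refl mult.assoc)
  finally have "p * q = cst (peval (p * q) u) + (\<Sum>i\<in>UNIV. vshift u i * (A * Q i + P i * q))"
    unfolding AB distrib_left sum.distrib by (simp only: add.assoc)
  then show ?case
    by (rule exI[where x = "\<lambda>i. A * Q i + P i * q"])
qed

text \<open>An exact identity with polynomial cofactors in place of a remainder estimate, since a
  functional on polynomials can be applied to identities but not to error terms.\<close>

lemma taylor2:
  fixes p :: "'n::finite real_mpoly"
  obtains b P where "p = cst (peval p u) + (\<Sum>i\<in>UNIV. vshift u i * cst (b i))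
    + (\<Sum>i\<in>UNIV. \<Sum>j\<in>UNIV. vshift u i * vshift u j * P i j)"
proof -
  obtain Q where Q: "p = cst (peval p u) + (\<Sum>i\<in>UNIV. vshift u i * Q i)"
    using taylor1[of p u] ..
  have "\<forall>i. \<exists>P. Q i = cst (peval (Q i) u) + (\<Sum>j\<in>UNIV. vshift u j * P j)"
    by (intro allI taylor1)
  from choice[OF this] obtain P
    where P: "\<forall>i. Q i = cst (peval (Q i) u) + (\<Sum>j\<in>UNIV. vshift u j * P i j)" ..
  have "(\<Sum>i\<in>UNIV. vshift u i * Q i) = (\<Sum>i\<in>UNIV. vshift u i * (cst (peval (Q i) u) + (\<Sum>j\<in>UNIV. vshift u j * P i j)))"
    using P by simp
  also have "\<dots> = (\<Sum>i\<in>UNIV. vshift u i * cst (peval (Q i) u))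
    + (\<Sum>i\<in>UNIV. \<Sum>j\<in>UNIV. vshift u i * vshift u j * P i j)"
    by (simp only: distrib_left sum.distrib sum_distrib_left mult.assoc)
  finally show thesis
    using Q by (intro that[of "\<lambda>i. peval (Q i) u" P]) (simp only: add.assoc)
qed


section \<open>Semidefinite representability from blocks of affine forms\<close>

definition affine_form :: "'j set \<Rightarrow> (real ^ 'n::finite \<Rightarrow> ('j \<Rightarrow> real) \<Rightarrow> real) \<Rightarrow> bool" where
  "affine_form J \<phi> \<longleftrightarrow>
     (\<exists>a b c. \<forall>x u. \<phi> x u = a + (\<Sum>i\<in>UNIV. x $ i * b i) + (\<Sum>j\<in>J. u j * c j))"

lemma affine_formI:
  "(\<And>x u. \<phi> x u = a + (\<Sum>i\<in>UNIV. x $ i * b i) + (\<Sum>j\<in>J. u j * c j)) \<Longrightarrow> affine_form J \<phi>"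
  unfolding affine_form_def by blast

lemma affine_form_const: "affine_form J (\<lambda>x u. a)"
  by (rule affine_formI[where a = a and b = "\<lambda>_. 0" and c = "\<lambda>_. 0"]) simp

lemma affine_form_nth: "affine_form J (\<lambda>x u. x $ i)"
  by (rule affine_formI[where a = 0 and b = "\<lambda>k. if k = i then 1 else 0" and c = "\<lambda>_. 0"])
    (simp add: if_distrib cong: if_cong)

lemma affine_form_var: "finite J \<Longrightarrow> j \<in> J \<Longrightarrow> affine_form J (\<lambda>x u. u j)"
  by (rule affine_formI[where a = 0 and b = "\<lambda>_. 0" and c = "\<lambda>k. if k = j then 1 else 0"])
    (simp add: if_distrib cong: if_cong)

lemma affine_form_add:
  assumes "affine_form J \<phi>" "affine_form J \<psi>"
  shows "affine_form J (\<lambda>x u. \<phi> x u + \<psi> x u)"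
proof -
  obtain a b c where 1: "\<And>x u. \<phi> x u = a + (\<Sum>i\<in>UNIV. x $ i * b i) + (\<Sum>j\<in>J. u j * c j)"
    using assms(1) unfolding affine_form_def by blast
  obtain a' b' c' where 2: "\<And>x u. \<psi> x u = a' + (\<Sum>i\<in>UNIV. x $ i * b' i) + (\<Sum>j\<in>J. u j * c' j)"
    using assms(2) unfolding affine_form_def by blast
  show ?thesis
    by (rule affine_formI[where a = "a + a'" and b = "\<lambda>i. b i + b' i" and c = "\<lambda>j. c j + c' j"])
      (simp add: 1 2 distrib_left sum.distrib)
qed

lemma affine_form_cmult:
  assumes "affine_form J \<phi>"
  shows "affine_form J (\<lambda>x u. k * \<phi> x u)"
proof -
  obtain a b c where 1: "\<And>x u. \<phi> x u = a + (\<Sum>i\<in>UNIV. x $ i * b i) + (\<Sum>j\<in>J. u j * c j)"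
    using assms(1) unfolding affine_form_def by blast
  show ?thesis
    by (rule affine_formI[where a = "k * a" and b = "\<lambda>i. k * b i" and c = "\<lambda>j. k * c j"])
      (simp add: 1 distrib_left sum_distrib_left mult.left_commute)
qed

lemma affine_form_cmult_right: "affine_form J \<phi> \<Longrightarrow> affine_form J (\<lambda>x u. \<phi> x u * k)"
  using affine_form_cmult[of J \<phi> k] by (simp add: mult.commute)

lemma affine_form_diff:
  "affine_form J \<phi> \<Longrightarrow> affine_form J \<psi> \<Longrightarrow> affine_form J (\<lambda>x u. \<phi> x u - \<psi> x u)"
  using affine_form_add[OF _ affine_form_cmult[of J \<psi> "-1"], of \<phi>] by simp

lemma affine_form_sum:
  "(\<And>a. a \<in> A \<Longrightarrow> affine_form J (\<phi> a)) \<Longrightarrow> affine_form J (\<lambda>x u. \<Sum>a\<in>A. \<phi> a x u)"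
  by (induction A rule: infinite_finite_induct) (auto intro: affine_form_add affine_form_const)

lemmas affine_form_intros = affine_form_const affine_form_nth affine_form_add affine_form_diff
  affine_form_cmult affine_form_cmult_right affine_form_sum

section \<open>Quadratic forms and block-diagonal matrices\<close>

abbreviation quad :: "'i set \<Rightarrow> ('i \<Rightarrow> 'i \<Rightarrow> real) \<Rightarrow> ('i \<Rightarrow> real) \<Rightarrow> real" where
  "quad I M v \<equiv> \<Sum>p\<in>I. \<Sum>q\<in>I. v p * M p q * v q"

text \<open>Averaging with the transpose leaves the quadratic form unchanged, so block entries may
  be given without any symmetry.\<close>

definition sym_block :: "('k \<Rightarrow> 'i \<Rightarrow> 'i \<Rightarrow> real) \<Rightarrow> 'k \<times> 'i \<Rightarrow> 'k \<times> 'i \<Rightarrow> real" where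
  "sym_block M P Q = (if fst P = fst Q
     then (M (fst P) (snd P) (snd Q) + M (fst P) (snd Q) (snd P)) / 2 else 0)"

lemma quad_lin:
  "quad I (\<lambda>p q. s * M p q + t * M' p q) v = s * quad I M v + t * quad I M' v"
  by (simp add: sum_distrib_left sum.distrib algebra_simps)

lemma quad_transpose: "quad I (\<lambda>p q. M q p) v = quad I M v"
  by (subst sum.swap) (simp add: ac_simps)

lemma quad_sym_block:
  assumes "finite K" "\<And>k. k \<in> K \<Longrightarrow> finite (I k)"
  shows "quad (Sigma K I) (sym_block M) w = (\<Sum>k\<in>K. quad (I k) (M k) (\<lambda>p. w (k, p)))"
proof -
  have Sg: "(\<Sum>P\<in>Sigma K I. F P) = (\<Sum>k\<in>K. \<Sum>p\<in>I k. F (k, p))" for F :: "'a \<times> 'b \<Rightarrow> real"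
    using assms by (simp add: sum.Sigma)
  have "quad (Sigma K I) (sym_block M) w
      = (\<Sum>k\<in>K. \<Sum>p\<in>I k. \<Sum>k'\<in>K. \<Sum>q\<in>I k'. w (k, p) * sym_block M (k, p) (k', q) * w (k', q))"
    unfolding Sg ..
  also have "\<dots> = (\<Sum>k\<in>K. \<Sum>p\<in>I k. \<Sum>k'\<in>K. if k = k' then
      (\<Sum>q\<in>I k. w (k, p) * ((M k p q + M k q p) / 2) * w (k, q)) else 0)"
    by (intro sum.cong refl) (auto simp: sym_block_def)
  also have "\<dots> = (\<Sum>k\<in>K. quad (I k) (\<lambda>p q. (M k p q + M k q p) / 2) (\<lambda>p. w (k, p)))"
    using assms by simp
  also have "\<dots> = (\<Sum>k\<in>K. quad (I k) (M k) (\<lambda>p. w (k, p)))"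
  proof (rule sum.cong[OF refl])
    fix k
    let ?w = "\<lambda>p. w (k, p)"
    have "quad (I k) (\<lambda>p q. (M k p q + M k q p) / 2) ?w
        = (quad (I k) (M k) ?w + quad (I k) (\<lambda>p q. M k q p) ?w) / 2"
      using quad_lin[where s = "1 / 2" and t = "1 / 2" and M = "M k" and M' = "\<lambda>p q. M k q p"
          and I = "I k" and v = ?w]
      by (simp add: add_divide_distrib)
    then show "quad (I k) (\<lambda>p q. (M k p q + M k q p) / 2) ?w = quad (I k) (M k) ?w"
      using quad_transpose[where I = "I k" and M = "M k" and v = ?w] by simp
  qed
  finally show ?thesis .
qed

lemma quad_reindex:
  assumes "bij_betw a A I"
  shows "quad A (\<lambda>p q. M (a p) (a q)) (\<lambda>p. w (a p)) = quad I M w"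
  by (simp add: sum.reindex_bij_betw[OF assms, of "\<lambda>P. \<Sum>Q\<in>I. w P * M P Q * w Q"]
      sum.reindex_bij_betw[OF assms, of "\<lambda>Q. w P * M P Q * w Q" for P])

text \<open>Several linear matrix inequalities are one, block-diagonal. Blocks, rows and lifting
  variables have arbitrary finite index sets, so later constructions can index by exponent vectors
  or tagged sums, and the numbering is done here once.\<close>

theorem sdp_representable_blocks:
  fixes S :: "(real ^ 'n::finite) set" and M :: "'k \<Rightarrow> 'i \<Rightarrow> 'i \<Rightarrow> real ^ 'n \<Rightarrow> ('j \<Rightarrow> real) \<Rightarrow> real"
  assumes K: "finite K" and I: "\<And>k. k \<in> K \<Longrightarrow> finite (I k)" and J: "finite J"
    and M: "\<And>k p q. k \<in> K \<Longrightarrow> p \<in> I k \<Longrightarrow> q \<in> I k \<Longrightarrow> affine_form J (M k p q)"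
    and S: "S = {x. \<exists>u. \<forall>k\<in>K. \<forall>v. 0 \<le> quad (I k) (\<lambda>p q. M k p q x u) v}"
  shows "sdp_representable S"
proof -
  have "\<forall>k p q. \<exists>a b c. k \<in> K \<and> p \<in> I k \<and> q \<in> I k \<longrightarrow>
      (\<forall>x u. M k p q x u = a + (\<Sum>i\<in>UNIV. x $ i * b i) + (\<Sum>j\<in>J. u j * c j))"
    using M unfolding affine_form_def by blast
  then obtain a0 b0 c0 where "\<forall>k p q. k \<in> K \<and> p \<in> I k \<and> q \<in> I k \<longrightarrow>
      (\<forall>x u. M k p q x u = a0 k p q + (\<Sum>i\<in>UNIV. x $ i * b0 k p q i) + (\<Sum>j\<in>J. u j * c0 k p q j))"
    unfolding choice_iff by (elim exE)
  then have abc: "\<And>k p q x u. k \<in> K \<Longrightarrow> p \<in> I k \<Longrightarrow> q \<in> I k \<Longrightarrow>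
      M k p q x u = a0 k p q + (\<Sum>i\<in>UNIV. x $ i * b0 k p q i) + (\<Sum>j\<in>J. u j * c0 k p q j)"
    by blast
  define IS where "IS = Sigma K I"
  have "finite IS" unfolding IS_def using K I by auto
  define d where "d = card IS"
  define N where "N = card J"
  obtain a where a: "bij_betw a {..<d} IS"
    using ex_bij_betw_nat_finite[OF \<open>finite IS\<close>] unfolding d_def atLeast0LessThan by blast
  obtain b where b: "bij_betw b {..<N} J"
    using ex_bij_betw_nat_finite[OF J] unfolding N_def atLeast0LessThan by blast
  define A0 where "A0 = (\<lambda>p q. sym_block a0 (a p) (a q))"
  define A where "A = (\<lambda>i p q. sym_block (\<lambda>k p q. b0 k p q i) (a p) (a q))"
  define B where "B = (\<lambda>j p q. sym_block (\<lambda>k p q. c0 k p q (b j)) (a p) (a q))"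
  have sym: "symmetric_matrix d A0" "symmetric_matrix d (A i)" "symmetric_matrix d (B j)" for i j
    by (auto simp: symmetric_matrix_def A0_def A_def B_def sym_block_def)
  have entry: "A0 p q + (\<Sum>i\<in>UNIV. x $ i * A i p q) + (\<Sum>j<N. u (b j) * B j p q)
      = sym_block (\<lambda>k p q. M k p q x u) (a p) (a q)" if "p < d" "q < d" for p q x u
  proof -
    obtain k r l s where pq: "a p = (k, r)" "a q = (l, s)" by (metis surj_pair)
    have mem: "k \<in> K" "r \<in> I k" "l \<in> K" "s \<in> I l"
      using bij_betwE[OF a] that pq unfolding IS_def by (metis lessThan_iff mem_Sigma_iff)+
    show ?thesis
    proof (cases "k = l")
      case False
      then show ?thesis by (simp add: A0_def A_def B_def sym_block_def pq)
    next
      case True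
      then have s: "s \<in> I k" using mem by simp
      have "(\<Sum>j<N. u (b j) * B j p q)
          = (\<Sum>j<N. (\<lambda>j. u j * ((c0 k r s j + c0 k s r j) / 2)) (b j))"
        using True by (simp add: B_def sym_block_def pq)
      also have "\<dots> = (\<Sum>j\<in>J. u j * ((c0 k r s j + c0 k s r j) / 2))"
        by (rule sum.reindex_bij_betw[OF b])
      also have "\<dots> = ((\<Sum>j\<in>J. u j * c0 k r s j) + (\<Sum>j\<in>J. u j * c0 k s r j)) / 2"
        by (simp add: sum.distrib sum_divide_distrib add_divide_distrib distrib_left)
      finally have u: "(\<Sum>j<N. u (b j) * B j p q)
        = ((\<Sum>j\<in>J. u j * c0 k r s j) + (\<Sum>j\<in>J. u j * c0 k s r j)) / 2" .
      have x: "(\<Sum>i\<in>UNIV. x $ i * A i p q)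
          = ((\<Sum>i\<in>UNIV. x $ i * b0 k r s i) + (\<Sum>i\<in>UNIV. x $ i * b0 k s r i)) / 2"
        using True
        by (simp add: A_def sym_block_def pq sum.distrib sum_divide_distrib add_divide_distrib distrib_left)
      have "sym_block (\<lambda>k p q. M k p q x u) (a p) (a q) = (M k r s x u + M k s r x u) / 2"
        using True by (simp add: sym_block_def pq)
      also have "\<dots> = A0 p q + (\<Sum>i\<in>UNIV. x $ i * A i p q) + (\<Sum>j<N. u (b j) * B j p q)"
        unfolding u x abc[OF \<open>k \<in> K\<close> \<open>r \<in> I k\<close> s] abc[OF \<open>k \<in> K\<close> s \<open>r \<in> I k\<close>]
        using True by (simp add: A0_def sym_block_def pq field_simps)
      finally show ?thesis ..
    qed
  qed
  have psd: "psd_matrix d (\<lambda>p q. A0 p q + (\<Sum>i\<in>UNIV. x $ i * A i p q) + (\<Sum>j<N. u (b j) * B j p q))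
      \<longleftrightarrow> (\<forall>k\<in>K. \<forall>v. 0 \<le> quad (I k) (\<lambda>p q. M k p q x u) v)" (is "?l \<longleftrightarrow> ?r") for x u
  proof -
    have "?l \<longleftrightarrow> (\<forall>v. 0 \<le> quad {..<d} (\<lambda>p q. sym_block (\<lambda>k p q. M k p q x u) (a p) (a q)) v)"
      unfolding psd_matrix_def symmetric_matrix_def using entry
      by (auto simp: sym_block_def)
    also have "\<dots> \<longleftrightarrow> (\<forall>w. 0 \<le> quad IS (sym_block (\<lambda>k p q. M k p q x u)) w)"
    proof (intro iffI allI)
      fix w assume "\<forall>v. 0 \<le> quad {..<d} (\<lambda>p q. sym_block (\<lambda>k p q. M k p q x u) (a p) (a q)) v"
      from this[rule_format, of "\<lambda>p. w (a p)"]
      show "0 \<le> quad IS (sym_block (\<lambda>k p q. M k p q x u)) w"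
        unfolding quad_reindex[OF a, where M = "sym_block (\<lambda>k p q. M k p q x u)" and w = w] .
    next
      fix v :: "nat \<Rightarrow> real" assume *: "\<forall>w. 0 \<le> quad IS (sym_block (\<lambda>k p q. M k p q x u)) w"
      \<comment> \<open>Every vector on \<open>{..<d}\<close> is the pullback along \<open>a\<close>
        of one on \<open>IS\<close>.\<close>
      define w where "w = (\<lambda>P. v (inv_into {..<d} a P))"
      have "quad {..<d} (\<lambda>p q. sym_block (\<lambda>k p q. M k p q x u) (a p) (a q)) v
          = quad {..<d} (\<lambda>p q. sym_block (\<lambda>k p q. M k p q x u) (a p) (a q)) (\<lambda>p. w (a p))"
        unfolding w_def using bij_betw_inv_into_left[OF a] by simp
      also have "\<dots> = quad IS (sym_block (\<lambda>k p q. M k p q x u)) w"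
        by (rule quad_reindex[OF a])
      finally show "0 \<le> quad {..<d} (\<lambda>p q. sym_block (\<lambda>k p q. M k p q x u) (a p) (a q)) v"
        using * by simp
    qed
    also have "\<dots> \<longleftrightarrow> ?r"
    proof (intro iffI ballI allI)
      fix k and v :: "'i \<Rightarrow> real" assume *: "\<forall>w. 0 \<le> quad IS (sym_block (\<lambda>k p q. M k p q x u)) w" and k: "k \<in> K"
      \<comment> \<open>Testing with a vector supported on block \<open>k\<close> isolates that
        block.\<close>
      define w where "w = (\<lambda>P. if fst P = k then v (snd P) else 0)"
      have "quad IS (sym_block (\<lambda>k p q. M k p q x u)) w
          = (\<Sum>l\<in>K. quad (I l) (\<lambda>p q. M l p q x u) (\<lambda>p. w (l, p)))"
        unfolding IS_def using K I by (rule quad_sym_block)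
      also have "\<dots> = (\<Sum>l\<in>K. if l = k then quad (I k) (\<lambda>p q. M k p q x u) v else 0)"
        by (rule sum.cong) (auto simp: w_def)
      also have "\<dots> = quad (I k) (\<lambda>p q. M k p q x u) v"
        using K k by simp
      finally show "0 \<le> quad (I k) (\<lambda>p q. M k p q x u) v"
        using *[rule_format, of w] by simp
    next
      fix w :: "'k \<times> 'i \<Rightarrow> real" assume "?r"
      have "quad IS (sym_block (\<lambda>k p q. M k p q x u)) w
          = (\<Sum>l\<in>K. quad (I l) (\<lambda>p q. M l p q x u) (\<lambda>p. w (l, p)))"
        unfolding IS_def using K I by (rule quad_sym_block)
      also have "\<dots> \<ge> 0"
        by (rule sum_nonneg) (rule \<open>?r\<close>[rule_format])
      finally show "0 \<le> quad IS (sym_block (\<lambda>k p q. M k p q x u)) w" .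
    qed
    finally show ?thesis .
  qed
  have "S = {x. \<exists>u. psd_matrix d
      (\<lambda>p q. A0 p q + (\<Sum>i\<in>UNIV. x $ i * A i p q) + (\<Sum>j<N. u j * B j p q))}" (is "S = ?R")
  proof (intro equalityI subsetI)
    fix x assume "x \<in> S"
    then obtain u where "\<forall>k\<in>K. \<forall>v. 0 \<le> quad (I k) (\<lambda>p q. M k p q x u) v"
      using S by blast
    then have "psd_matrix d
        (\<lambda>p q. A0 p q + (\<Sum>i\<in>UNIV. x $ i * A i p q) + (\<Sum>j<N. u (b j) * B j p q))"
      unfolding psd .
    then show "x \<in> ?R" by (intro CollectI exI)
  next
    fix x assume "x \<in> ?R"
    then obtain u where u: "psd_matrix d
        (\<lambda>p q. A0 p q + (\<Sum>i\<in>UNIV. x $ i * A i p q) + (\<Sum>j<N. u j * B j p q))" by blast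
    define u' where "u' = (\<lambda>j. u (inv_into {..<N} b j))"
    have "(\<Sum>j<N. u j * B j p q) = (\<Sum>j<N. u' (b j) * B j p q)" for p q
      unfolding u'_def using bij_betw_inv_into_left[OF b] by simp
    then have "psd_matrix d
        (\<lambda>p q. A0 p q + (\<Sum>i\<in>UNIV. x $ i * A i p q) + (\<Sum>j<N. u' (b j) * B j p q))"
      using u by simp
    then show "x \<in> S"
      unfolding psd S by blast
  qed
  then show ?thesis
    unfolding sdp_representable_def using sym by blast
qed


section \<open>Convex hulls of unions\<close>

text \<open>The constant term is multiplied by \<open>l\<close>, which makes the pencil jointly
  linear in \<open>(l, x, u)\<close>: it describes the cone over the set placed at height 1.\<close>

definition lmi :: "nat \<Rightarrow> (nat \<Rightarrow> nat \<Rightarrow> real) \<Rightarrow> ('n::finite \<Rightarrow> nat \<Rightarrow> nat \<Rightarrow> real)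
    \<Rightarrow> (nat \<Rightarrow> nat \<Rightarrow> nat \<Rightarrow> real) \<Rightarrow> real \<Rightarrow> real ^ 'n \<Rightarrow> (nat \<Rightarrow> real) \<Rightarrow> nat \<Rightarrow> nat \<Rightarrow> real" where
  "lmi N A0 A B l x u p q = l * A0 p q + (\<Sum>i\<in>UNIV. x $ i * A i p q) + (\<Sum>j<N. u j * B j p q)"

lemma lmi_lin:
  "lmi N A0 A B (s * l + t * l') (s *\<^sub>R x + t *\<^sub>R x') (\<lambda>j. s * u j + t * u' j) p q
   = s * lmi N A0 A B l x u p q + t * lmi N A0 A B l' x' u' p q"
proof -
  have 1: "(\<Sum>i\<in>UNIV. (s *\<^sub>R x + t *\<^sub>R x') $ i * A i p q)
      = s * (\<Sum>i\<in>UNIV. x $ i * A i p q) + t * (\<Sum>i\<in>UNIV. x' $ i * A i p q)"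
    by (simp add: distrib_right sum.distrib sum_distrib_left mult.assoc)
  have 2: "(\<Sum>j<N. (s * u j + t * u' j) * B j p q)
      = s * (\<Sum>j<N. u j * B j p q) + t * (\<Sum>j<N. u' j * B j p q)"
    by (simp add: distrib_right sum.distrib sum_distrib_left mult.assoc)
  show ?thesis unfolding lmi_def 1 2 by (simp add: algebra_simps)
qed

definition lmi_form :: "nat \<Rightarrow> nat \<Rightarrow> (nat \<Rightarrow> nat \<Rightarrow> real) \<Rightarrow> ('n::finite \<Rightarrow> nat \<Rightarrow> nat \<Rightarrow> real)
    \<Rightarrow> (nat \<Rightarrow> nat \<Rightarrow> nat \<Rightarrow> real) \<Rightarrow> real \<Rightarrow> real ^ 'n \<Rightarrow> (nat \<Rightarrow> real) \<Rightarrow> (nat \<Rightarrow> real) \<Rightarrow> real" where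
  "lmi_form d N A0 A B l x u v = quad {..<d} (lmi N A0 A B l x u) v"

lemma lmi_form_lin:
  "lmi_form d N A0 A B (s * l + t * l') (s *\<^sub>R x + t *\<^sub>R x') (\<lambda>j. s * u j + t * u' j) v
   = s * lmi_form d N A0 A B l x u v + t * lmi_form d N A0 A B l' x' u' v"
  unfolding lmi_form_def by (simp only: lmi_lin quad_lin)

lemma sdp_representableE:
  fixes S :: "(real ^ 'n::finite) set"
  assumes "sdp_representable S"
  obtains d N A0 A B where
    "\<forall>x. x \<in> S \<longleftrightarrow> (\<exists>u. \<forall>v. 0 \<le> lmi_form d N A0 A B 1 x u v)"
proof -
  obtain d N :: nat and A0 :: "nat \<Rightarrow> nat \<Rightarrow> real" and A :: "'n \<Rightarrow> nat \<Rightarrow> nat \<Rightarrow> real"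
    and B :: "nat \<Rightarrow> nat \<Rightarrow> nat \<Rightarrow> real"
    where *: "symmetric_matrix d A0" "\<forall>i. symmetric_matrix d (A i)"
    "\<forall>j<N. symmetric_matrix d (B j)"
    and S: "S = {x. \<exists>u. psd_matrix d
      (\<lambda>p q. A0 p q + (\<Sum>i\<in>UNIV. x $ i * A i p q) + (\<Sum>j<N. u j * B j p q))}"
    using assms unfolding sdp_representable_def by (elim exE conjE)
  have "symmetric_matrix d (lmi N A0 A B 1 x u)" for x u
    using * unfolding symmetric_matrix_def lmi_def by simp
  then have "\<forall>x. x \<in> S \<longleftrightarrow> (\<exists>u. \<forall>v. 0 \<le> lmi_form d N A0 A B 1 x u v)"
    unfolding S psd_matrix_def lmi_form_def lmi_def by simp
  then show thesis by (rule that)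
qed

lemma sdp_representable_convex:
  assumes "sdp_representable S"
  shows "convex S"
proof -
  obtain d N A0 A B
    where "\<forall>x. x \<in> S \<longleftrightarrow> (\<exists>u. \<forall>v. 0 \<le> lmi_form d N A0 A B 1 x u v)"
    by (rule sdp_representableE[OF assms])
  then have S: "\<And>x. x \<in> S \<longleftrightarrow> (\<exists>u. \<forall>v. 0 \<le> lmi_form d N A0 A B 1 x u v)" ..
  show ?thesis
  proof (rule convexI)
    fix x y and s t :: real
    assume "x \<in> S" "y \<in> S" and st: "0 \<le> s" "0 \<le> t" "s + t = 1"
    then obtain u w where uw: "\<And>v. 0 \<le> lmi_form d N A0 A B 1 x u v"
      "\<And>v. 0 \<le> lmi_form d N A0 A B 1 y w v"
      unfolding S by blast
    have "0 \<le> lmi_form d N A0 A B 1 (s *\<^sub>R x + t *\<^sub>R y) (\<lambda>j. s * u j + t * w j) v" for v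
      using lmi_form_lin[where s = s and l = 1 and x = x and u = u and t = t and l' = 1 and x' = y
          and u' = w and v = v and d = d] uw[of v] st by simp
    then show "s *\<^sub>R x + t *\<^sub>R y \<in> S"
      unfolding S by (intro exI allI)
  qed
qed

text \<open>Boundedness is what makes the fibre over \<open>l = 0\<close> trivial: a nonzero point in it would be a
  recession direction of \<open>S\<close>.\<close>

lemma sdp_homogenize:
  fixes S :: "(real ^ 'n::finite) set"
  assumes "sdp_representable S" "bounded S" "S \<noteq> {}"
  obtains d N A0 A B where
    "\<And>l x. 0 \<le> l \<Longrightarrow>
      (\<exists>u. \<forall>v. 0 \<le> lmi_form d N A0 A B l x u v) \<longleftrightarrow> (\<exists>s\<in>S. x = l *\<^sub>R s)"
proof -
  obtain d N A0 A B
    where "\<forall>x. x \<in> S \<longleftrightarrow> (\<exists>u. \<forall>v. 0 \<le> lmi_form d N A0 A B 1 x u v)"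
    by (rule sdp_representableE[OF assms(1)])
  then have S: "\<And>x. x \<in> S \<longleftrightarrow> (\<exists>u. \<forall>v. 0 \<le> lmi_form d N A0 A B 1 x u v)" ..
  let ?M = "lmi_form d N A0 A B"
  note lin = lmi_form_lin[where d = d and N = N and ?A0.0 = A0 and A = A and B = B]
  have "(\<exists>u. \<forall>v. 0 \<le> ?M l x u v) \<longleftrightarrow> (\<exists>s\<in>S. x = l *\<^sub>R s)" if l: "0 \<le> l" for l x
  proof
    assume "\<exists>u. \<forall>v. 0 \<le> ?M l x u v"
    then obtain u where u: "\<And>v. 0 \<le> ?M l x u v" by blast
    show "\<exists>s\<in>S. x = l *\<^sub>R s"
    proof (cases "l = 0")
      case False
      have "0 \<le> ?M 1 ((1 / l) *\<^sub>R x) (\<lambda>j. (1 / l) * u j) v" for v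
        using lin[where s = "1 / l" and l = l and x = x and u = u and t = 0 and v = v] u[of v] False l
        by simp
      then have "(1 / l) *\<^sub>R x \<in> S" unfolding S by (intro exI allI)
      then show ?thesis using False by (intro bexI[of _ "(1 / l) *\<^sub>R x"]) auto
    next
      case True
      obtain s where s: "s \<in> S" using assms(3) by blast
      then obtain w where w: "\<And>v. 0 \<le> ?M 1 s w v" unfolding S by blast
      have ray: "s + t *\<^sub>R x \<in> S" if "0 \<le> t" for t
      proof -
        have "0 \<le> ?M 1 (s + t *\<^sub>R x) (\<lambda>j. w j + t * u j) v" for v
          using lin[where s = 1 and l = 1 and x = s and u = w and t = t and l' = 0 and x' = x and u' = u and v = v]
            u[of v] w[of v] that True by simp
        then show ?thesis unfolding S by (intro exI allI)
      qed
      obtain R where R: "\<And>y. y \<in> S \<Longrightarrow> norm y \<le> R"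
        using assms(2) unfolding bounded_iff by blast
      have "x = 0"
      proof (rule ccontr)
        assume "x \<noteq> 0"
        \<comment> \<open>Gives \<open>t *\<^sub>R x\<close> the norm
          \<open>2 * \<bar>R\<bar> + 1\<close>, more than the distance \<open>R + R\<close> that two
          points of \<open>S\<close> can have.\<close>
        define t where "t = (2 * \<bar>R\<bar> + 1) / norm x"
        have "norm (t *\<^sub>R x) \<le> norm (s + t *\<^sub>R x) + norm s"
          by (metis add_diff_cancel_left' norm_triangle_ineq4)
        also have "\<dots> \<le> R + R"
          using \<open>x \<noteq> 0\<close> by (intro add_mono R ray s) (simp add: t_def)
        finally show False
          using \<open>x \<noteq> 0\<close> by (simp add: t_def)
      qed
      then show ?thesis using s True by auto
    qed
  next
    assume "\<exists>s\<in>S. x = l *\<^sub>R s"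
    then obtain s where s: "s \<in> S" "x = l *\<^sub>R s" by blast
    then obtain w where w: "\<And>v. 0 \<le> ?M 1 s w v" unfolding S by blast
    have "0 \<le> ?M l x (\<lambda>j. l * w j) v" for v
      using lin[where s = l and l = 1 and x = s and u = w and t = 0 and v = v] w[of v] l s by simp
    then show "\<exists>u. \<forall>v. 0 \<le> ?M l x u v" by (intro exI allI)
  qed
  then show thesis by (rule that)
qed

text \<open>In \<open>x = l s + (1 - l) t\<close> the products of unknowns spoil linearity. Taking
  \<open>y = l s\<close> as the unknown instead, the conditions on \<open>y\<close> and
  \<open>x - y\<close> are homogenized inequalities, linear in \<open>l\<close>, \<open>y\<close>
  and \<open>x\<close> together.\<close>

lemma sdp_representable_convex_hull_Un:
  fixes S T :: "(real ^ 'n::finite) set"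
  assumes S: "sdp_representable S" "bounded S" "S \<noteq> {}"
    and T: "sdp_representable T" "bounded T" "T \<noteq> {}"
  shows "sdp_representable (convex hull (S \<union> T))"
proof -
  obtain d N A0 A B where hS: "\<And>l x. 0 \<le> l \<Longrightarrow>
      (\<exists>u. \<forall>v. 0 \<le> lmi_form d N A0 A B l x u v) \<longleftrightarrow> (\<exists>s\<in>S. x = l *\<^sub>R s)"
    by (rule sdp_homogenize[OF S]) (rule that)
  obtain d' N' A0' A' B' where hT: "\<And>l x. 0 \<le> l \<Longrightarrow>
      (\<exists>u. \<forall>v. 0 \<le> lmi_form d' N' A0' A' B' l x u v) \<longleftrightarrow> (\<exists>s\<in>T. x = l *\<^sub>R s)"
    by (rule sdp_homogenize[OF T]) (rule that)
  \<comment> \<open>Blocks 0 and 1 are the two homogenized inequalities; blocks 2 and 3 are scalar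
    and say \<open>0 \<le> l\<close> and \<open>l \<le> 1\<close>.\<close>
  define K :: "nat set" where "K = {0, 1, 2, 3}"
  define I :: "nat \<Rightarrow> nat set" where
    "I k = (if k = 0 then {..<d} else if k = 1 then {..<d'} else {0})" for k
  \<comment> \<open>\<open>Inl None\<close> stores \<open>l\<close>, \<open>Inl (Some i)\<close> the
    coordinates of \<open>y\<close>, and the \<open>Inr\<close> part the lifting variables of
    \<open>S\<close> and of \<open>T\<close>.\<close>
  define J :: "('n option + (nat + nat)) set" where "J = UNIV <+> ({..<N} <+> {..<N'})"
  define M :: "nat \<Rightarrow> nat \<Rightarrow> nat \<Rightarrow> real ^ 'n \<Rightarrow> ('n option + (nat + nat) \<Rightarrow> real) \<Rightarrow> real" where
    "M k p q x u =
      (if k = 0 then lmi N A0 A B (u (Inl None)) (\<chi> i. u (Inl (Some i))) (\<lambda>j. u (Inr (Inl j))) p q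
       else if k = 1 then lmi N' A0' A' B' (1 - u (Inl None)) (x - (\<chi> i. u (Inl (Some i))))
         (\<lambda>j. u (Inr (Inr j))) p q
       else if k = 2 then u (Inl None) else 1 - u (Inl None))" for k p q x u
  have scalar: "(\<forall>v. 0 \<le> quad {0::nat} (\<lambda>_ _. c) v) \<longleftrightarrow> 0 \<le> c" for c :: real
  proof
    assume "\<forall>v. 0 \<le> quad {0::nat} (\<lambda>_ _. c) v"
    from this[rule_format, of "\<lambda>_. 1"] show "0 \<le> c" by simp
  next
    assume "0 \<le> c"
    then have "0 \<le> c * (v 0 * v 0)" for v :: "nat \<Rightarrow> real"
      by (intro mult_nonneg_nonneg zero_le_square)
    then show "\<forall>v. 0 \<le> quad {0::nat} (\<lambda>_ _. c) v"
      by (simp add: ac_simps)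
  qed
  have "finite J" unfolding J_def by simp
  have blocks: "(\<forall>k\<in>K. \<forall>v. 0 \<le> quad (I k) (\<lambda>p q. M k p q x u) v) \<longleftrightarrow>
      (\<forall>v. 0 \<le> lmi_form d N A0 A B (u (Inl None)) (\<chi> i. u (Inl (Some i))) (\<lambda>j. u (Inr (Inl j))) v) \<and>
      (\<forall>v. 0 \<le> lmi_form d' N' A0' A' B' (1 - u (Inl None)) (x - (\<chi> i. u (Inl (Some i))))
         (\<lambda>j. u (Inr (Inr j))) v) \<and> 0 \<le> u (Inl None) \<and> u (Inl None) \<le> 1" for x u
    unfolding K_def ball_simps lmi_form_def I_def M_def using scalar by simp
  have "convex hull (S \<union> T) =
    {a *\<^sub>R s + b *\<^sub>R t | a b s t. a \<ge> 0 \<and> b \<ge> 0 \<and> a + b = 1 \<and> s \<in> S \<and> t \<in> T}"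
    using assms by (intro convex_hull_union_two sdp_representable_convex)
  also have "\<dots> = {x. \<exists>l y. 0 \<le> l \<and> l \<le> 1 \<and> (\<exists>s\<in>S. y = l *\<^sub>R s) \<and> (\<exists>t\<in>T. x - y = (1 - l) *\<^sub>R t)}"
    (is "?A = ?B")
  proof (intro equalityI subsetI)
    fix x assume "x \<in> ?A"
    then obtain a b s t where *: "x = a *\<^sub>R s + b *\<^sub>R t" "a \<ge> 0" "b \<ge> 0" "a + b = 1" "s \<in> S" "t \<in> T"
      by blast
    then have "b = 1 - a" by simp
    with * show "x \<in> ?B"
      by (intro CollectI exI[of _ a] exI[of _ "a *\<^sub>R s"]) auto
  next
    fix x assume "x \<in> ?B"
    then obtain l y s t where *: "0 \<le> l" "l \<le> 1" "s \<in> S" "y = l *\<^sub>R s" "t \<in> T" "x - y = (1 - l) *\<^sub>R t"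
      by blast
    then have "x = l *\<^sub>R s + (1 - l) *\<^sub>R t" by (metis add.commute diff_add_cancel)
    with * show "x \<in> ?A"
      by (intro CollectI exI[of _ l] exI[of _ "1 - l"] exI[of _ s] exI[of _ t]) auto
  qed
  also have "\<dots> = {x. \<exists>u. \<forall>k\<in>K. \<forall>v. 0 \<le> quad (I k) (\<lambda>p q. M k p q x u) v}"
    unfolding blocks
  proof (intro equalityI subsetI CollectI)
    fix x assume "x \<in> ?B"
    then obtain l y where l: "0 \<le> l" "l \<le> 1" and y: "\<exists>s\<in>S. y = l *\<^sub>R s"
      and t: "\<exists>t\<in>T. x - y = (1 - l) *\<^sub>R t" by blast
    obtain a where a: "\<forall>v. 0 \<le> lmi_form d N A0 A B l y a v"
      using y hS[OF l(1)] by blast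
    obtain b where b: "\<forall>v. 0 \<le> lmi_form d' N' A0' A' B' (1 - l) (x - y) b v"
      using t hT[of "1 - l"] l by auto
    let ?u = "\<lambda>j. case j of Inl None \<Rightarrow> l | Inl (Some i) \<Rightarrow> y $ i | Inr (Inl j) \<Rightarrow> a j | Inr (Inr j) \<Rightarrow> b j"
    show "\<exists>u. (\<forall>v. 0 \<le> lmi_form d N A0 A B (u (Inl None)) (\<chi> i. u (Inl (Some i))) (\<lambda>j. u (Inr (Inl j))) v) \<and>
      (\<forall>v. 0 \<le> lmi_form d' N' A0' A' B' (1 - u (Inl None)) (x - (\<chi> i. u (Inl (Some i))))
         (\<lambda>j. u (Inr (Inr j))) v) \<and> 0 \<le> u (Inl None) \<and> u (Inl None) \<le> 1"
      by (rule exI[of _ ?u]) (use a b l in simp)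
  next
    fix x assume "x \<in> {x. \<exists>u. (\<forall>v. 0 \<le> lmi_form d N A0 A B (u (Inl None)) (\<chi> i. u (Inl (Some i))) (\<lambda>j. u (Inr (Inl j))) v) \<and>
      (\<forall>v. 0 \<le> lmi_form d' N' A0' A' B' (1 - u (Inl None)) (x - (\<chi> i. u (Inl (Some i))))
         (\<lambda>j. u (Inr (Inr j))) v) \<and> 0 \<le> u (Inl None) \<and> u (Inl None) \<le> 1}"
    then obtain u where
      u: "\<forall>v. 0 \<le> lmi_form d N A0 A B (u (Inl None)) (\<chi> i. u (Inl (Some i))) (\<lambda>j. u (Inr (Inl j))) v"
      "\<forall>v. 0 \<le> lmi_form d' N' A0' A' B' (1 - u (Inl None)) (x - (\<chi> i. u (Inl (Some i))))
         (\<lambda>j. u (Inr (Inr j))) v" "0 \<le> u (Inl None)" "u (Inl None) \<le> 1"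
      by (elim CollectE exE conjE)
    have "\<exists>s\<in>S. (\<chi> i. u (Inl (Some i))) = u (Inl None) *\<^sub>R s"
      using hS[OF u(3)] u(1) by blast
    moreover have "\<exists>t\<in>T. x - (\<chi> i. u (Inl (Some i))) = (1 - u (Inl None)) *\<^sub>R t"
      using hT[of "1 - u (Inl None)"] u(2,4) by (metis diff_ge_0_iff_ge)
    ultimately show "\<exists>l y. 0 \<le> l \<and> l \<le> 1 \<and> (\<exists>s\<in>S. y = l *\<^sub>R s) \<and> (\<exists>t\<in>T. x - y = (1 - l) *\<^sub>R t)"
      using u(3,4) by blast
  qed
  finally show ?thesis
  proof (rule sdp_representable_blocks[where K = K and I = I and J = J and M = M, rotated -1])
    show "affine_form J (M k p q)" if "p \<in> I k" "q \<in> I k" for k p q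
      using \<open>finite J\<close> unfolding J_def
      by (cases "k = 0"; cases "k = 1"; cases "k = 2")
        (auto simp: M_def[abs_def] lmi_def intro!: affine_form_intros affine_form_var)
  qed (auto simp: K_def I_def \<open>finite J\<close>)
qed

lemma sdp_representable_convex_hull_Union:
  fixes F :: "(real ^ 'n::finite) set set"
  assumes "finite F" "F \<noteq> {}"
    and "\<And>S. S \<in> F \<Longrightarrow> sdp_representable S \<and> bounded S \<and> S \<noteq> {}"
  shows "sdp_representable (convex hull (\<Union>F))"
  using assms
proof (induction F rule: finite_ne_induct)
  case (singleton S)
  then show ?case by (simp add: convex_hull_eq[THEN iffD2] sdp_representable_convex)
next
  case (insert S F)
  have "sdp_representable (convex hull (S \<union> convex hull (\<Union>F)))"
  proof (rule sdp_representable_convex_hull_Un)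
    show "sdp_representable S" "bounded S" "S \<noteq> {}"
      using insert.prems[of S] by simp_all
    show "sdp_representable (convex hull (\<Union>F))"
      by (rule insert.IH) (simp add: insert.prems)
    show "bounded (convex hull (\<Union>F))"
      using insert.hyps(1) insert.prems by (intro bounded_convex_hull bounded_Union) auto
    obtain T where "T \<in> F" using insert.hyps(2) by blast
    then show "convex hull (\<Union>F) \<noteq> {}"
      using insert.prems[of T] by auto
  qed
  also have "convex hull (S \<union> convex hull (\<Union>F)) = convex hull (S \<union> \<Union>F)"
    by (metis hull_Un_right)
  finally show ?case by simp
qed


section \<open>The moment relaxation\<close>

text \<open>Each exponent is bounded separately rather than their sum: the box is still finite, and
  the bounds still add under multiplication.\<close>

definition expbox :: "nat \<Rightarrow> ('n::finite \<Rightarrow>\<^sub>0 nat) set" where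
  "expbox D = {e. \<forall>i. Poly_Mapping.lookup e i \<le> D}"

definition deg_le :: "'n::finite real_mpoly \<Rightarrow> nat \<Rightarrow> bool" where
  "deg_le p D \<longleftrightarrow> Poly_Mapping.keys p \<subseteq> expbox D"

lemma finite_expbox: "finite (expbox D :: ('n::finite \<Rightarrow>\<^sub>0 nat) set)"
proof (rule finite_imageD)
  have "Poly_Mapping.lookup ` (expbox D :: ('n \<Rightarrow>\<^sub>0 nat) set) \<subseteq> Pi\<^sub>E UNIV (\<lambda>_. {..D})"
    by (auto simp: expbox_def)
  then show "finite (Poly_Mapping.lookup ` (expbox D :: ('n \<Rightarrow>\<^sub>0 nat) set))"
    by (rule finite_subset) (intro finite_PiE finite finite_atMost)
  show "inj_on Poly_Mapping.lookup (expbox D)"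
    by (rule inj_onI) (rule poly_mapping_eqI, simp)
qed

lemma deg_le_mono: "deg_le p D \<Longrightarrow> D \<le> D' \<Longrightarrow> deg_le p D'"
  unfolding deg_le_def expbox_def by (auto intro: order_trans)

lemma deg_le_add: "deg_le p D \<Longrightarrow> deg_le q D \<Longrightarrow> deg_le (p + q) D"
  unfolding deg_le_def using keys_add[of p q] by blast

lemma deg_le_minus: "deg_le (- p) D \<longleftrightarrow> deg_le p D"
  unfolding deg_le_def expbox_def by (simp add: in_keys_iff subset_eq)

lemma deg_le_diff: "deg_le p D \<Longrightarrow> deg_le q D \<Longrightarrow> deg_le (p - q) D"
  using deg_le_add[of p D "- q"] by (simp add: deg_le_minus)

lemma deg_le_mult: "deg_le p D \<Longrightarrow> deg_le q D' \<Longrightarrow> deg_le (p * q) (D + D')"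
  unfolding deg_le_def expbox_def using keys_mult[of p q]
  by (fastforce simp: lookup_add intro: add_mono)

lemma deg_le_cst [simp]: "deg_le (cst c) D"
  unfolding deg_le_def expbox_def by (simp add: subset_eq)

lemma deg_le_var: "1 \<le> D \<Longrightarrow> deg_le (var i) D"
  unfolding deg_le_def expbox_def var_def by (auto simp: lookup_single when_def)

lemma deg_le_sum: "(\<And>a. a \<in> A \<Longrightarrow> deg_le (F a) D) \<Longrightarrow> deg_le (\<Sum>a\<in>A. F a) D"
  by (induction A rule: infinite_finite_induct) (use deg_le_cst[of 0] in \<open>auto intro: deg_le_add\<close>)

lemma deg_le_vshift: "1 \<le> D \<Longrightarrow> deg_le (vshift u i) D"
  unfolding vshift_def by (intro deg_le_diff deg_le_var deg_le_cst)

text \<open>Pseudo-expectations with mean \<open>x\<close>, as in the Lasserre hierarchy. The member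
  \<open>1\<close> of \<open>K\<close> gives the moment matrix, any other member a localizing
  matrix; \<open>D\<close> bounds the multiplier \<open>h\<close> only, whatever the degree of
  \<open>g\<close>.\<close>

definition moments :: "'n::finite real_mpoly set \<Rightarrow> nat \<Rightarrow> ('n real_mpoly \<Rightarrow> real) \<Rightarrow> real ^ 'n \<Rightarrow> bool" where
  "moments K D L x \<longleftrightarrow> functional L \<and> L 1 = 1 \<and> (\<forall>i. L (var i) = x $ i) \<and>
     (\<forall>g\<in>K. \<forall>h. deg_le h D \<longrightarrow> 0 \<le> L (g * (h * h)))"

lemma moments_peval:
  assumes "\<And>g. g \<in> K \<Longrightarrow> 0 \<le> peval g x"
  shows "moments K D (\<lambda>p. peval p x) x"
  unfolding moments_def by (auto simp: peval_functional assms)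

text \<open>Identifies nonnegativity of \<open>L\<close> on \<open>g\<close> times squares with
  positive semidefiniteness of the localizing matrix of \<open>g\<close>.\<close>

lemma functional_quad:
  assumes "functional L" "finite E"
  shows "L (g * ((\<Sum>p\<in>E. Poly_Mapping.single p (v p)) * (\<Sum>q\<in>E. Poly_Mapping.single q (v q))))
    = quad E (\<lambda>p q. L (g * (Poly_Mapping.single p 1 * Poly_Mapping.single q 1))) v"
proof -
  have "g * (Poly_Mapping.single p (v p) * Poly_Mapping.single q (v q))
      = cst (v p * v q) * (g * (Poly_Mapping.single p 1 * Poly_Mapping.single q 1))" for p q
    by (subst mult.left_commute) (simp add: mult_single)
  then have *: "L (g * (Poly_Mapping.single p (v p) * Poly_Mapping.single q (v q)))
      = v p * L (g * (Poly_Mapping.single p 1 * Poly_Mapping.single q 1)) * v q" for p q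
    by (simp add: functionalD(2)[OF assms(1)])
  show ?thesis
    unfolding sum_product
    by (simp only: sum_distrib_left functional_sum(2)[OF assms(1)] *)
qed

theorem sdp_representable_moments:
  fixes K :: "'n::finite real_mpoly set"
  assumes "finite K"
  shows "sdp_representable {x. \<exists>L. moments K D L x}"
proof -
  \<comment> \<open>The normalization and the first moments are substituted into the sequence; all
    higher moments are lifting variables.\<close>
  define y :: "real ^ 'n \<Rightarrow> (('n \<Rightarrow>\<^sub>0 nat) \<Rightarrow> real) \<Rightarrow> ('n \<Rightarrow>\<^sub>0 nat) \<Rightarrow> real" where
    "y x u e = (if e = 0 then 1
      else if \<exists>i. e = Poly_Mapping.single i 1 then x $ (THE i. e = Poly_Mapping.single i 1) else u e)" for x u e
  define Q :: "'n real_mpoly \<Rightarrow> ('n \<Rightarrow>\<^sub>0 nat) \<Rightarrow> ('n \<Rightarrow>\<^sub>0 nat) \<Rightarrow> 'n real_mpoly" where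
    "Q g p q = g * (Poly_Mapping.single p 1 * Poly_Mapping.single q 1)" for g p q
  \<comment> \<open>Finitely many variables suffice because only these exponents occur in the
    localizing matrices; the moments outside \<open>J\<close> are unconstrained.\<close>
  define J :: "('n \<Rightarrow>\<^sub>0 nat) set" where
    "J = (\<Union>g\<in>K. \<Union>p\<in>expbox D. \<Union>q\<in>expbox D. Poly_Mapping.keys (Q g p q))"
  have J: "finite J" unfolding J_def by (intro finite_UN_I assms finite_expbox finite_keys)
  have single_eq: "(Poly_Mapping.single i 1 = Poly_Mapping.single j (1::nat)) \<longleftrightarrow> i = j" for i j :: 'n
    by (metis lookup_single_eq lookup_single_not_eq zero_neq_one)
  have single_0: "Poly_Mapping.single i (1::nat) \<noteq> 0" for i :: 'n
    by (metis lookup_single_eq lookup_zero zero_neq_one)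
  have y: "y x u 0 = 1" "y x u (Poly_Mapping.single i 1) = x $ i" for x u i
    unfolding y_def using single_0 by (auto simp: single_eq simp del: One_nat_def)
  have y_aff: "affine_form J (\<lambda>x u. y x u e)" if "e \<in> J" for e
  proof -
    consider "e = 0" | i where "e = Poly_Mapping.single i 1"
      | "e \<noteq> 0" "\<nexists>i. e = Poly_Mapping.single i 1" by blast
    then show ?thesis
    proof cases
      case 3
      then show ?thesis using affine_form_var[OF J that] by (simp add: y_def)
    qed (simp_all only: y affine_form_intros)
  qed
  have "{x. \<exists>L. moments K D L x}
      = {x. \<exists>u. \<forall>g\<in>K. \<forall>v. 0 \<le> quad (expbox D) (\<lambda>p q. lin_ext (y x u) (Q g p q)) v}" (is "?A = ?B")
  proof (intro equalityI subsetI)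
    fix x assume "x \<in> ?A"
    then obtain L where L: "functional L" "L 1 = 1" "\<And>i. L (var i) = x $ i"
      "\<And>g h. g \<in> K \<Longrightarrow> deg_le h D \<Longrightarrow> 0 \<le> L (g * (h * h))"
      unfolding moments_def by blast
    define u where "u = (\<lambda>e. L (Poly_Mapping.single e 1))"
    have "y x u e = u e" for e
      using L(2,3) by (cases "e = 0 \<or> (\<exists>i. e = Poly_Mapping.single i 1)")
        (auto simp: y u_def var_def simp del: One_nat_def, auto simp: y_def u_def)
    then have "y x u = u" by blast
    then have Ly: "lin_ext (y x u) = L"
      using functional_eq_lin_ext[OF L(1)] by (simp add: u_def)
    have "0 \<le> quad (expbox D) (\<lambda>p q. lin_ext (y x u) (Q g p q)) v" if "g \<in> K" for g v
    proof -
      have "deg_le (\<Sum>p\<in>expbox D. Poly_Mapping.single p (v p)) D"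
        by (rule deg_le_sum) (simp add: deg_le_def)
      from L(4)[OF that this] show ?thesis
        unfolding functional_quad[OF L(1) finite_expbox] Ly Q_def .
    qed
    then show "x \<in> ?B" by blast
  next
    fix x assume "x \<in> ?B"
    then obtain u where u: "\<And>g v. g \<in> K \<Longrightarrow> 0 \<le> quad (expbox D) (\<lambda>p q. lin_ext (y x u) (Q g p q)) v"
      by blast
    note L = lin_ext_functional[of "y x u"]
    have "lin_ext (y x u) 1 = 1" "lin_ext (y x u) (var i) = x $ i" for i
      using lin_ext_single[of "y x u" 0 1] by (simp_all add: var_def y del: One_nat_def)
    moreover have "0 \<le> lin_ext (y x u) (g * (h * h))" if "g \<in> K" "deg_le h D" for g h
    proof -
      have "h = (\<Sum>p\<in>expbox D. Poly_Mapping.single p (Poly_Mapping.lookup h p))"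
        by (subst sum_single_keys, rule sum.mono_neutral_left)
          (use that finite_expbox in \<open>auto simp: deg_le_def in_keys_iff\<close>)
      then show ?thesis
        using u[OF that(1), of "Poly_Mapping.lookup h"]
        by (simp only: Q_def flip: functional_quad[OF L finite_expbox])
    qed
    ultimately show "x \<in> ?A"
      using L unfolding moments_def by blast
  qed
  then show ?thesis
  proof (rule sdp_representable_blocks[OF assms finite_expbox J, rotated])
    fix g and p q :: "'n \<Rightarrow>\<^sub>0 nat" assume "g \<in> K" "p \<in> expbox D" "q \<in> expbox D"
    then have "Poly_Mapping.keys (Q g p q) \<subseteq> J" unfolding J_def by blast
    then show "affine_form J (\<lambda>x u. lin_ext (y x u) (Q g p q))"
      unfolding lin_ext_def by (intro affine_form_sum affine_form_cmult y_aff) blast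
  qed
qed


section \<open>Positive semidefinite forms as sums of squares\<close>

lemma quad_insert:
  assumes "finite I" "i \<notin> I" and sym: "\<And>p q. p \<in> insert i I \<Longrightarrow> q \<in> insert i I \<Longrightarrow> B p q = B q p"
  shows "quad (insert i I) B v = B i i * (v i)\<^sup>2 + 2 * v i * (\<Sum>j\<in>I. B i j * v j) + quad I B v"
proof -
  have "(\<Sum>p\<in>I. v p * B p i * v i) = v i * (\<Sum>j\<in>I. B i j * v j)"
    using sym by (simp add: sum_distrib_left ac_simps)
  moreover have "(\<Sum>q\<in>I. v i * B i q * v q) = v i * (\<Sum>j\<in>I. B i j * v j)"
    by (simp add: sum_distrib_left ac_simps)
  ultimately show ?thesis
    using assms(1,2) by (simp add: sum.distrib power2_eq_square)
qed

text \<open>Completing the square one index at a time: a positive pivot \<open>B i i\<close> splits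
  off one square and leaves the Schur complement, while a zero pivot forces its whole row to
  vanish.\<close>

lemma psd_sum_squares:
  fixes B :: "'i \<Rightarrow> 'i \<Rightarrow> real"
  assumes "finite I" "\<And>p q. p \<in> I \<Longrightarrow> q \<in> I \<Longrightarrow> B p q = B q p" "\<And>v. 0 \<le> quad I B v"
  shows "\<exists>(m::nat) a. \<forall>p\<in>I. \<forall>q\<in>I. B p q = (\<Sum>k<m. a k p * a k q)"
  using assms
proof (induction I arbitrary: B rule: finite_induct)
  case empty
  then show ?case by simp
next
  case (insert i I)
  note sym = insert.prems(1)
  have qi: "quad (insert i I) B v = B i i * (v i)\<^sup>2 + 2 * v i * (\<Sum>j\<in>I. B i j * v j) + quad I B v" for v
    by (rule quad_insert[OF insert.hyps sym])
  have "0 \<le> B i i"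
  proof -
    define v where "v = (\<lambda>p. if p = i then 1 else (0::real))"
    have "v i = 1" and vI: "v p = 0" if "p \<in> I" for p
      using insert.hyps(2) that by (auto simp: v_def)
    then have "quad (insert i I) B v = B i i"
      unfolding qi by (simp add: vI v_def)
    then show ?thesis using insert.prems(2)[of v] by simp
  qed
  then consider "B i i = 0" | "0 < B i i" by linarith
  then show ?case
  proof cases
    case 1
    have B0: "B i j = 0" if j: "j \<in> I" for j
    proof (rule ccontr)
      assume nz: "B i j \<noteq> 0"
      \<comment> \<open>The entry at \<open>i\<close> is chosen so that the cross term is
        \<open>- (B j j + 1)\<close> and the form takes the value \<open>-1\<close>.\<close>
      define v where "v = (\<lambda>p. if p = i then - (B j j + 1) / (2 * B i j) else if p = j then 1 else (0::real))"
      have vI: "v p = (if p = j then 1 else 0)" if "p \<in> I" for p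
        using insert.hyps(2) that by (auto simp: v_def)
      have "(\<Sum>p\<in>I. B i p * v p) = B i j"
        using insert.hyps(1) j by (simp add: vI if_distrib cong: if_cong sum.cong)
      moreover have "quad I B v = (\<Sum>p\<in>I. if p = j then (\<Sum>q\<in>I. if q = j then B j j else 0) else 0)"
        by (intro sum.cong refl) (auto simp: vI intro!: sum.neutral sum.cong)
      then have "quad I B v = B j j"
        using insert.hyps(1) j by simp
      moreover have "v i = - (B j j + 1) / (2 * B i j)" by (simp add: v_def)
      ultimately have "quad (insert i I) B v = -1"
        unfolding qi 1 using nz by (simp add: field_simps)
      then show False using insert.prems(2)[of v] by simp
    qed
    have quadI: "0 \<le> quad I B v" for v
    proof -
      define w where "w = v(i := 0)"
      have wI: "w p = v p" if "p \<in> I" for p using that insert.hyps by (auto simp: w_def)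
      have "w i = 0" by (simp add: w_def)
      then have "quad I B v = quad (insert i I) B w"
        unfolding qi by (simp add: wI)
      then show ?thesis using insert.prems(2)[of w] by simp
    qed
    have symI: "\<And>p q. p \<in> I \<Longrightarrow> q \<in> I \<Longrightarrow> B p q = B q p"
      by (rule sym) auto
    obtain m a where ma: "\<forall>p\<in>I. \<forall>q\<in>I. B p q = (\<Sum>k<m::nat. a k p * a k q)"
      using insert.IH[OF symI quadI] by blast
    define a' where "a' k p = (if p = i then 0 else a k p)" for k p
    have "B p q = (\<Sum>k<m. a' k p * a' k q)" if "p \<in> insert i I" "q \<in> insert i I" for p q
    proof (cases "p = i \<or> q = i")
      case True
      then have "(\<Sum>k<m. a' k p * a' k q) = 0"
        by (intro sum.neutral) (auto simp: a'_def)
      then show ?thesis using True sym[OF that] that B0 1 by auto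
    next
      case False
      then have "(\<Sum>k<m. a' k p * a' k q) = (\<Sum>k<m. a k p * a k q)"
        by (intro sum.cong) (auto simp: a'_def)
      then show ?thesis using ma that False by auto
    qed
    then show ?thesis by blast
  next
    case 2
    \<comment> \<open>The Schur complement of the pivot.\<close>
    define B' where "B' p q = B p q - B i p * B i q / B i i" for p q
    have quadI: "0 \<le> quad I B' v" for v
    proof -
      define s where "s = (\<Sum>j\<in>I. B i j * v j)"
      \<comment> \<open>This entry minimizes the form in the coordinate \<open>i\<close>; the
        minimum is the value of the Schur complement at \<open>v\<close>.\<close>
      define w where "w = v(i := - s / B i i)"
      have wI: "w p = v p" if "p \<in> I" for p using that insert.hyps by (auto simp: w_def)
      have ws: "(\<Sum>j\<in>I. B i j * w j) = s" "quad I B w = quad I B v"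
        by (simp_all add: wI s_def)
      have "quad I B' v = quad I B v - s * s / B i i"
        unfolding s_def B'_def sum_product sum_divide_distrib sum_subtractf[symmetric]
        by (intro sum.cong refl) (simp add: algebra_simps)
      also have "\<dots> = quad (insert i I) B w"
        unfolding qi ws using 2 by (simp add: w_def power2_eq_square field_simps)
      finally show ?thesis using insert.prems(2) by simp
    qed
    have symI: "B' p q = B' q p" if "p \<in> I" "q \<in> I" for p q
      using sym[of p q] that by (simp add: B'_def)
    obtain m a where ma: "\<forall>p\<in>I. \<forall>q\<in>I. B' p q = (\<Sum>k<m::nat. a k p * a k q)"
      using insert.IH[OF symI quadI] by blast
    \<comment> \<open>The new index \<open>m\<close> carries the square split off by the pivot; the
      old linear forms are extended by zero at \<open>i\<close>.\<close>
    define a' where "a' k p = (if k = m then B i p / sqrt (B i i) else if p = i then 0 else a k p)" for k p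
    have "B p q = (\<Sum>k<Suc m. a' k p * a' k q)" if "p \<in> insert i I" "q \<in> insert i I" for p q
    proof -
      have "a' m p * a' m q = B i p * B i q / B i i"
        using 2 by (simp add: a'_def)
      moreover have "(\<Sum>k<m. a' k p * a' k q) = B p q - B i p * B i q / B i i"
      proof (cases "p = i \<or> q = i")
        case True
        then have "(\<Sum>k<m. a' k p * a' k q) = 0"
          by (intro sum.neutral) (auto simp: a'_def)
        then show ?thesis using True sym[of p q] that 2 by auto
      next
        case False
        then have "p \<in> I" "q \<in> I" using that by auto
        have "(\<Sum>k<m. a' k p * a' k q) = (\<Sum>k<m. a k p * a k q)"
          using False by (intro sum.cong) (auto simp: a'_def)
        also have "\<dots> = B' p q" using ma \<open>p \<in> I\<close> \<open>q \<in> I\<close> by simp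
        finally show ?thesis by (simp add: B'_def)
      qed
      ultimately show ?thesis by simp
    qed
    then show ?thesis by blast
  qed
qed


section \<open>Pseudo-moments on a small ball\<close>

definition ball_poly :: "real ^ 'n::finite \<Rightarrow> real \<Rightarrow> 'n real_mpoly" where
  "ball_poly u r = cst (r\<^sup>2) - (\<Sum>i\<in>UNIV. vshift u i * vshift u i)"

lemma peval_ball_poly: "peval (ball_poly u r) x = r\<^sup>2 - (norm (x - u))\<^sup>2"
  by (simp add: ball_poly_def power2_norm_eq_inner inner_vec_def)

text \<open>The constraint \<open>1\<close> gives positivity on plain squares.
  \<open>1 \<le> D\<close> admits linear forms as test polynomials, and \<open>r \<le> 1\<close>
  lets the constants below be chosen independently of \<open>r\<close>.\<close>

locale ball_moments =
  fixes u :: "real ^ 'n::finite" and r :: real and D :: nat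
    and L :: "'n real_mpoly \<Rightarrow> real" and x :: "real ^ 'n"
  assumes mom: "moments {1, ball_poly u r} D L x"
    and r: "0 < r" "r \<le> 1" and D: "1 \<le> D"
begin

lemma L: "functional L" and L_1: "L 1 = 1" and L_var: "L (var i) = x $ i"
  using mom unfolding moments_def by blast+

lemmas L_add = functionalD(1)[OF L] and L_cst_mult = functionalD(2)[OF L]
  and L_diff = functional_minus(2)[OF L]
  and L_0 = functional_sum(1)[OF L] and L_sum = functional_sum(2)[OF L]

lemma L_cst: "L (cst c) = c"
  using L_cst_mult[of c 1] L_1 by simp

lemma L_sq_nonneg: "deg_le h D \<Longrightarrow> 0 \<le> L (h * h)"
  using mom unfolding moments_def by force

lemma L_sq_ball: "deg_le h D \<Longrightarrow> 0 \<le> L (ball_poly u r * (h * h))"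
  using mom unfolding moments_def by blast

section \<open>The seminorm \<open>sqrt (L (h * h))\<close>\<close>

lemma L_sq_add:
  assumes "deg_le a D" "deg_le b D"
  shows "L ((a + b) * (a + b)) \<le> 2 * L (a * a) + 2 * L (b * b)"
proof -
  have "0 \<le> L ((a - b) * (a - b))"
    by (intro L_sq_nonneg deg_le_diff assms)
  then show ?thesis
    by (simp add: distrib_left distrib_right left_diff_distrib right_diff_distrib L_add L_diff mult.commute[of b a])
qed

text \<open>A weighted Cauchy-Schwarz inequality, from the squares of \<open>t a + b\<close> and
  \<open>- t a + b\<close>. The free weight \<open>t\<close> is what later balances two terms of
  different order in \<open>r\<close>.\<close>

lemma L_cross:
  assumes "deg_le a D" "deg_le b D" "0 < t"
  shows "2 * \<bar>L (a * b)\<bar> \<le> t * L (a * a) + L (b * b) / t"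
proof -
  have *: "0 \<le> t\<^sup>2 * L (a * a) + 2 * (s * t) * L (a * b) + L (b * b)" if "s\<^sup>2 = 1" for s
  proof -
    have "deg_le (cst (s * t) * a + b) D"
      using deg_le_add[OF deg_le_mult[OF deg_le_cst[of "s * t" 0] assms(1)]] assms(2) by simp
    then have "0 \<le> L ((cst (s * t) * a + b) * (cst (s * t) * a + b))"
      by (rule L_sq_nonneg)
    also have "(cst (s * t) * a + b) * (cst (s * t) * a + b)
        = cst (s * t) * (cst (s * t) * (a * a)) + (cst (s * t) * (a * b) + cst (s * t) * (a * b)) + b * b"
      by (simp only: distrib_left distrib_right ac_simps)
    finally have "0 \<le> (s * t) * ((s * t) * L (a * a)) + 2 * ((s * t) * L (a * b)) + L (b * b)"
      by (simp only: L_add L_cst_mult mult_2)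
    also have "(s * t) * ((s * t) * L (a * a)) = s\<^sup>2 * (t\<^sup>2 * L (a * a))"
      by (simp add: power2_eq_square)
    finally show ?thesis
      by (simp add: that)
  qed
  have "2 * t * \<bar>L (a * b)\<bar> \<le> t\<^sup>2 * L (a * a) + L (b * b)"
    using *[of 1] *[of "-1"] assms(3) by (cases "0 \<le> L (a * b)") auto
  then show ?thesis using assms(3) by (simp add: field_simps power2_eq_square)
qed

text \<open>The ball constraint times \<open>h * h\<close> bounds the sum over all coordinates,
  whose terms are nonnegative. So multiplication by \<open>vshift u i\<close> shrinks the seminorm
  by the factor \<open>r\<close>; \<open>e + 1 \<le> D\<close> keeps the products admissible as test
  polynomials.\<close>

lemma L_sq_vshift:
  assumes "deg_le h e" "e + 1 \<le> D"
  shows "L ((h * vshift u i) * (h * vshift u i)) \<le> r\<^sup>2 * L (h * h)"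
proof -
  have pos: "0 \<le> L ((h * vshift u j) * (h * vshift u j))" for j
    by (rule L_sq_nonneg, rule deg_le_mono[OF deg_le_mult[OF assms(1) deg_le_vshift[of 1]]])
      (use assms(2) in auto)
  have "ball_poly u r * (h * h) = cst (r\<^sup>2) * (h * h) - (\<Sum>j\<in>UNIV. (h * vshift u j) * (h * vshift u j))"
    unfolding ball_poly_def left_diff_distrib sum_distrib_right by (simp only: mult_ac)
  moreover have "0 \<le> L (ball_poly u r * (h * h))"
    by (rule L_sq_ball) (use assms in \<open>auto intro: deg_le_mono\<close>)
  ultimately have "(\<Sum>j\<in>UNIV. L ((h * vshift u j) * (h * vshift u j))) \<le> r\<^sup>2 * L (h * h)"
    by (simp add: L_diff L_cst_mult L_sum)
  moreover have "L ((h * vshift u i) * (h * vshift u i)) \<le> (\<Sum>j\<in>UNIV. L ((h * vshift u j) * (h * vshift u j)))"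
    by (rule member_le_sum) (auto intro: pos)
  ultimately show ?thesis by linarith
qed

section \<open>Mean and covariance of the functional\<close>

definition V :: real where
  "V = (\<Sum>i\<in>UNIV. L (vshift x i * vshift x i))"

lemma L_vshift_x: "L (vshift x i) = 0"
  by (simp add: vshift_def L_diff L_var L_cst)

lemma V_le: "L (vshift x i * vshift x i) \<le> V"
  unfolding V_def by (rule member_le_sum) (auto intro: L_sq_nonneg deg_le_vshift D)

lemma V_nonneg: "0 \<le> V"
  unfolding V_def by (rule sum_nonneg) (auto intro: L_sq_nonneg deg_le_vshift D)

text \<open>Recentering from the ball's center \<open>u\<close> to the mean \<open>x\<close>: the
  mixed terms vanish because the first moments are those of \<open>x\<close>.\<close>

lemma L_vshift2: "L (vshift u i * vshift u j) - (x $ i - u $ i) * (x $ j - u $ j) = L (vshift x i * vshift x j)"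
proof -
  have "vshift u k = vshift x k + cst (x $ k - u $ k)" for k
    by (simp add: vshift_def single_diff)
  then have "vshift u i * vshift u j = vshift x i * vshift x j + cst (x $ i - u $ i) * vshift x j
      + cst (x $ j - u $ j) * vshift x i + cst (x $ i - u $ i) * cst (x $ j - u $ j)"
    by (simp add: algebra_simps)
  then show ?thesis
    by (simp only: L_add L_cst_mult L_vshift_x L_cst)
qed

text \<open>Tested at \<open>h = 1\<close>, the ball constraint says that
  \<open>(norm (x - u))\<^sup>2 + V\<close> is at most \<open>r\<^sup>2\<close>.\<close>

lemma norm_le: "norm (x - u) \<le> r"
proof -
  have "0 \<le> L (ball_poly u r * (1 * 1))"
    by (rule L_sq_ball) (use deg_le_cst[of 1] in simp)
  also have "\<dots> = r\<^sup>2 - (\<Sum>i\<in>UNIV. L (vshift u i * vshift u i))"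
    by (simp add: ball_poly_def L_diff L_cst L_sum)
  also have "\<dots> = r\<^sup>2 - ((norm (x - u))\<^sup>2 + V)"
    unfolding V_def L_vshift2[symmetric] sum_subtractf
    by (simp add: power2_norm_eq_inner inner_vec_def)
  finally have "(norm (x - u))\<^sup>2 \<le> r\<^sup>2" using V_nonneg by simp
  then show ?thesis using r(1) by (simp add: abs_le_square_iff[symmetric])
qed

lemma component_le: "\<bar>x $ i - u $ i\<bar> \<le> r"
  using component_le_norm_cart[of "x - u" i] norm_le by simp

text \<open>The symmetrized matrix of \<open>- A - c I\<close> is positive semidefinite, hence a sum
  of squares of linear forms, and \<open>L\<close> is nonnegative on each of these squares after
  centering at \<open>x\<close>.\<close>

lemma L_form_le:
  assumes A: "\<And>v. (\<Sum>i\<in>UNIV. \<Sum>j\<in>UNIV. v i * A i j * v j) \<le> - c * (\<Sum>i\<in>UNIV. (v i)\<^sup>2)"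
  shows "(\<Sum>i\<in>UNIV. \<Sum>j\<in>UNIV. A i j * L (vshift x i * vshift x j)) \<le> - c * V"
proof -
  \<comment> \<open>Symmetrizing is harmless because \<open>B\<close> is only paired with symmetric
    arrays \<open>F\<close>: products \<open>v i * v j\<close> and covariances.\<close>
  define B where "B i j = - (A i j + A j i) / 2 - (if i = j then c else 0)" for i j
  have diag: "(\<Sum>i\<in>UNIV. \<Sum>j\<in>UNIV. (if i = j then c else 0) * F i j) = c * (\<Sum>i\<in>UNIV. F i i)"
    for F :: "'n \<Rightarrow> 'n \<Rightarrow> real"
    by (simp add: sum_distrib_left if_distrib[where f = "\<lambda>y. y * _"] cong: if_cong)
  have BF: "(\<Sum>i\<in>UNIV. \<Sum>j\<in>UNIV. B i j * F i j) = - (\<Sum>i\<in>UNIV. \<Sum>j\<in>UNIV. A i j * F i j) - c * (\<Sum>i\<in>UNIV. F i i)"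
    if F: "\<And>i j. F i j = F j i" for F :: "'n \<Rightarrow> 'n \<Rightarrow> real"
  proof -
    have "(\<Sum>i\<in>UNIV. \<Sum>j\<in>UNIV. A j i * F i j) = (\<Sum>i\<in>UNIV. \<Sum>j\<in>UNIV. A i j * F i j)"
      by (subst sum.swap) (simp add: F)
    moreover have "B i j * F i j = - (1/2) * (A i j * F i j) + - (1/2) * (A j i * F i j)
        - (if i = j then c else 0) * F i j" for i j
      by (simp add: B_def field_simps)
    ultimately show ?thesis
      by (simp only: sum.distrib sum_subtractf diag flip: sum_distrib_left)
  qed
  have "0 \<le> quad UNIV B v" for v
    using A[of v] BF[of "\<lambda>i j. v i * v j"] by (simp add: ac_simps power2_eq_square)
  moreover have "B i j = B j i" for i j
    by (simp add: B_def)
  ultimately obtain m a where ma: "\<And>i j. B i j = (\<Sum>k<m::nat. a k i * a k j)"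
    using psd_sum_squares[of UNIV B] by auto
  have "0 \<le> (\<Sum>k<m. L ((\<Sum>i\<in>UNIV. cst (a k i) * vshift x i) * (\<Sum>i\<in>UNIV. cst (a k i) * vshift x i)))"
    by (intro sum_nonneg L_sq_nonneg deg_le_sum)
      (use deg_le_mult[OF deg_le_cst[of _ 0] deg_le_vshift[OF D]] in simp)
  also have "\<dots> = (\<Sum>k<m. \<Sum>i\<in>UNIV. \<Sum>j\<in>UNIV. a k i * a k j * L (vshift x i * vshift x j))"
  proof (rule sum.cong[OF refl])
    fix k
    have "L (cst (a k i) * vshift x i * (cst (a k j) * vshift x j)) = a k i * a k j * L (vshift x i * vshift x j)" for i j
      by (simp add: mult.assoc L_cst_mult mult.left_commute[of "vshift x i" "cst (a k j)"])
    then show "L ((\<Sum>i\<in>UNIV. cst (a k i) * vshift x i) * (\<Sum>i\<in>UNIV. cst (a k i) * vshift x i))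
        = (\<Sum>i\<in>UNIV. \<Sum>j\<in>UNIV. a k i * a k j * L (vshift x i * vshift x j))"
      unfolding sum_product L_sum by simp
  qed
  also have "\<dots> = (\<Sum>i\<in>UNIV. \<Sum>j\<in>UNIV. B i j * L (vshift x i * vshift x j))"
    unfolding ma sum_distrib_right
    by (subst sum.swap, rule sum.cong[OF refl], subst sum.swap, rule refl)
  also have "\<dots> = - (\<Sum>i\<in>UNIV. \<Sum>j\<in>UNIV. A i j * L (vshift x i * vshift x j)) - c * V"
    unfolding V_def by (rule BF) (simp add: mult.commute)
  finally show ?thesis by simp
qed

end

text \<open>Multiplication by \<open>p\<close> is a bounded operator for the seminorm, uniformly in
  \<open>r\<close>, \<open>D\<close>, \<open>L\<close> and \<open>x\<close>. The slack
  \<open>d\<close> keeps \<open>h * p\<close> an admissible test polynomial;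
  \<open>deg_le p d\<close> belongs to the claim so that in the product case the bound for
  \<open>q\<close> applies to \<open>h * p\<close>.\<close>

lemma L_mult_bound:
  fixes p :: "'n::finite real_mpoly"
  shows "\<exists>d C. 0 \<le> C \<and> deg_le p d \<and> (\<forall>r D L x h e. ball_moments u r D L x \<longrightarrow> deg_le h e \<longrightarrow> e + d \<le> D
    \<longrightarrow> L ((h * p) * (h * p)) \<le> C * L (h * h))"
proof (induction p rule: mpoly_induct)
  case (cst c)
  have "L ((h * cst c) * (h * cst c)) \<le> c\<^sup>2 * L (h * h)" if "ball_moments u r D L x" for r D L x h
  proof -
    interpret ball_moments u r D L x by (fact that)
    have *: "(h * cst c) * (h * cst c) = cst c * (cst c * (h * h))" by (simp only: mult_ac)
    show ?thesis unfolding * L_cst_mult power2_eq_square by simp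
  qed
  then show ?case
    by (intro exI[of _ 0] exI[of _ "c\<^sup>2"]) simp
next
  case (var i)
  have "L ((h * var i) * (h * var i)) \<le> (2 + 2 * (u $ i)\<^sup>2) * L (h * h)"
    if bm: "ball_moments u r D L x" and h: "deg_le h e" "e + 1 \<le> D" for r D L x h e
  proof -
    interpret ball_moments u r D L x by (fact bm)
    have hD: "deg_le h D" using h by (auto intro: deg_le_mono)
    \<comment> \<open>The ball controls only \<open>vshift u i\<close>, with factor at most 1
      because \<open>r \<le> 1\<close>; shifting back by \<open>u $ i\<close> produces the constant
      \<open>2 + 2 * (u $ i)\<^sup>2\<close>.\<close>
    have e: "h * var i = h * vshift u i + h * cst (u $ i)"
      by (simp add: vshift_def right_diff_distrib)
    have "L ((h * var i) * (h * var i)) \<le> 2 * L ((h * vshift u i) * (h * vshift u i))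
        + 2 * L ((h * cst (u $ i)) * (h * cst (u $ i)))"
      unfolding e
      by (rule L_sq_add[OF deg_le_mono[OF deg_le_mult[OF h(1) deg_le_vshift[of 1 u i]]]
            deg_le_mono[OF deg_le_mult[OF h(1) deg_le_cst[of _ 0]]]]) (use h(2) in auto)
    also have "L ((h * cst (u $ i)) * (h * cst (u $ i))) = (u $ i)\<^sup>2 * L (h * h)"
    proof -
      have *: "(h * cst (u $ i)) * (h * cst (u $ i)) = cst (u $ i) * (cst (u $ i) * (h * h))"
        by (simp only: mult_ac)
      show ?thesis unfolding * L_cst_mult power2_eq_square by simp
    qed
    also have "L ((h * vshift u i) * (h * vshift u i)) \<le> L (h * h)"
    proof -
      have "r\<^sup>2 * L (h * h) \<le> 1 * L (h * h)"
        using r L_sq_nonneg[OF hD] by (intro mult_right_mono) (auto simp: power_le_one)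
      then show ?thesis using L_sq_vshift[OF h, of i] by simp
    qed
    finally show ?thesis by (simp add: algebra_simps)
  qed
  then show ?case
    by (intro exI[of _ 1] exI[of _ "2 + 2 * (u $ i)\<^sup>2"]) (auto intro: deg_le_var)
next
  case (add p q)
  obtain d C where p0: "0 \<le> C" "deg_le p d"
      "\<forall>r D L x h e. ball_moments u r D L x \<longrightarrow> deg_le h e \<longrightarrow> e + d \<le> D
    \<longrightarrow> L ((h * p) * (h * p)) \<le> C * L (h * h)"
    using add(1) by (elim exE conjE)
  note p = p0(1,2) p0(3)[rule_format]
  obtain d' C' where q0: "0 \<le> C'" "deg_le q d'"
      "\<forall>r D L x h e. ball_moments u r D L x \<longrightarrow> deg_le h e \<longrightarrow> e + d' \<le> D
    \<longrightarrow> L ((h * q) * (h * q)) \<le> C' * L (h * h)"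
    using add(2) by (elim exE conjE)
  note q = q0(1,2) q0(3)[rule_format]
  have "L ((h * (p + q)) * (h * (p + q))) \<le> (2 * C + 2 * C') * L (h * h)"
    if bm: "ball_moments u r D L x" and h: "deg_le h e" "e + max d d' \<le> D" for r D L x h e
  proof -
    interpret ball_moments u r D L x by (fact bm)
    have "L ((h * p + h * q) * (h * p + h * q)) \<le> 2 * L ((h * p) * (h * p)) + 2 * L ((h * q) * (h * q))"
      by (rule L_sq_add[OF deg_le_mono[OF deg_le_mult[OF h(1) p(2)]]
            deg_le_mono[OF deg_le_mult[OF h(1) q(2)]]]) (use h(2) in auto)
    also have "\<dots> \<le> 2 * (C * L (h * h)) + 2 * (C' * L (h * h))"
      using p(3)[OF bm h(1)] q(3)[OF bm h(1)] h(2) by (intro add_mono mult_left_mono) auto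
    finally show ?thesis by (simp add: distrib_left distrib_right)
  qed
  moreover have "deg_le (p + q) (max d d')"
    using p(2) q(2) by (intro deg_le_add) (auto intro: deg_le_mono)
  moreover have "0 \<le> 2 * C + 2 * C'" using p(1) q(1) by simp
  ultimately show ?case
    by (intro exI[of _ "max d d'"] exI[of _ "2 * C + 2 * C'"]) blast
next
  case (mult p q)
  obtain d C where p0: "0 \<le> C" "deg_le p d"
      "\<forall>r D L x h e. ball_moments u r D L x \<longrightarrow> deg_le h e \<longrightarrow> e + d \<le> D
    \<longrightarrow> L ((h * p) * (h * p)) \<le> C * L (h * h)"
    using mult(1) by (elim exE conjE)
  note p = p0(1,2) p0(3)[rule_format]
  obtain d' C' where q0: "0 \<le> C'" "deg_le q d'"
      "\<forall>r D L x h e. ball_moments u r D L x \<longrightarrow> deg_le h e \<longrightarrow> e + d' \<le> D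
    \<longrightarrow> L ((h * q) * (h * q)) \<le> C' * L (h * h)"
    using mult(2) by (elim exE conjE)
  note q = q0(1,2) q0(3)[rule_format]
  have "L ((h * (p * q)) * (h * (p * q))) \<le> (C' * C) * L (h * h)"
    if bm: "ball_moments u r D L x" and h: "deg_le h e" "e + (d + d') \<le> D" for r D L x h e
  proof -
    have "L ((h * p * q) * (h * p * q)) \<le> C' * L ((h * p) * (h * p))"
      using q(3)[OF bm deg_le_mult[OF h(1) p(2)]] h(2) by simp
    also have "\<dots> \<le> C' * (C * L (h * h))"
      using p(3)[OF bm h(1)] h(2) q(1) by (intro mult_left_mono) auto
    finally show ?thesis by (simp only: mult.assoc)
  qed
  moreover have "deg_le (p * q) (d + d')"
    using p(2) q(2) by (rule deg_le_mult)
  moreover have "0 \<le> C' * C" using p(1) q(1) by simp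
  ultimately show ?case
    by (intro exI[of _ "d + d'"] exI[of _ "C' * C"]) blast
qed

text \<open>One bound serves all radii: \<open>r \<le> 1\<close> puts the mean into the unit ball
  around \<open>u\<close>, which is compact.\<close>

lemma peval_bounded_on_ball:
  obtains M where "0 \<le> M" "\<And>r D L x. ball_moments u r D L x \<Longrightarrow> \<bar>peval p x\<bar> \<le> M"
proof -
  have "compact (peval p ` cball u 1)"
    by (intro compact_continuous_image continuous_intros) auto
  then obtain M where "\<forall>y\<in>peval p ` cball u 1. norm y \<le> M"
    using compact_imp_bounded bounded_iff by metis
  then have M: "\<And>x. x \<in> cball u 1 \<Longrightarrow> \<bar>peval p x\<bar> \<le> M"
    by simp
  have "\<bar>peval p x\<bar> \<le> M" if "ball_moments u r D L x" for r D L x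
  proof -
    interpret ball_moments u r D L x by (fact that)
    show ?thesis using norm_le r by (intro M) (simp add: dist_norm norm_minus_commute)
  qed
  moreover have "0 \<le> M" using M[of u] by force
  ultimately show thesis using that by blast
qed

section \<open>Variance and bias of a polynomial\<close>

abbreviation centered :: "'n::finite real_mpoly \<Rightarrow> real ^ 'n \<Rightarrow> 'n real_mpoly" where
  "centered p x \<equiv> p - cst (peval p x)"

lemma centered_add: "centered (p + q) x = centered p x + centered q x"
  by (simp add: single_add)

lemma centered_mult: "centered (p * q) x = centered p x * q + cst (peval p x) * centered q x"
proof -
  have "cst (peval (p * q) x) = cst (peval p x) * cst (peval q x)"
    by (simp add: mult_single)
  then show ?thesis
    by (simp only: left_diff_distrib right_diff_distrib) simp
qed

lemma deg_le_centered: "deg_le p d \<Longrightarrow> deg_le (centered p x) d"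
  by (intro deg_le_diff deg_le_cst)

lemma L_variance_bound:
  fixes p :: "'n::finite real_mpoly"
  shows "\<exists>d C. 0 \<le> C \<and> deg_le p d \<and> (\<forall>r D L x. ball_moments u r D L x \<longrightarrow> d \<le> D
    \<longrightarrow> L (centered p x * centered p x) \<le> C * ball_moments.V L x)"
proof (induction p rule: mpoly_induct)
  case (cst c)
  have "L (centered (cst c) x * centered (cst c) x) \<le> 0" if "ball_moments u r D L x" for r D L x
  proof -
    interpret ball_moments u r D L x by (fact that)
    show ?thesis by (simp add: L_0)
  qed
  then show ?case
    by (intro exI[of _ 0] exI[of _ "0::real"]) simp
next
  case (var i)
  have "L (centered (var i) x * centered (var i) x) \<le> ball_moments.V L x" if "ball_moments u r D L x" for r D L x
  proof -
    interpret ball_moments u r D L x by (fact that)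
    show ?thesis using V_le[of i] by (simp add: vshift_def)
  qed
  then show ?case
    by (intro exI[of _ 1] exI[of _ "1::real"]) (auto intro: deg_le_var)
next
  case (add p q)
  obtain d C where p0: "0 \<le> C" "deg_le p d"
      "\<forall>r D L x. ball_moments u r D L x \<longrightarrow> d \<le> D
    \<longrightarrow> L (centered p x * centered p x) \<le> C * ball_moments.V L x"
    using add(1) by (elim exE conjE)
  note p = p0(1,2) p0(3)[rule_format]
  obtain d' C' where q0: "0 \<le> C'" "deg_le q d'"
      "\<forall>r D L x. ball_moments u r D L x \<longrightarrow> d' \<le> D
    \<longrightarrow> L (centered q x * centered q x) \<le> C' * ball_moments.V L x"
    using add(2) by (elim exE conjE)
  note q = q0(1,2) q0(3)[rule_format]
  have "L (centered (p + q) x * centered (p + q) x) \<le> (2 * C + 2 * C') * ball_moments.V L x"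
    if bm: "ball_moments u r D L x" and d: "max d d' \<le> D" for r D L x
  proof -
    interpret ball_moments u r D L x by (fact bm)
    have "L (centered (p + q) x * centered (p + q) x)
        \<le> 2 * L (centered p x * centered p x) + 2 * L (centered q x * centered q x)"
      unfolding centered_add
      by (rule L_sq_add[OF deg_le_mono[OF deg_le_centered[OF p(2)]]
            deg_le_mono[OF deg_le_centered[OF q(2)]]]) (use d in auto)
    also have "\<dots> \<le> 2 * (C * V) + 2 * (C' * V)"
      using p(3)[OF bm] q(3)[OF bm] d by (intro add_mono mult_left_mono) auto
    finally show ?thesis by (simp add: distrib_left distrib_right)
  qed
  moreover have "deg_le (p + q) (max d d')"
    using p(2) q(2) by (intro deg_le_add) (auto intro: deg_le_mono)
  moreover have "0 \<le> 2 * C + 2 * C'" using p(1) q(1) by simp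
  ultimately show ?case
    by (intro exI[of _ "max d d'"] exI[of _ "2 * C + 2 * C'"]) blast
next
  case (mult p q)
  obtain d C where p0: "0 \<le> C" "deg_le p d"
      "\<forall>r D L x. ball_moments u r D L x \<longrightarrow> d \<le> D
    \<longrightarrow> L (centered p x * centered p x) \<le> C * ball_moments.V L x"
    using mult(1) by (elim exE conjE)
  note p = p0(1,2) p0(3)[rule_format]
  obtain d' C' where q0: "0 \<le> C'" "deg_le q d'"
      "\<forall>r D L x. ball_moments u r D L x \<longrightarrow> d' \<le> D
    \<longrightarrow> L (centered q x * centered q x) \<le> C' * ball_moments.V L x"
    using mult(2) by (elim exE conjE)
  note q = q0(1,2) q0(3)[rule_format]
  obtain e E where b0: "0 \<le> E" "deg_le q e"
      "\<forall>r D L x h e'. ball_moments u r D L x \<longrightarrow> deg_le h e' \<longrightarrow> e' + e \<le> D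
    \<longrightarrow> L ((h * q) * (h * q)) \<le> E * L (h * h)"
    using L_mult_bound[of q u] by (elim exE conjE)
  note b = b0(1,2) b0(3)[rule_format]
  obtain M where M: "0 \<le> M" "\<And>r D L x. ball_moments u r D L x \<Longrightarrow> \<bar>peval p x\<bar> \<le> M"
    by (rule peval_bounded_on_ball[where u = u and p = p]) (rule that)
  \<comment> \<open>\<open>d\<close> and \<open>e\<close> make room for
    \<open>centered p x * q\<close>, and \<open>d'\<close> for the other summand.\<close>
  define d1 where "d1 = d + e + d'"
  define C1 where "C1 = 2 * (E * C) + 2 * (M\<^sup>2 * C')"
  have "L (centered (p * q) x * centered (p * q) x) \<le> C1 * ball_moments.V L x"
    if bm: "ball_moments u r D L x" and d: "d1 \<le> D" for r D L x
  proof -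
    interpret ball_moments u r D L x by (fact bm)
    have 1: "deg_le (centered p x) d" "deg_le (centered p x * q) D" "deg_le (cst (peval p x) * centered q x) D"
    proof -
      show *: "deg_le (centered p x) d" by (rule deg_le_centered[OF p(2)])
      show "deg_le (centered p x * q) D"
        by (rule deg_le_mono[OF deg_le_mult[OF * b(2)]]) (use d in \<open>simp add: d1_def\<close>)
      show "deg_le (cst (peval p x) * centered q x) D"
        by (rule deg_le_mono[OF deg_le_mult[OF deg_le_cst[of _ 0] deg_le_centered[OF q(2)]]])
          (use d in \<open>simp add: d1_def\<close>)
    qed
    have "L (centered (p * q) x * centered (p * q) x) \<le> 2 * L (centered p x * q * (centered p x * q))
        + 2 * L ((cst (peval p x) * centered q x) * (cst (peval p x) * centered q x))"
      unfolding centered_mult by (rule L_sq_add[OF 1(2,3)])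
    also have "L ((cst (peval p x) * centered q x) * (cst (peval p x) * centered q x))
        = (peval p x)\<^sup>2 * L (centered q x * centered q x)"
    proof -
      have *: "(cst (peval p x) * centered q x) * (cst (peval p x) * centered q x)
          = cst (peval p x) * (cst (peval p x) * (centered q x * centered q x))"
        by (simp only: mult_ac)
      show ?thesis unfolding * L_cst_mult power2_eq_square by simp
    qed
    also have "\<dots> \<le> M\<^sup>2 * (C' * V)"
    proof (rule mult_mono)
      show "(peval p x)\<^sup>2 \<le> M\<^sup>2"
        using M(2)[OF bm] M(1) by (simp add: abs_le_square_iff[symmetric])
      show "L (centered q x * centered q x) \<le> C' * V"
        using q(3)[OF bm] d by (simp add: d1_def)
      show "0 \<le> L (centered q x * centered q x)"
        by (rule L_sq_nonneg, rule deg_le_mono[OF deg_le_centered[OF q(2)]]) (use d in \<open>simp add: d1_def\<close>)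
    qed simp
    also have "L (centered p x * q * (centered p x * q)) \<le> E * L (centered p x * centered p x)"
      by (rule b(3)[OF bm 1(1)]) (use d in \<open>simp add: d1_def\<close>)
    also have "\<dots> \<le> E * (C * V)"
      using p(3)[OF bm] d b(1) by (intro mult_left_mono) (auto simp: d1_def)
    finally show ?thesis by (simp add: C1_def algebra_simps)
  qed
  moreover have "deg_le (p * q) d1"
    by (rule deg_le_mono[OF deg_le_mult[OF p(2) q(2)]]) (simp add: d1_def)
  moreover have "0 \<le> C1" using p(1) q(1) b(1) by (simp add: C1_def)
  ultimately show ?case
    by (intro exI[of _ d1] exI[of _ C1]) blast
qed

context ball_moments
begin

lemma L_mult_centered:
  "L (p * q) - peval (p * q) x
    = L (centered p x * centered q x) + peval p x * (L q - peval q x) + peval q x * (L p - peval p x)"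
proof -
  have "centered p x * centered q x
      = p * q - cst (peval p x) * q - (cst (peval q x) * p - cst (peval p x) * cst (peval q x))"
    by (simp only: left_diff_distrib right_diff_distrib mult.commute)
  then show ?thesis
    by (simp only: L_diff L_cst_mult L_cst peval_mult) (simp add: algebra_simps)
qed

end

text \<open>Constants and coordinates have no bias, so bias arises only at products, as a
  covariance; \<open>L_cross\<close> with weight 1 bounds it by variances. This makes the bias of
  every polynomial a second-order quantity.\<close>

lemma L_bias_bound:
  fixes p :: "'n::finite real_mpoly"
  shows "\<exists>d C. 0 \<le> C \<and> (\<forall>r D L x. ball_moments u r D L x \<longrightarrow> d \<le> D
    \<longrightarrow> \<bar>L p - peval p x\<bar> \<le> C * ball_moments.V L x)"
proof (induction p rule: mpoly_induct)
  case (cst c)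
  have "\<bar>L (cst c) - peval (cst c) x\<bar> \<le> 0" if "ball_moments u r D L x" for r D L x
  proof -
    interpret ball_moments u r D L x by (fact that)
    show ?thesis by (simp add: L_cst)
  qed
  then show ?case
    by (intro exI[of _ 0] exI[of _ "0::real"]) simp
next
  case (var i)
  have "\<bar>L (var i) - peval (var i) x\<bar> \<le> 0" if "ball_moments u r D L x" for r D L x
  proof -
    interpret ball_moments u r D L x by (fact that)
    show ?thesis by (simp add: L_var)
  qed
  then show ?case
    by (intro exI[of _ 0] exI[of _ "0::real"]) simp
next
  case (add p q)
  obtain d C where p0: "0 \<le> C"
      "\<forall>r D L x. ball_moments u r D L x \<longrightarrow> d \<le> D
    \<longrightarrow> \<bar>L p - peval p x\<bar> \<le> C * ball_moments.V L x"
    using add(1) by (elim exE conjE)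
  note p = p0(1) p0(2)[rule_format]
  obtain d' C' where q0: "0 \<le> C'"
      "\<forall>r D L x. ball_moments u r D L x \<longrightarrow> d' \<le> D
    \<longrightarrow> \<bar>L q - peval q x\<bar> \<le> C' * ball_moments.V L x"
    using add(2) by (elim exE conjE)
  note q = q0(1) q0(2)[rule_format]
  have "\<bar>L (p + q) - peval (p + q) x\<bar> \<le> (C + C') * ball_moments.V L x"
    if bm: "ball_moments u r D L x" and d: "max d d' \<le> D" for r D L x
  proof -
    interpret ball_moments u r D L x by (fact bm)
    show ?thesis
      using p(2)[OF bm] q(2)[OF bm] d by (simp add: L_add distrib_right)
  qed
  moreover have "0 \<le> C + C'" using p(1) q(1) by simp
  ultimately show ?case
    by (intro exI[of _ "max d d'"] exI[of _ "C + C'"]) blast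
next
  case (mult p q)
  obtain d C where p0: "0 \<le> C"
      "\<forall>r D L x. ball_moments u r D L x \<longrightarrow> d \<le> D
    \<longrightarrow> \<bar>L p - peval p x\<bar> \<le> C * ball_moments.V L x"
    using mult(1) by (elim exE conjE)
  note p = p0(1) p0(2)[rule_format]
  obtain d' C' where q0: "0 \<le> C'"
      "\<forall>r D L x. ball_moments u r D L x \<longrightarrow> d' \<le> D
    \<longrightarrow> \<bar>L q - peval q x\<bar> \<le> C' * ball_moments.V L x"
    using mult(2) by (elim exE conjE)
  note q = q0(1) q0(2)[rule_format]
  obtain e E where vp0: "0 \<le> E" "deg_le p e"
      "\<forall>r D L x. ball_moments u r D L x \<longrightarrow> e \<le> D
    \<longrightarrow> L (centered p x * centered p x) \<le> E * ball_moments.V L x"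
    using L_variance_bound[of p u] by (elim exE conjE)
  note vp = vp0(1,2) vp0(3)[rule_format]
  obtain e' E' where vq0: "0 \<le> E'" "deg_le q e'"
      "\<forall>r D L x. ball_moments u r D L x \<longrightarrow> e' \<le> D
    \<longrightarrow> L (centered q x * centered q x) \<le> E' * ball_moments.V L x"
    using L_variance_bound[of q u] by (elim exE conjE)
  note vq = vq0(1,2) vq0(3)[rule_format]
  obtain M where M: "0 \<le> M" "\<And>r D L x. ball_moments u r D L x \<Longrightarrow> \<bar>peval p x\<bar> \<le> M"
    by (rule peval_bounded_on_ball[where u = u and p = p]) (rule that)
  obtain M' where M': "0 \<le> M'" "\<And>r D L x. ball_moments u r D L x \<Longrightarrow> \<bar>peval q x\<bar> \<le> M'"
    by (rule peval_bounded_on_ball[where u = u and p = q]) (rule that)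
  define d1 where "d1 = d + d' + e + e'"
  define C1 where "C1 = (E + E') + M * C' + M' * C"
  have "\<bar>L (p * q) - peval (p * q) x\<bar> \<le> C1 * ball_moments.V L x"
    if bm: "ball_moments u r D L x" and d: "d1 \<le> D" for r D L x
  proof -
    interpret ball_moments u r D L x by (fact bm)
    have D: "d \<le> D" "d' \<le> D" "e \<le> D" "e' \<le> D" using d by (auto simp: d1_def)
    have "2 * \<bar>L (centered p x * centered q x)\<bar>
        \<le> 1 * L (centered p x * centered p x) + L (centered q x * centered q x) / 1"
      by (rule L_cross[OF deg_le_mono[OF deg_le_centered[OF vp(2)]]
            deg_le_mono[OF deg_le_centered[OF vq(2)]]]) (use D in auto)
    also have "\<dots> \<le> E * V + E' * V"
      using vp(3)[OF bm D(3)] vq(3)[OF bm D(4)] by simp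
    also have "\<dots> = (E + E') * V" by (simp add: distrib_right)
    finally have 1: "\<bar>L (centered p x * centered q x)\<bar> \<le> (E + E') * V"
      by simp
    have 2: "\<bar>peval p x * (L q - peval q x)\<bar> \<le> M * (C' * V)"
      unfolding abs_mult by (rule mult_mono) (use M(1) M(2)[OF bm] q(2)[OF bm D(2)] in auto)
    have 3: "\<bar>peval q x * (L p - peval p x)\<bar> \<le> M' * (C * V)"
      unfolding abs_mult by (rule mult_mono) (use M'(1) M'(2)[OF bm] p(2)[OF bm D(1)] in auto)
    have "\<bar>L (p * q) - peval (p * q) x\<bar> \<le> (E + E') * V + M * (C' * V) + M' * (C * V)"
      unfolding L_mult_centered using 1 2 3 by linarith
    then show ?thesis by (simp add: C1_def algebra_simps)
  qed
  moreover have "0 \<le> C1" using p(1) q(1) vp(1) vq(1) M(1) M'(1) by (simp add: C1_def)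
  ultimately show ?case
    by (intro exI[of _ d1] exI[of _ C1]) blast
qed

text \<open>The gain of a factor \<open>r\<close> over the generic bound is what lets the quadratic part win on
  small balls.\<close>

lemma L_cubic_bound:
  fixes s :: "'n::finite real_mpoly"
  shows "\<exists>d C. 0 \<le> C \<and> (\<forall>r D L x. ball_moments u r D L x \<longrightarrow> d \<le> D
    \<longrightarrow> \<bar>L (vshift u i * (vshift u j * (vshift u k * s))) - peval (vshift u i * (vshift u j * (vshift u k * s))) x\<bar>
      \<le> C * r * ball_moments.V L x)"
proof -
  define c where "c = vshift u k * s"
  obtain e E where b0: "0 \<le> E" "deg_le s e"
      "\<forall>r D L x h e'. ball_moments u r D L x \<longrightarrow> deg_le h e' \<longrightarrow> e' + e \<le> D
    \<longrightarrow> L ((h * s) * (h * s)) \<le> E * L (h * h)"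
    using L_mult_bound[of s u] by (elim exE conjE)
  note b = b0(1,2) b0(3)[rule_format]
  obtain e' E' where v0: "0 \<le> E'" "deg_le c e'"
      "\<forall>r D L x. ball_moments u r D L x \<longrightarrow> e' \<le> D
    \<longrightarrow> L (centered c x * centered c x) \<le> E' * ball_moments.V L x"
    using L_variance_bound[of c u] by (elim exE conjE)
  note v = v0(1,2) v0(3)[rule_format]
  obtain d C where t0: "0 \<le> C"
      "\<forall>r D L x. ball_moments u r D L x \<longrightarrow> d \<le> D
    \<longrightarrow> \<bar>L (vshift u j * c) - peval (vshift u j * c) x\<bar> \<le> C * ball_moments.V L x"
    using L_bias_bound[where p = "vshift u j * c" and u = u] by (elim exE conjE)
  note t = t0(1) t0(2)[rule_format]
  define d1 where "d1 = e + e' + d + 3"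
  define C1 where "C1 = 1 + 2 * E + 2 * E' + C"
  have "\<bar>L (vshift u i * (vshift u j * c)) - peval (vshift u i * (vshift u j * c)) x\<bar>
      \<le> C1 * r * ball_moments.V L x"
    if bm: "ball_moments u r D L x" and d: "d1 \<le> D" for r D L x
  proof -
    interpret ball_moments u r D L x by (fact bm)
    have dD: "e + 3 \<le> D" "e' + 3 \<le> D" "d \<le> D" using d by (auto simp: d1_def)
    have cw: "centered (vshift u l) x = vshift x l" for l
      by (simp add: vshift_def single_diff)
    have dv: "deg_le (vshift x l) 1" "deg_le (vshift u l) 1" for l
      by (simp_all add: deg_le_vshift)
    have dc: "deg_le (centered c x) e'" by (rule deg_le_centered[OF v(2)])
    \<comment> \<open>Each summand has second moment of order \<open>r\<^sup>2 * V\<close>: the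
      first because multiplication by \<open>vshift u k\<close> contracts by \<open>r\<close>, the
      second because the mean is within \<open>r\<close> of \<open>u\<close>.\<close>
    have "centered (vshift u j * c) x
        = vshift x j * vshift u k * s + cst (x $ j - u $ j) * centered c x"
      unfolding centered_mult cw by (simp only: peval_vshift c_def mult.assoc)
    then have "L (centered (vshift u j * c) x * centered (vshift u j * c) x)
        \<le> 2 * L ((vshift x j * vshift u k * s) * (vshift x j * vshift u k * s))
          + 2 * L ((cst (x $ j - u $ j) * centered c x) * (cst (x $ j - u $ j) * centered c x))"
      using L_sq_add[of "vshift x j * vshift u k * s" "cst (x $ j - u $ j) * centered c x"]
        deg_le_mono[OF deg_le_mult[OF deg_le_mult[OF dv(1) dv(2)] b(2)], of D j k]
        deg_le_mono[OF deg_le_mult[OF deg_le_cst[of _ 0] dc], of D] dD by simp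
    also have "L ((vshift x j * vshift u k * s) * (vshift x j * vshift u k * s)) \<le> E * (r\<^sup>2 * V)"
    proof -
      have "L ((vshift x j * vshift u k * s) * (vshift x j * vshift u k * s))
          \<le> E * L ((vshift x j * vshift u k) * (vshift x j * vshift u k))"
        by (rule b(3)[OF bm deg_le_mult[OF dv(1) dv(2)]]) (use dD in simp)
      also have "\<dots> \<le> E * (r\<^sup>2 * L (vshift x j * vshift x j))"
        by (intro mult_left_mono b(1) L_sq_vshift[OF dv(1)]) (use dD in simp)
      also have "\<dots> \<le> E * (r\<^sup>2 * V)"
        by (intro mult_left_mono b(1) V_le) simp
      finally show ?thesis .
    qed
    also have "L ((cst (x $ j - u $ j) * centered c x) * (cst (x $ j - u $ j) * centered c x)) \<le> r\<^sup>2 * (E' * V)"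
    proof -
      have *: "(cst (x $ j - u $ j) * centered c x) * (cst (x $ j - u $ j) * centered c x)
          = cst (x $ j - u $ j) * (cst (x $ j - u $ j) * (centered c x * centered c x))"
        by (simp only: mult_ac)
      have "L ((cst (x $ j - u $ j) * centered c x) * (cst (x $ j - u $ j) * centered c x))
          = (x $ j - u $ j)\<^sup>2 * L (centered c x * centered c x)"
        unfolding * L_cst_mult power2_eq_square by simp
      also have "\<dots> \<le> r\<^sup>2 * (E' * V)"
      proof (rule mult_mono)
        show "(x $ j - u $ j)\<^sup>2 \<le> r\<^sup>2"
          using component_le[of j] r by (simp add: abs_le_square_iff[symmetric])
        show "L (centered c x * centered c x) \<le> E' * V"
          using v(3)[OF bm] dD by simp
        show "0 \<le> L (centered c x * centered c x)"
          by (rule L_sq_nonneg, rule deg_le_mono[OF dc]) (use dD in simp)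
      qed simp
      finally show ?thesis .
    qed
    finally have N: "L (centered (vshift u j * c) x * centered (vshift u j * c) x) \<le> r\<^sup>2 * ((2 * E + 2 * E') * V)"
      by (simp add: algebra_simps)
    \<comment> \<open>The weight \<open>r\<close> balances \<open>V\<close> against
      \<open>r\<^sup>2 * V\<close>: both terms become multiples of \<open>r * V\<close>.\<close>
    have "2 * \<bar>L (vshift x i * centered (vshift u j * c) x)\<bar>
        \<le> r * L (vshift x i * vshift x i) + L (centered (vshift u j * c) x * centered (vshift u j * c) x) / r"
      by (rule L_cross[OF deg_le_mono[OF dv(1)] deg_le_mono[OF deg_le_centered[OF deg_le_mult[OF dv(2) v(2)]]] r(1)])
        (use dD in auto)
    also have "\<dots> \<le> r * V + r\<^sup>2 * ((2 * E + 2 * E') * V) / r"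
      using r N V_le[of i] by (intro add_mono mult_left_mono divide_right_mono) auto
    also have "\<dots> = r * ((1 + 2 * E + 2 * E') * V)"
      using r by (simp add: power2_eq_square field_simps)
    finally have 1: "2 * \<bar>L (vshift x i * centered (vshift u j * c) x)\<bar> \<le> r * ((1 + 2 * E + 2 * E') * V)" .
    have 2: "\<bar>(x $ i - u $ i) * (L (vshift u j * c) - peval (vshift u j * c) x)\<bar> \<le> r * (C * V)"
      unfolding abs_mult by (rule mult_mono) (use r component_le[of i] t(2)[OF bm dD(3)] in auto)
    \<comment> \<open>An affine polynomial has no bias, so the last term of
      \<open>L_mult_centered\<close> disappears.\<close>
    have "L (vshift u i) - peval (vshift u i) x = 0"
      by (simp add: vshift_def L_diff L_var L_cst)
    then have "L (vshift u i * (vshift u j * c)) - peval (vshift u i * (vshift u j * c)) x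
        = L (vshift x i * centered (vshift u j * c) x)
          + (x $ i - u $ i) * (L (vshift u j * c) - peval (vshift u j * c) x)"
      unfolding L_mult_centered[of "vshift u i"] cw by simp
    also have "\<bar>\<dots>\<bar> \<le> r * ((1 + 2 * E + 2 * E') * V) + r * (C * V)"
      using 1 2 by linarith
    also have "\<dots> = C1 * r * V" by (simp add: C1_def algebra_simps)
    finally show ?thesis .
  qed
  moreover have "0 \<le> C1" using b(1) v(1) t(1) by (simp add: C1_def)
  ultimately show ?thesis
    unfolding c_def by (intro exI[of _ d1] exI[of _ C1]) blast
qed


section \<open>Gradient and Hessian of a polynomial\<close>

text \<open>Partial derivatives are polynomials again, so the statement can be iterated to reach the
  Hessian.\<close>

lemma peval_has_derivative:
  fixes p :: "'n::finite real_mpoly"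
  shows "\<exists>P. \<forall>x. (peval p has_derivative (\<lambda>h. \<Sum>i\<in>UNIV. h $ i * peval (P i) x)) (at x)"
proof (induction p rule: mpoly_induct)
  case (cst c)
  have "peval (cst c) = (\<lambda>x :: real ^ 'n. c)" by (simp add: fun_eq_iff)
  then show ?case by (intro exI[of _ "\<lambda>_. 0"]) simp
next
  case (var i)
  have "peval (var i) = (\<lambda>x :: real ^ 'n. x $ i)" by (simp add: fun_eq_iff)
  moreover have "(\<Sum>j\<in>UNIV. h $ j * peval (if j = i then 1 else 0) x) = h $ i" for h x :: "real ^ 'n"
    by (simp add: if_distrib[where f = "\<lambda>p. peval p x"] if_distrib[where f = "\<lambda>y. _ * y"] cong: if_cong)
  ultimately show ?case
    by (intro exI[of _ "\<lambda>j. if j = i then 1 else 0"])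
      (simp add: bounded_linear_imp_has_derivative bounded_linear_vec_nth)
next
  case (add p q)
  then obtain P Q where P: "\<And>x. (peval p has_derivative (\<lambda>h. \<Sum>i\<in>UNIV. h $ i * peval (P i) x)) (at x)"
    and Q: "\<And>x. (peval q has_derivative (\<lambda>h. \<Sum>i\<in>UNIV. h $ i * peval (Q i) x)) (at x)" by blast
  have e: "peval (p + q) = (\<lambda>x. peval p x + peval q x)" by (simp add: fun_eq_iff)
  have "(peval (p + q) has_derivative (\<lambda>h. \<Sum>i\<in>UNIV. h $ i * peval (P i + Q i) x)) (at x)" for x
    unfolding e using has_derivative_add[OF P[of x] Q[of x]]
    by (simp add: distrib_left sum.distrib)
  then show ?case by (intro exI[of _ "\<lambda>i. P i + Q i"]) blast
next
  case (mult p q)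
  then obtain P Q where P: "\<And>x. (peval p has_derivative (\<lambda>h. \<Sum>i\<in>UNIV. h $ i * peval (P i) x)) (at x)"
    and Q: "\<And>x. (peval q has_derivative (\<lambda>h. \<Sum>i\<in>UNIV. h $ i * peval (Q i) x)) (at x)" by blast
  have e: "peval (p * q) = (\<lambda>x. peval p x * peval q x)" by (simp add: fun_eq_iff)
  have "(peval (p * q) has_derivative (\<lambda>h. \<Sum>i\<in>UNIV. h $ i * peval (p * Q i + P i * q) x)) (at x)" for x
    unfolding e using has_derivative_mult[OF P[of x] Q[of x]]
    by (simp add: distrib_left sum.distrib sum_distrib_left sum_distrib_right ac_simps)
  then show ?case by (intro exI[of _ "\<lambda>i. p * Q i + P i * q"]) blast
qed

lemma gradient_eqI:
  assumes "(f has_derivative (\<lambda>h. \<Sum>i\<in>UNIV. h $ i * d i)) (at x)"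
  shows "gradient f x = (\<chi> i. d i)"
proof -
  have "(\<Sum>j\<in>UNIV. axis i 1 $ j * d j) = (\<Sum>j\<in>UNIV. if j = i then d j else 0)" for i :: 'a
    by (rule sum.cong) (auto simp: axis_def)
  then show ?thesis
    unfolding gradient_def frechet_derivative_at[OF assms, symmetric] by simp
qed

text \<open>Polynomial entries supply the continuity of gradient and Hessian used when the base
  point moves.\<close>

lemma gradient_hessian_peval:
  fixes p :: "'n::finite real_mpoly"
  obtains G H where "\<And>x. gradient (peval p) x = (\<chi> i. peval (G i) x)"
    and "\<And>x. hessian (peval p) x = (\<chi> i j. peval (H i j) x)"
    and "\<And>x. (peval p has_derivative (\<lambda>h. gradient (peval p) x \<bullet> h)) (at x)"
    and "\<And>x. (gradient (peval p) has_derivative (\<lambda>h. hessian (peval p) x *v h)) (at x)"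
proof -
  obtain G where G: "\<And>x. (peval p has_derivative (\<lambda>h. \<Sum>i\<in>UNIV. h $ i * peval (G i) x)) (at x)"
    using peval_has_derivative[of p] by blast
  have "\<forall>i. \<exists>P. \<forall>x. (peval (G i) has_derivative (\<lambda>h. \<Sum>j\<in>UNIV. h $ j * peval (P j) x)) (at x)"
    by (intro allI peval_has_derivative)
  from choice[OF this] obtain H
    where H0: "\<forall>i x. (peval (G i) has_derivative (\<lambda>h. \<Sum>j\<in>UNIV. h $ j * peval (H i j) x)) (at x)" ..
  have H: "\<And>i x. (peval (G i) has_derivative (\<lambda>h. \<Sum>j\<in>UNIV. h $ j * peval (H i j) x)) (at x)"
    by (rule H0[rule_format])
  have g: "gradient (peval p) x = (\<chi> i. peval (G i) x)" for x
    using G[of x] by (rule gradient_eqI)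
  have dg: "(gradient (peval p) has_derivative (\<lambda>h. (\<chi> i j. peval (H i j) x) *v h)) (at x)" for x
  proof -
    have "((\<lambda>x. \<chi> i. peval (G i) x) has_derivative (\<lambda>h. (\<chi> i j. peval (H i j) x) *v h)) (at x)"
    proof (rule has_derivative_componentwise_within[THEN iffD2], rule ballI)
      fix e :: "real ^ 'n" assume "e \<in> Basis"
      then obtain i where e: "e = axis i 1" by (auto simp: Basis_vec_def)
      have 1: "(\<lambda>x. (\<chi> i. peval (G i) x) \<bullet> e) = peval (G i)"
        by (simp add: e inner_axis fun_eq_iff)
      have 2: "(\<lambda>h. ((\<chi> i j. peval (H i j) x) *v h) \<bullet> e) = (\<lambda>h. \<Sum>j\<in>UNIV. h $ j * peval (H i j) x)"
        by (simp add: e inner_axis fun_eq_iff matrix_vector_mult_def mult.commute)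
      show "((\<lambda>x. (\<chi> i. peval (G i) x) \<bullet> e) has_derivative
          (\<lambda>h. ((\<chi> i j. peval (H i j) x) *v h) \<bullet> e)) (at x)"
        unfolding 1 2 by (rule H)
    qed
    then show ?thesis by (simp add: g[abs_def])
  qed
  have h: "hessian (peval p) x = (\<chi> i j. peval (H i j) x)" for x
    unfolding hessian_def jacobian_def frechet_derivative_at[OF dg, symmetric]
    by (rule matrix_of_matrix_vector_mul)
  show thesis
  proof (rule that[OF g h])
    show "(peval p has_derivative (\<lambda>h. gradient (peval p) x \<bullet> h)) (at x)" for x
      using G[of x] by (simp add: g inner_vec_def mult.commute)
    show "(gradient (peval p) has_derivative (\<lambda>h. hessian (peval p) x *v h)) (at x)" for x
      unfolding h by (rule dg)
  qed
qed

lemma peval_line_DERIV: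
  "((\<lambda>t. peval p (u + t *\<^sub>R v)) has_real_derivative gradient (peval p) (u + t *\<^sub>R v) \<bullet> v) (at t)"
proof -
  have "((\<lambda>t. u + t *\<^sub>R v) has_derivative (\<lambda>s. s *\<^sub>R v)) (at t)"
    by (auto intro!: derivative_eq_intros)
  moreover have "(peval p has_derivative (\<lambda>h. gradient (peval p) (u + t *\<^sub>R v) \<bullet> h)) (at (u + t *\<^sub>R v))"
    by (rule gradient_hessian_peval)
  ultimately have "((\<lambda>t. peval p (u + t *\<^sub>R v)) has_derivative
      (\<lambda>s. gradient (peval p) (u + t *\<^sub>R v) \<bullet> (s *\<^sub>R v))) (at t)"
    by (rule has_derivative_compose)
  then show ?thesis
    by (simp add: has_field_derivative_def mult.commute[of "gradient _ _ \<bullet> _"] mult_commute_abs)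
qed

lemma gradient_line_DERIV:
  "((\<lambda>t. gradient (peval p) (u + t *\<^sub>R v) \<bullet> v) has_real_derivative
     v \<bullet> (hessian (peval p) (u + t *\<^sub>R v) *v v)) (at t)"
proof -
  have "((\<lambda>t. u + t *\<^sub>R v) has_derivative (\<lambda>s. s *\<^sub>R v)) (at t)"
    by (auto intro!: derivative_eq_intros)
  moreover have "(gradient (peval p) has_derivative (\<lambda>h. hessian (peval p) (u + t *\<^sub>R v) *v h)) (at (u + t *\<^sub>R v))"
    by (rule gradient_hessian_peval)
  ultimately have "((\<lambda>t. gradient (peval p) (u + t *\<^sub>R v)) has_derivative
      (\<lambda>s. hessian (peval p) (u + t *\<^sub>R v) *v (s *\<^sub>R v))) (at t)"
    by (rule has_derivative_compose)
  then have "((\<lambda>t. gradient (peval p) (u + t *\<^sub>R v) \<bullet> v) has_derivative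
      (\<lambda>s. (hessian (peval p) (u + t *\<^sub>R v) *v (s *\<^sub>R v)) \<bullet> v)) (at t)"
    by (rule has_derivative_inner_left)
  then show ?thesis
    by (simp add: has_field_derivative_def matrix_vector_mult_scaleR inner_commute mult_commute_abs)
qed

text \<open>Both sides are the first two Taylor coefficients of \<open>t \<mapsto> p (u + t v)\<close> at \<open>0\<close>.\<close>

lemma taylor2_gradient_hessian:
  fixes p :: "'n::finite real_mpoly"
  assumes p: "p = cst a + (\<Sum>i\<in>UNIV. vshift u i * cst (b i))
    + (\<Sum>i\<in>UNIV. \<Sum>j\<in>UNIV. vshift u i * vshift u j * P i j)"
  shows "gradient (peval p) u \<bullet> v = (\<Sum>i\<in>UNIV. v $ i * b i)"
    and "v \<bullet> (hessian (peval p) u *v v) = 2 * (\<Sum>i\<in>UNIV. \<Sum>j\<in>UNIV. v $ i * peval (P i j) u * v $ j)"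
proof -
  define B where "B = (\<Sum>i\<in>UNIV. v $ i * b i)"
  \<comment> \<open>With \<open>v\<close> frozen into constant coefficients, the second-order part
    along the line is \<open>t\<^sup>2\<close> times the value of a single polynomial.\<close>
  define Q where "Q = (\<Sum>i\<in>UNIV. \<Sum>j\<in>UNIV. cst (v $ i * v $ j) * P i j)"
  define \<psi> where "\<psi> t = gradient (peval Q) (u + t *\<^sub>R v) \<bullet> v" for t
  have line: "peval p (u + t *\<^sub>R v) = a + t * B + t\<^sup>2 * peval Q (u + t *\<^sub>R v)" for t
    by (subst p) (simp add: B_def Q_def sum_distrib_left power2_eq_square ac_simps)
  have "((\<lambda>t. peval p (u + t *\<^sub>R v)) has_real_derivative B + 2 * t * peval Q (u + t *\<^sub>R v) + t\<^sup>2 * \<psi> t) (at t)" for t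
    unfolding line \<psi>_def
    by (auto intro!: derivative_eq_intros peval_line_DERIV simp: power2_eq_square algebra_simps)
  then have g: "gradient (peval p) (u + t *\<^sub>R v) \<bullet> v = B + 2 * t * peval Q (u + t *\<^sub>R v) + t\<^sup>2 * \<psi> t" for t
    using DERIV_unique[OF peval_line_DERIV] by blast
  from g[of 0] show "gradient (peval p) u \<bullet> v = (\<Sum>i\<in>UNIV. v $ i * b i)"
    by (simp add: B_def)
  \<comment> \<open>Differentiability of \<open>\<psi>\<close> at \<open>0\<close> ensures that
    \<open>t\<^sup>2 * \<psi> t\<close> contributes nothing to the derivative there.\<close>
  have "(\<psi> has_real_derivative v \<bullet> (hessian (peval Q) (u + 0 *\<^sub>R v) *v v)) (at 0)"
    unfolding \<psi>_def by (rule gradient_line_DERIV)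
  moreover have "((\<lambda>t. peval Q (u + t *\<^sub>R v)) has_real_derivative gradient (peval Q) (u + 0 *\<^sub>R v) \<bullet> v) (at 0)"
    by (rule peval_line_DERIV)
  ultimately have "((\<lambda>t. B + 2 * t * peval Q (u + t *\<^sub>R v) + t\<^sup>2 * \<psi> t) has_real_derivative 2 * peval Q u) (at 0)"
    by (auto intro!: derivative_eq_intros)
  moreover have "((\<lambda>t. B + 2 * t * peval Q (u + t *\<^sub>R v) + t\<^sup>2 * \<psi> t) has_real_derivative
      v \<bullet> (hessian (peval p) (u + 0 *\<^sub>R v) *v v)) (at 0)"
    unfolding g[symmetric] by (rule gradient_line_DERIV)
  ultimately have "v \<bullet> (hessian (peval p) u *v v) = 2 * peval Q u"
    using DERIV_unique by fastforce
  then show "v \<bullet> (hessian (peval p) u *v v) = 2 * (\<Sum>i\<in>UNIV. \<Sum>j\<in>UNIV. v $ i * peval (P i j) u * v $ j)"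
    by (simp add: Q_def ac_simps)
qed


section \<open>Quasi-concavity from local convexity\<close>

text \<open>If the second derivative were positive along a tangent direction \<open>v\<close>, the two points
  \<open>w \<plusminus> t v - c t\<^sup>2 b\<close> with \<open>b\<close> the gradient would lie in the set for small \<open>t\<close>, but not their midpoint.\<close>

lemma quasi_concave_at_of_convex:
  fixes p :: "'n::finite real_mpoly"
  assumes S: "convex S" and e: "0 < e" and loc: "S \<inter> ball w e = nonneg_set p \<inter> ball w e"
    and w: "peval p w = 0" and grad: "gradient (peval p) w \<noteq> 0"
  shows "quasi_concave_at (peval p) w"
  unfolding quasi_concave_at_def
proof (intro allI impI, rule ccontr)
  fix v assume v: "v \<noteq> 0 \<and> gradient (peval p) w \<bullet> v = 0" and "\<not> 0 \<le> - (v \<bullet> (hessian (peval p) w *v v))"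
  then have h: "0 < v \<bullet> (hessian (peval p) w *v v)" by simp
  obtain b P where p0: "p = cst (peval p w) + (\<Sum>i\<in>UNIV. vshift w i * cst (b i))
    + (\<Sum>i\<in>UNIV. \<Sum>j\<in>UNIV. vshift w i * vshift w j * P i j)"
    by (rule taylor2)
  note th = taylor2_gradient_hessian[OF p0]
  define g where "g = gradient (peval p) w"
  define q where "q y x = (\<Sum>i\<in>UNIV. \<Sum>j\<in>UNIV. y $ i * peval (P i j) x * y $ j)" for x y :: "real ^ 'n"
  have ev: "peval p (w + y) = g \<bullet> y + q y (w + y)" for y
    unfolding g_def th(1) q_def
    by (subst p0) (simp add: w ac_simps)
  have q_scale: "q (t *\<^sub>R y) x = t\<^sup>2 * q y x" for t y x
    by (simp add: q_def sum_distrib_left power2_eq_square ac_simps)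
  have gg: "0 < g \<bullet> g" using grad by (simp add: g_def)
  \<comment> \<open>Pushing back along the gradient costs half of \<open>q v w\<close> at order
    \<open>t\<^sup>2\<close>: the outer points, \<open>s = 1\<close> and \<open>s = -1\<close>, keep
    \<open>q v w / 2\<close>, while the midpoint, \<open>s = 0\<close>, is left with
    \<open>- q v w / 2\<close>.\<close>
  define c where "c = q v w / (2 * (g \<bullet> g))"
  have qv: "0 < q v w" using h unfolding th(2) q_def by simp
  then have c: "0 < c" using gg by (simp add: c_def)
  have cg: "c * (g \<bullet> g) = q v w / 2" using gg by (simp add: c_def)
  \<comment> \<open>The value of \<open>p\<close> on the curve divided by \<open>t\<^sup>2\<close>;
    the first-order term is absent because \<open>v\<close> is tangent. Unlike the quotient,
    \<open>F s\<close> is continuous at \<open>0\<close>.\<close>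
  define F where "F s t = - c * (g \<bullet> g) + q (s *\<^sub>R v - (c * t) *\<^sub>R g) (w + t *\<^sub>R (s *\<^sub>R v - (c * t) *\<^sub>R g))" for s t
  have F: "peval p (w + t *\<^sub>R (s *\<^sub>R v - (c * t) *\<^sub>R g)) = t\<^sup>2 * F s t" for s t
    unfolding ev F_def q_scale using v
    by (simp add: g_def[symmetric] inner_diff_right power2_eq_square algebra_simps)
  have lim: "(F s \<longlongrightarrow> - (q v w / 2) + s\<^sup>2 * q v w) (at_right 0)" for s
  proof -
    have "isCont (F s) 0"
      unfolding F_def q_def by (intro continuous_intros)
    then have "(F s \<longlongrightarrow> F s 0) (at_right 0)"
      unfolding isCont_def by (rule tendsto_within_subset) auto
    moreover have "F s 0 = - (q v w / 2) + s\<^sup>2 * q v w"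
      unfolding F_def using cg by (simp add: q_scale)
    ultimately show ?thesis by simp
  qed
  have ball: "eventually (\<lambda>t. w + t *\<^sub>R (s *\<^sub>R v - (c * t) *\<^sub>R g) \<in> ball w e) (at_right 0)" for s
  proof -
    have "isCont (\<lambda>t. w + t *\<^sub>R (s *\<^sub>R v - (c * t) *\<^sub>R g)) 0"
      by (intro continuous_intros)
    then have "((\<lambda>t. w + t *\<^sub>R (s *\<^sub>R v - (c * t) *\<^sub>R g)) \<longlongrightarrow> w) (at 0)"
      unfolding isCont_def by simp
    then have "((\<lambda>t. w + t *\<^sub>R (s *\<^sub>R v - (c * t) *\<^sub>R g)) \<longlongrightarrow> w) (at_right 0)"
      by (rule tendsto_within_subset) simp
    then show ?thesis
      by (rule topological_tendstoD) (use e in auto)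
  qed
  have "eventually (\<lambda>t. 0 < F 1 t) (at_right 0)" "eventually (\<lambda>t. 0 < F (-1) t) (at_right 0)"
    "eventually (\<lambda>t. F 0 t < 0) (at_right 0)"
    using order_tendstoD(1)[OF lim, of 0 1] order_tendstoD(1)[OF lim, of 0 "-1"]
      order_tendstoD(2)[OF lim[of 0], of 0] qv by simp_all
  then have "eventually (\<lambda>t. 0 < F 1 t \<and> 0 < F (-1) t \<and> F 0 t < 0 \<and> 0 < t \<and>
      w + t *\<^sub>R (1 *\<^sub>R v - (c * t) *\<^sub>R g) \<in> ball w e \<and> w + t *\<^sub>R ((-1) *\<^sub>R v - (c * t) *\<^sub>R g) \<in> ball w e \<and>
      w + t *\<^sub>R (0 *\<^sub>R v - (c * t) *\<^sub>R g) \<in> ball w e) (at_right 0)"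
    using ball[of 1] ball[of "-1"] ball[of 0] eventually_at_right_less[of 0]
    by eventually_elim simp
  then obtain t where t: "0 < F 1 t" "0 < F (-1) t" "F 0 t < 0" "0 < t"
    and tb: "w + t *\<^sub>R (1 *\<^sub>R v - (c * t) *\<^sub>R g) \<in> ball w e" "w + t *\<^sub>R ((-1) *\<^sub>R v - (c * t) *\<^sub>R g) \<in> ball w e"
      "w + t *\<^sub>R (0 *\<^sub>R v - (c * t) *\<^sub>R g) \<in> ball w e"
    using eventually_happens[of _ "at_right (0::real)"] by (metis (no_types, lifting) trivial_limit_at_right_real)
  have in_iff: "w + t *\<^sub>R (s *\<^sub>R v - (c * t) *\<^sub>R g) \<in> S \<longleftrightarrow> 0 \<le> F s t"
    if "w + t *\<^sub>R (s *\<^sub>R v - (c * t) *\<^sub>R g) \<in> ball w e" for s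
  proof -
    have "w + t *\<^sub>R (s *\<^sub>R v - (c * t) *\<^sub>R g) \<in> S \<longleftrightarrow> w + t *\<^sub>R (s *\<^sub>R v - (c * t) *\<^sub>R g) \<in> nonneg_set p"
      using loc that by blast
    then show ?thesis
      unfolding nonneg_set_def mem_Collect_eq F using \<open>0 < t\<close> by (simp add: zero_le_mult_iff)
  qed
  have "(1/2) *\<^sub>R (w + t *\<^sub>R (1 *\<^sub>R v - (c * t) *\<^sub>R g)) + (1/2) *\<^sub>R (w + t *\<^sub>R ((-1) *\<^sub>R v - (c * t) *\<^sub>R g)) \<in> S"
    using in_iff[OF tb(1)] in_iff[OF tb(2)] t by (intro convexD[OF S]) auto
  also have "(1/2) *\<^sub>R (w + t *\<^sub>R (1 *\<^sub>R v - (c * t) *\<^sub>R g)) + (1/2) *\<^sub>R (w + t *\<^sub>R ((-1) *\<^sub>R v - (c * t) *\<^sub>R g))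
      = w + t *\<^sub>R (0 *\<^sub>R v - (c * t) *\<^sub>R g)"
    by (simp add: vec_eq_iff field_simps)
  finally show False
    using in_iff[OF tb(3)] t by simp
qed

text \<open>The tangent space moves with the base point, so \<open>v\<close> is first projected onto
  the tangent space at \<open>w n\<close>; a nonzero gradient at the limit makes these projections
  converge to \<open>v\<close>.\<close>

lemma quasi_concave_at_limit:
  fixes p :: "'n::finite real_mpoly"
  assumes w: "w \<longlonglongrightarrow> u" and qc: "\<And>n. quasi_concave_at (peval p) (w n)"
    and grad: "gradient (peval p) u \<noteq> 0"
  shows "quasi_concave_at (peval p) u"
  unfolding quasi_concave_at_def
proof (intro allI impI)
  fix v assume v: "v \<noteq> 0 \<and> gradient (peval p) u \<bullet> v = 0"
  obtain G H where G: "\<And>x. gradient (peval p) x = (\<chi> i. peval (G i) x)"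
    and H: "\<And>x. hessian (peval p) x = (\<chi> i j. peval (H i j) x)"
    by (rule gradient_hessian_peval[of p]) (rule that)
  define g where "g n = gradient (peval p) (w n)" for n
  define g0 where "g0 = gradient (peval p) u"
  define y where "y n = v - (g n \<bullet> v / (g n \<bullet> g n)) *\<^sub>R g n" for n
  have g: "g \<longlonglongrightarrow> g0"
    unfolding g_def g0_def G by (intro tendsto_intros w)
  have g0: "g0 \<bullet> g0 \<noteq> 0" using grad by (simp add: g0_def)
  have "y \<longlonglongrightarrow> v - (g0 \<bullet> v / (g0 \<bullet> g0)) *\<^sub>R g0"
    unfolding y_def by (intro tendsto_intros g g0)
  then have y: "y \<longlonglongrightarrow> v" using v by (simp add: g0_def)
  have form: "z \<bullet> (hessian (peval p) x *v z) = (\<Sum>i\<in>UNIV. \<Sum>j\<in>UNIV. z $ i * (peval (H i j) x * z $ j))" for z x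
    by (simp add: H inner_vec_def matrix_vector_mult_def sum_distrib_left)
  have "(\<lambda>n. y n \<bullet> (hessian (peval p) (w n) *v y n)) \<longlonglongrightarrow> v \<bullet> (hessian (peval p) u *v v)"
    unfolding form by (intro tendsto_intros y w)
  moreover have "eventually (\<lambda>n. y n \<bullet> (hessian (peval p) (w n) *v y n) \<le> 0) sequentially"
  proof -
    have "eventually (\<lambda>n. y n \<noteq> 0) sequentially"
      using y v by (intro tendsto_imp_eventually_ne) auto
    moreover have "eventually (\<lambda>n. g n \<bullet> g n \<noteq> 0) sequentially"
      by (rule tendsto_imp_eventually_ne[OF tendsto_inner[OF g g] g0])
    ultimately show ?thesis
    proof eventually_elim
      case (elim n)
      then have "g n \<bullet> y n = 0" by (simp add: y_def inner_diff_right)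
      then show ?case
        using qc[of n] elim(1) unfolding quasi_concave_at_def g_def[symmetric] by fastforce
    qed
  qed
  ultimately have "v \<bullet> (hessian (peval p) u *v v) \<le> 0"
    by (rule tendsto_upperbound) simp
  then show "0 \<le> - (v \<bullet> (hessian (peval p) u *v v))" by simp
qed


section \<open>Exactness of the relaxation near a strictly quasi-concave point\<close>

text \<open>Finsler's lemma: on the part of the unit sphere where the form is nonnegative,
  \<open>b \<bullet> v\<close> is nonzero and by compactness bounded away from zero, so a large
  multiple of its square wins.\<close>

lemma form_penalty:
  fixes A :: "'n::finite \<Rightarrow> 'n \<Rightarrow> real" and b :: "real ^ 'n"
  assumes "\<And>v :: real ^ 'n. v \<noteq> 0 \<Longrightarrow> b \<bullet> v = 0 \<Longrightarrow> (\<Sum>i\<in>UNIV. \<Sum>j\<in>UNIV. v $ i * A i j * v $ j) < 0"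
  obtains M c where "0 < c" "\<And>v :: real ^ 'n.
    (\<Sum>i\<in>UNIV. \<Sum>j\<in>UNIV. v $ i * A i j * v $ j) - M * (b \<bullet> v)\<^sup>2 \<le> - c * (v \<bullet> v)"
proof -
  define Q where "Q v = (\<Sum>i\<in>UNIV. \<Sum>j\<in>UNIV. v $ i * A i j * v $ j)" for v :: "real ^ 'n"
  have cQ: "continuous_on T Q" for T
    unfolding Q_def by (intro continuous_intros)
  let ?K = "sphere (0 :: real ^ 'n) 1"
  have K: "compact ?K" "?K \<noteq> {}" by (simp_all add: compact_sphere)
  obtain M where M: "\<And>v. v \<in> ?K \<Longrightarrow> Q v - M * (b \<bullet> v)\<^sup>2 < 0"
  proof (cases "?K \<inter> {v. 0 \<le> Q v} = {}")
    case True
    show thesis by (rule that[of 0]) (use True in force)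
  next
    case False
    have "closed {v. 0 \<le> Q v}"
      by (intro closed_Collect_le continuous_on_const cQ)
    then have A: "compact (?K \<inter> {v. 0 \<le> Q v})"
      by (intro compact_Int_closed K)
    have "continuous_on (?K \<inter> {v. 0 \<le> Q v}) (\<lambda>v. (b \<bullet> v)\<^sup>2)"
      by (intro continuous_intros)
    from continuous_attains_inf[OF A False this] obtain v0 where v0: "v0 \<in> ?K" "0 \<le> Q v0"
      and m: "\<And>v. v \<in> ?K \<Longrightarrow> 0 \<le> Q v \<Longrightarrow> (b \<bullet> v0)\<^sup>2 \<le> (b \<bullet> v)\<^sup>2"
      by auto
    obtain v1 where v1: "\<And>v. v \<in> ?K \<Longrightarrow> Q v \<le> Q v1"
      using continuous_attains_sup[OF K cQ] by blast
    have "v0 \<noteq> 0" using v0(1) by auto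
    then have "b \<bullet> v0 \<noteq> 0" using assms[of v0] v0(2) unfolding Q_def by force
    then have pos: "0 < (b \<bullet> v0)\<^sup>2" by simp
    have Q1: "0 \<le> Q v1" using v0 v1[of v0] by simp
    show thesis
    \<comment> \<open>The maximum of \<open>Q\<close> over the minimum of
      \<open>(b \<bullet> v)\<^sup>2\<close> on the bad part; the \<open>+ 1\<close> makes the
      inequality strict.\<close>
    proof (rule that[of "(Q v1 + 1) / (b \<bullet> v0)\<^sup>2"])
      fix v assume v: "v \<in> ?K"
      have nn: "0 \<le> (Q v1 + 1) / (b \<bullet> v0)\<^sup>2" using Q1 by simp
      show "Q v - (Q v1 + 1) / (b \<bullet> v0)\<^sup>2 * (b \<bullet> v)\<^sup>2 < 0"
      proof (cases "0 \<le> Q v")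
        case True
        have "Q v1 + 1 = (Q v1 + 1) / (b \<bullet> v0)\<^sup>2 * (b \<bullet> v0)\<^sup>2" using pos by simp
        also have "\<dots> \<le> (Q v1 + 1) / (b \<bullet> v0)\<^sup>2 * (b \<bullet> v)\<^sup>2"
          by (intro mult_left_mono m v True nn)
        finally show ?thesis using v1[OF v] by simp
      next
        case False
        have "0 \<le> (Q v1 + 1) / (b \<bullet> v0)\<^sup>2 * (b \<bullet> v)\<^sup>2" by (intro mult_nonneg_nonneg nn) simp
        then show ?thesis using False by linarith
      qed
    qed
  qed
  have "continuous_on ?K (\<lambda>v. Q v - M * (b \<bullet> v)\<^sup>2)"
    by (intro continuous_intros cQ)
  then obtain s where s: "s \<in> ?K" "\<And>v. v \<in> ?K \<Longrightarrow> Q v - M * (b \<bullet> v)\<^sup>2 \<le> Q s - M * (b \<bullet> s)\<^sup>2"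
    using continuous_attains_sup[OF K] by blast
  \<comment> \<open>Minus the maximum over the sphere; by homogeneity of degree two the bound there
    extends to all \<open>v\<close>.\<close>
  define c where "c = - (Q s - M * (b \<bullet> s)\<^sup>2)"
  have c: "0 < c" using M[OF s(1)] by (simp add: c_def)
  have "Q v - M * (b \<bullet> v)\<^sup>2 \<le> - c * (v \<bullet> v)" for v
  proof (cases "v = 0")
    case True
    then show ?thesis by (simp add: Q_def)
  next
    case False
    define y where "y = (1 / norm v) *\<^sub>R v"
    have v: "v = norm v *\<^sub>R y" and y: "y \<in> ?K" using False by (simp_all add: y_def)
    have "Q v = (norm v)\<^sup>2 * Q y"
      by (subst v) (simp add: Q_def sum_distrib_left power2_eq_square ac_simps)
    moreover have "b \<bullet> v = norm v * (b \<bullet> y)"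
      by (subst v) (simp only: inner_scaleR_right)
    ultimately have "Q v - M * (b \<bullet> v)\<^sup>2 = (norm v)\<^sup>2 * (Q y - M * (b \<bullet> y)\<^sup>2)"
      by (simp add: power_mult_distrib algebra_simps)
    also have "\<dots> \<le> (norm v)\<^sup>2 * (- c)"
      using s(2)[OF y] by (intro mult_left_mono) (auto simp: c_def)
    finally show ?thesis by (simp add: power2_norm_eq_inner mult.commute)
  qed
  then show thesis using that c unfolding Q_def by blast
qed

text \<open>\<open>L\<close> and evaluation at the mean agree on affine polynomials, so only terms
  of order two and higher are compared. The threshold \<open>d\<close> is chosen before the radius
  and stays fixed as \<open>r\<close> shrinks.\<close>

lemma eventually_L_le_peval:
  fixes g :: "'n::finite real_mpoly"
  assumes g: "g = cst a + (\<Sum>i\<in>UNIV. vshift u i * cst (b i))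
      + (\<Sum>i\<in>UNIV. \<Sum>j\<in>UNIV. vshift u i * vshift u j * cst (A i j))
      + (\<Sum>i\<in>UNIV. \<Sum>j\<in>UNIV. \<Sum>k\<in>UNIV. vshift u i * (vshift u j * (vshift u k * R i j k)))"
    and A: "\<And>v. (\<Sum>i\<in>UNIV. \<Sum>j\<in>UNIV. v i * A i j * v j) \<le> - c * (\<Sum>i\<in>UNIV. (v i)\<^sup>2)"
    and c: "0 < c"
  shows "\<exists>d. \<forall>\<^sub>F r in at_right 0. \<forall>D L x. ball_moments u r D L x \<longrightarrow> d \<le> D \<longrightarrow> L g \<le> peval g x"
proof -
  let ?T = "\<lambda>i j k. vshift u i * (vshift u j * (vshift u k * R i j k))"
  have "\<forall>i j k. \<exists>d C. 0 \<le> C \<and> (\<forall>r D L x. ball_moments u r D L x \<longrightarrow> d \<le> D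
    \<longrightarrow> \<bar>L (?T i j k) - peval (?T i j k) x\<bar> \<le> C * r * ball_moments.V L x)"
    by (intro allI L_cubic_bound)
  then obtain d C where "\<forall>i j k. 0 \<le> C i j k \<and> (\<forall>r D L x. ball_moments u r D L x \<longrightarrow> d i j k \<le> D
    \<longrightarrow> \<bar>L (?T i j k) - peval (?T i j k) x\<bar> \<le> C i j k * r * ball_moments.V L x)"
    unfolding choice_iff by (elim exE)
  then have C: "\<And>i j k. 0 \<le> C i j k"
    and dC: "\<And>i j k r D L x. ball_moments u r D L x \<Longrightarrow> d i j k \<le> D
      \<Longrightarrow> \<bar>L (?T i j k) - peval (?T i j k) x\<bar> \<le> C i j k * r * ball_moments.V L x"
    by blast+
  define d0 where "d0 = (\<Sum>i\<in>UNIV. \<Sum>j\<in>UNIV. \<Sum>k\<in>UNIV. d i j k)"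
  define C0 where "C0 = (\<Sum>i\<in>UNIV. \<Sum>j\<in>UNIV. \<Sum>k\<in>UNIV. C i j k)"
  have C0: "0 \<le> C0" unfolding C0_def by (intro sum_nonneg C)
  have d0: "d i j k \<le> d0" for i j k
  proof -
    have "d i j k \<le> (\<Sum>k\<in>UNIV. d i j k)" by (rule member_le_sum) auto
    also have "\<dots> \<le> (\<Sum>j\<in>UNIV. \<Sum>k\<in>UNIV. d i j k)"
      by (rule member_le_sum[where f = "\<lambda>j. \<Sum>k\<in>UNIV. d i j k"]) auto
    also have "\<dots> \<le> d0" unfolding d0_def
      by (rule member_le_sum[where f = "\<lambda>i. \<Sum>j\<in>UNIV. \<Sum>k\<in>UNIV. d i j k"]) auto
    finally show ?thesis .
  qed
  \<comment> \<open>The radius makes \<open>C0 * r\<close> at most \<open>c\<close>; the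
    \<open>+ 1\<close> keeps the quotient meaningful when \<open>C0 = 0\<close>.\<close>
  have "L g \<le> peval g x" if bm: "ball_moments u r D L x" and dD: "d0 \<le> D" and rc: "r < c / (C0 + 1)" for r D L x
  proof -
    interpret ball_moments u r D L x by (fact bm)
    have Lw: "L (vshift u i) = x $ i - u $ i" for i
      by (simp add: vshift_def L_diff L_var L_cst)
    have lin: "L (vshift u i * cst (b i)) - peval (vshift u i * cst (b i)) x = 0" for i
      by (subst mult.commute) (simp add: L_cst_mult Lw)
    have quad: "L (vshift u i * vshift u j * cst (A i j)) - peval (vshift u i * vshift u j * cst (A i j)) x
        = A i j * L (vshift x i * vshift x j)" for i j
    proof -
      have "L (vshift u i * vshift u j * cst (A i j)) = A i j * L (vshift u i * vshift u j)"
        by (subst mult.commute) (rule L_cst_mult)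
      then show ?thesis
        unfolding L_vshift2[symmetric] by (simp add: algebra_simps)
    qed
    have "L g - peval g x = (\<Sum>i\<in>UNIV. L (vshift u i * cst (b i)) - peval (vshift u i * cst (b i)) x)
      + (\<Sum>i\<in>UNIV. \<Sum>j\<in>UNIV. L (vshift u i * vshift u j * cst (A i j)) - peval (vshift u i * vshift u j * cst (A i j)) x)
      + (\<Sum>i\<in>UNIV. \<Sum>j\<in>UNIV. \<Sum>k\<in>UNIV. L (?T i j k) - peval (?T i j k) x)"
      unfolding g L_add L_sum L_cst peval_add peval_sum peval_cst sum_subtractf by simp
    also have "\<dots> = (\<Sum>i\<in>UNIV. \<Sum>j\<in>UNIV. A i j * L (vshift x i * vshift x j))
      + (\<Sum>i\<in>UNIV. \<Sum>j\<in>UNIV. \<Sum>k\<in>UNIV. L (?T i j k) - peval (?T i j k) x)"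
      unfolding lin quad by simp
    also have "\<dots> \<le> - c * V + (\<Sum>i\<in>UNIV. \<Sum>j\<in>UNIV. \<Sum>k\<in>UNIV. C i j k * r * V)"
      by (intro add_mono L_form_le A sum_mono order_trans[OF abs_ge_self dC[OF bm order_trans[OF d0 dD]]])
    also have "\<dots> = (C0 * r - c) * V"
      by (simp add: C0_def sum_distrib_left sum_distrib_right algebra_simps)
    also have "\<dots> \<le> 0"
    proof (rule mult_nonpos_nonneg)
      have "C0 * r \<le> (C0 + 1) * r" using r by (simp add: distrib_right)
      also have "\<dots> \<le> c" using rc C0 by (simp add: field_simps)
      finally show "C0 * r - c \<le> 0" by simp
    qed (rule V_nonneg)
    finally show ?thesis by simp
  qed
  moreover have "\<forall>\<^sub>F r in at_right 0. r < c / (C0 + 1)"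
    using c C0 by (intro order_tendstoD(2)[OF tendsto_ident_at]) simp
  ultimately show ?thesis
    by (intro exI[of _ d0]) (auto elim!: eventually_mono)
qed

text \<open>\<open>g = f - M f\<^sup>2\<close> has the sign of \<open>f\<close> near \<open>u\<close>, and its Hessian is that of \<open>f\<close> minus
  \<open>2 M \<nabla>f \<nabla>f\<^sup>T\<close>, which is negative definite on all of \<open>\<real>\<^sup>n\<close> for large \<open>M\<close>.\<close>

lemma strictly_quasi_concave_relaxation:
  fixes f :: "'n::finite real_mpoly"
  assumes f0: "peval f u = 0" and sqc: "strictly_quasi_concave_at (peval f) u"
  shows "\<exists>g d. \<forall>\<^sub>F r in at_right 0. (\<forall>x\<in>cball u r. 0 \<le> peval f x \<longleftrightarrow> 0 \<le> peval g x) \<and>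
    (\<forall>D L x. ball_moments u r D L x \<longrightarrow> d \<le> D \<longrightarrow> L g \<le> peval g x)"
proof -
  obtain b P where f: "f = cst (peval f u) + (\<Sum>i\<in>UNIV. vshift u i * cst (b i))
    + (\<Sum>i\<in>UNIV. \<Sum>j\<in>UNIV. vshift u i * vshift u j * P i j)"
    by (rule taylor2)
  note th = taylor2_gradient_hessian[OF f]
  define A where "A i j = peval (P i j) u" for i j
  have "(\<Sum>i\<in>UNIV. \<Sum>j\<in>UNIV. v $ i * A i j * v $ j) < 0" if "v \<noteq> 0" "(\<chi> i. b i) \<bullet> v = 0" for v :: "real ^ 'n"
  proof -
    have "gradient (peval f) u \<bullet> v = 0"
      using that(2) unfolding th(1) by (simp add: inner_vec_def mult.commute)
    then have "v \<bullet> (hessian (peval f) u *v v) < 0"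
      using sqc that(1) unfolding strictly_quasi_concave_at_def by force
    then show ?thesis unfolding th(2) A_def by simp
  qed
  then obtain M c where c: "0 < c" and Mc: "\<And>v :: real ^ 'n.
    (\<Sum>i\<in>UNIV. \<Sum>j\<in>UNIV. v $ i * A i j * v $ j) - M * ((\<chi> i. b i) \<bullet> v)\<^sup>2 \<le> - c * (v \<bullet> v)"
    by (rule form_penalty[where A = A and b = "\<chi> i. b i"]) auto
  \<comment> \<open>The \<open>F i\<close> are first-order cofactors of \<open>f\<close>, so
    \<open>f * f\<close> is exactly of second order with cofactors \<open>F i * F j\<close>.
    \<open>G\<close> collects the second-order cofactors of \<open>g\<close>, whose values at
    \<open>u\<close> are the penalized matrix.\<close>
  define F where "F i = cst (b i) + (\<Sum>j\<in>UNIV. vshift u j * P i j)" for i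
  define G where "G i j = P i j - cst M * (F i * F j)" for i j
  define g where "g = f - cst M * (f * f)"
  have fF: "f = (\<Sum>i\<in>UNIV. vshift u i * F i)"
    by (subst f) (simp add: f0 F_def distrib_left sum.distrib sum_distrib_left mult.assoc)
  have Gu: "peval (G i j) u = A i j - M * (b i * b j)" for i j
    by (simp add: G_def A_def F_def)
  have "\<forall>i j. \<exists>R. G i j = cst (A i j - M * (b i * b j)) + (\<Sum>k\<in>UNIV. vshift u k * R k)"
    unfolding Gu[symmetric] by (intro allI taylor1)
  then obtain R where R: "\<forall>i j. G i j = cst (A i j - M * (b i * b j)) + (\<Sum>k\<in>UNIV. vshift u k * R i j k)"
    unfolding choice_iff by (elim exE)
  have "cst M * (f * f) = (\<Sum>i\<in>UNIV. \<Sum>j\<in>UNIV. vshift u i * vshift u j * (cst M * (F i * F j)))"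
    unfolding fF sum_product unfolding sum_distrib_left by (intro sum.cong refl) (simp only: mult_ac)
  then have "g = (cst (peval f u) + (\<Sum>i\<in>UNIV. vshift u i * cst (b i))
    + (\<Sum>i\<in>UNIV. \<Sum>j\<in>UNIV. vshift u i * vshift u j * P i j))
    - (\<Sum>i\<in>UNIV. \<Sum>j\<in>UNIV. vshift u i * vshift u j * (cst M * (F i * F j)))"
    unfolding g_def by (metis f)
  also have "\<dots> = cst (peval f u) + (\<Sum>i\<in>UNIV. vshift u i * cst (b i))
    + (\<Sum>i\<in>UNIV. \<Sum>j\<in>UNIV. vshift u i * vshift u j * G i j)"
    by (simp only: G_def right_diff_distrib sum_subtractf add_diff_eq)
  also have "(\<Sum>i\<in>UNIV. \<Sum>j\<in>UNIV. vshift u i * vshift u j * G i j)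
    = (\<Sum>i\<in>UNIV. \<Sum>j\<in>UNIV. vshift u i * vshift u j * cst (A i j - M * (b i * b j)))
      + (\<Sum>i\<in>UNIV. \<Sum>j\<in>UNIV. \<Sum>k\<in>UNIV. vshift u i * (vshift u j * (vshift u k * R i j k)))"
    unfolding sum.distrib[symmetric]
    by (intro sum.cong refl) (simp only: R[rule_format] distrib_left sum_distrib_left mult.assoc)
  finally have g: "g = cst (peval f u) + (\<Sum>i\<in>UNIV. vshift u i * cst (b i))
    + (\<Sum>i\<in>UNIV. \<Sum>j\<in>UNIV. vshift u i * vshift u j * cst (A i j - M * (b i * b j)))
    + (\<Sum>i\<in>UNIV. \<Sum>j\<in>UNIV. \<Sum>k\<in>UNIV. vshift u i * (vshift u j * (vshift u k * R i j k)))"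
    by (simp only: add.assoc)
  have "(\<Sum>i\<in>UNIV. \<Sum>j\<in>UNIV. v i * (A i j - M * (b i * b j)) * v j) \<le> - c * (\<Sum>i\<in>UNIV. (v i)\<^sup>2)" for v
  proof -
    have "(\<Sum>i\<in>UNIV. \<Sum>j\<in>UNIV. v i * (A i j - M * (b i * b j)) * v j)
      = (\<Sum>i\<in>UNIV. \<Sum>j\<in>UNIV. v i * A i j * v j) - M * ((\<Sum>i\<in>UNIV. b i * v i) * (\<Sum>i\<in>UNIV. b i * v i))"
      unfolding sum_product unfolding sum_distrib_left sum_subtractf[symmetric]
      by (intro sum.cong refl) (simp add: algebra_simps)
    then show ?thesis
      using Mc[of "\<chi> i. v i"] by (simp add: inner_vec_def power2_eq_square)
  qed
  from eventually_L_le_peval[OF g this c] obtain d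
    where d: "\<forall>\<^sub>F r in at_right 0. \<forall>D L x. ball_moments u r D L x \<longrightarrow> d \<le> D \<longrightarrow> L g \<le> peval g x" ..
  \<comment> \<open>\<open>g\<close> factors as \<open>f * (1 - M * f)\<close>, and the second
    factor is positive near \<open>u\<close> because \<open>f\<close> vanishes there.\<close>
  have "((\<lambda>x. 1 - M * peval f x) \<longlongrightarrow> 1 - M * peval f u) (nhds u)"
    by (intro tendsto_intros filterlim_ident)
  then have "((\<lambda>x. 1 - M * peval f x) \<longlongrightarrow> 1) (nhds u)"
    using f0 by simp
  from order_tendstoD(1)[OF this, of 0] have "\<forall>\<^sub>F x in nhds u. 0 < 1 - M * peval f x" by simp
  then obtain e where e: "0 < e" "\<And>x. dist x u < e \<Longrightarrow> 0 < 1 - M * peval f x"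
    unfolding eventually_nhds_metric by blast
  have "\<forall>\<^sub>F r in at_right 0. r < e"
    using e(1) by (intro order_tendstoD(2)[OF tendsto_ident_at])
  then have "\<forall>\<^sub>F r in at_right 0. \<forall>x\<in>cball u r. 0 \<le> peval f x \<longleftrightarrow> 0 \<le> peval g x"
  proof eventually_elim
    case (elim r)
    show ?case
    proof
      fix x assume "x \<in> cball u r"
      then have "0 < 1 - M * peval f x"
        using elim by (intro e(2)) (simp add: dist_commute)
      moreover have "peval g x = peval f x * (1 - M * peval f x)"
        by (simp add: g_def algebra_simps)
      ultimately show "0 \<le> peval f x \<longleftrightarrow> 0 \<le> peval g x"
        by (simp add: zero_le_mult_iff)
    qed
  qed
  from eventually_conj[OF this d] show ?thesis
    by (intro exI)
qed

text \<open>The thresholds do not depend on the radius, so one relaxation order \<open>D\<close>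
  serves all small balls.\<close>

lemma eventually_sdp_representable_cball:
  fixes F :: "'n::finite real_mpoly set"
  assumes F: "finite F"
    and sqc: "\<And>f. f \<in> F \<Longrightarrow> peval f u = 0 \<and> strictly_quasi_concave_at (peval f) u"
  shows "\<forall>\<^sub>F r in at_right 0. sdp_representable (cball u r \<inter> (\<Inter>f\<in>F. nonneg_set f))"
proof -
  have "\<forall>f\<in>F. \<exists>gd. \<forall>\<^sub>F r in at_right 0. (\<forall>x\<in>cball u r. 0 \<le> peval f x \<longleftrightarrow> 0 \<le> peval (fst gd) x) \<and>
    (\<forall>D L x. ball_moments u r D L x \<longrightarrow> snd gd \<le> D \<longrightarrow> L (fst gd) \<le> peval (fst gd) x)"
  proof
    fix f assume "f \<in> F"
    with strictly_quasi_concave_relaxation[of f u] sqc obtain g d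
      where "\<forall>\<^sub>F r in at_right 0. (\<forall>x\<in>cball u r. 0 \<le> peval f x \<longleftrightarrow> 0 \<le> peval g x) \<and>
        (\<forall>D L x. ball_moments u r D L x \<longrightarrow> d \<le> D \<longrightarrow> L g \<le> peval g x)" by auto
    then show "\<exists>gd. \<forall>\<^sub>F r in at_right 0. (\<forall>x\<in>cball u r. 0 \<le> peval f x \<longleftrightarrow> 0 \<le> peval (fst gd) x) \<and>
        (\<forall>D L x. ball_moments u r D L x \<longrightarrow> snd gd \<le> D \<longrightarrow> L (fst gd) \<le> peval (fst gd) x)"
      by (intro exI[of _ "(g, d)"]) simp
  qed
  from finite_set_choice[OF F this] obtain gd where
    gd: "\<forall>f\<in>F. \<forall>\<^sub>F r in at_right 0. (\<forall>x\<in>cball u r. 0 \<le> peval f x \<longleftrightarrow> 0 \<le> peval (fst (gd f)) x) \<and>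
    (\<forall>D L x. ball_moments u r D L x \<longrightarrow> snd (gd f) \<le> D \<longrightarrow> L (fst (gd f)) \<le> peval (fst (gd f)) x)" ..
  define g where "g f = fst (gd f)" for f
  \<comment> \<open>The sum dominates every threshold, and \<open>Suc\<close> secures
    \<open>1 \<le> D\<close> for the locale.\<close>
  define D where "D = Suc (\<Sum>f\<in>F. snd (gd f))"
  have dD: "snd (gd f) \<le> D" if "f \<in> F" for f
    using member_le_sum[of f F "\<lambda>f. snd (gd f)"] that F unfolding D_def by simp
  have "\<forall>\<^sub>F r :: real in at_right 0. 0 < r \<and> r < 1"
    using eventually_at_right_real[of 0 1] by simp
  with eventually_ball_finite[OF F gd] show ?thesis
  proof eventually_elim
    case (elim r)
    let ?K = "{1, ball_poly u r} \<union> g ` F"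
    have "cball u r \<inter> (\<Inter>f\<in>F. nonneg_set f) = {x. \<exists>L. moments ?K D L x}"
    proof (intro equalityI subsetI)
      fix x assume x: "x \<in> cball u r \<inter> (\<Inter>f\<in>F. nonneg_set f)"
      then have "norm (x - u) \<le> r" by (simp add: dist_norm norm_minus_commute)
      then have "0 \<le> peval (ball_poly u r) x"
        unfolding peval_ball_poly using power_mono[of "norm (x - u)" r 2] by simp
      moreover have "0 \<le> peval (g f) x" if "f \<in> F" for f
        using x elim(1) that by (auto simp: g_def nonneg_set_def)
      ultimately have "moments ?K D (\<lambda>p. peval p x) x"
        by (intro moments_peval) auto
      then show "x \<in> {x. \<exists>L. moments ?K D L x}" by blast
    next
      fix x assume "x \<in> {x. \<exists>L. moments ?K D L x}"
      then obtain L where L: "moments ?K D L x" by blast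
      then have bm: "ball_moments u r D L x"
        using elim(2) by unfold_locales (auto simp: moments_def D_def)
      then have x: "x \<in> cball u r"
        using ball_moments.norm_le by (simp add: dist_norm norm_minus_commute)
      have "0 \<le> peval f x" if f: "f \<in> F" for f
      proof -
        have "0 \<le> L (g f * (h * h))" if "deg_le h D" for h
          using L f that unfolding moments_def by simp
        from this[of 1] have "0 \<le> L (g f)"
          using deg_le_cst[of 1 D] by simp
        also have "\<dots> \<le> peval (g f) x"
          using elim(1) f bm dD[OF f] by (simp add: g_def)
        finally show ?thesis
          using elim(1) f x by (simp add: g_def)
      qed
      with x show "x \<in> cball u r \<inter> (\<Inter>f\<in>F. nonneg_set f)"
        by (simp add: nonneg_set_def)
    qed
    then show ?case
      using sdp_representable_moments[of ?K D] F by simp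
  qed
qed


section \<open>Gluing the local pieces\<close>

text \<open>The points \<open>w n\<close> are only given as boundary points, yet \<open>p\<close>
  vanishes there: were it positive, \<open>S\<close> would contain a neighborhood of
  \<open>w n\<close>. So the convexity argument applies at each of them.\<close>

lemma irredundant_quasi_concave_at:
  fixes p :: "'n::finite real_mpoly"
  assumes S: "closed S" "convex S" and irr: "irredundant_at S p u"
    and u: "u \<in> zeros p \<inter> frontier S"
    and grad: "\<And>y. y \<in> zeros p \<inter> frontier S \<Longrightarrow> gradient (peval p) y \<noteq> 0"
  shows "quasi_concave_at (peval p) u"
proof -
  obtain w \<epsilon> where w: "w \<longlonglongrightarrow> u" and N: "\<And>N. w N \<in> frontier S" "\<And>N. 0 < \<epsilon> N"
    "\<And>N. S \<inter> ball (w N) (\<epsilon> N) = nonneg_set p \<inter> ball (w N) (\<epsilon> N)"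
    using irr unfolding irredundant_at_def by blast
  have zero: "peval p (w n) = 0" for n
  proof (rule ccontr)
    assume nz: "peval p (w n) \<noteq> 0"
    have "w n \<in> S" using N(1)[of n] S(1) frontier_subset_closed by blast
    then have "w n \<in> S \<inter> ball (w n) (\<epsilon> n)" using N(2)[of n] by simp
    then have "w n \<in> nonneg_set p" unfolding N(3) by (rule IntD1)
    then have "0 < peval p (w n)" using nz by (simp add: nonneg_set_def)
    moreover have "open (ball (w n) (\<epsilon> n) \<inter> {x. 0 < peval p x})"
      by (intro open_Int open_ball open_Collect_less continuous_intros)
    moreover have "ball (w n) (\<epsilon> n) \<inter> {x. 0 < peval p x} \<subseteq> S"
    proof -
      have "ball (w n) (\<epsilon> n) \<inter> {x. 0 < peval p x} \<subseteq> nonneg_set p \<inter> ball (w n) (\<epsilon> n)"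
        by (auto simp: nonneg_set_def)
      then show ?thesis unfolding N(3)[symmetric] by simp
    qed
    ultimately have "w n \<in> interior S"
      using N(2)[of n] by (intro interiorI[of "ball (w n) (\<epsilon> n) \<inter> {x. 0 < peval p x}"]) auto
    then show False using N(1)[of n] by (simp add: frontier_def)
  qed
  show ?thesis
  proof (rule quasi_concave_at_limit[OF w])
    show "quasi_concave_at (peval p) (w n)" for n
      using N(1)[of n] zero[of n]
      by (intro quasi_concave_at_of_convex[OF S(2) N(2,3) zero] grad) (simp add: zeros_def)
    show "gradient (peval p) u \<noteq> 0" by (rule grad[OF u])
  qed
qed

text \<open>A polynomial positive at \<open>u\<close> stays positive on a small ball and drops out
  of the local description of \<open>closure T\<close>; the others vanish at \<open>u\<close>, where
  strict quasi-concavity is available.\<close>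

lemma eventually_sdp_representable_piece:
  fixes S :: "(real ^ 'n::finite) set"
  assumes T: "intrinsic_piece T L f" and TS: "T \<subseteq> interior S" and S: "closed S"
    and u: "u \<in> frontier S" "u \<in> closure T"
    and grad: "\<And>i. i \<in> {1..L} \<Longrightarrow> peval (f i) u = 0 \<Longrightarrow> gradient (peval (f i)) u \<noteq> 0"
    and sqc: "\<And>i. i \<in> {1..L} \<Longrightarrow> peval (f i) u = 0 \<Longrightarrow> strictly_quasi_concave_at (peval (f i)) u"
  shows "\<forall>\<^sub>F r in at_right 0. sdp_representable (closure T \<inter> cball u r)"
proof -
  have "closure T \<subseteq> S"
    using TS S by (meson closure_minimal interior_subset order_trans)
  \<comment> \<open>The local description is available on \<open>frontier (closure T)\<close>; a
    point interior to \<open>closure T\<close> would be interior to \<open>S\<close>.\<close>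
  then have "interior (closure T) \<subseteq> interior S" by (rule interior_mono)
  then have uf: "u \<in> frontier (closure T)"
    using u by (auto simp: frontier_def)
  have gradz: "\<forall>i\<in>{1..L}. u \<in> zeros (f i) \<longrightarrow> gradient (peval (f i)) u \<noteq> 0"
    using grad by (simp add: zeros_def)
  have "\<forall>u\<in>frontier (closure T).
        (\<forall>i\<in>{1..L}. u \<in> zeros (f i) \<longrightarrow> gradient (peval (f i)) u \<noteq> 0) \<longrightarrow>
        (\<exists>r0>0. \<forall>r. 0 < r \<and> r < r0 \<longrightarrow>
           closure T \<inter> cball u r = (\<Inter>i\<in>{1..L}. nonneg_set (f i)) \<inter> cball u r)"
    using T unfolding intrinsic_piece_def by (elim conjE)
  from mp[OF bspec[OF this uf] gradz] obtain r0 where r0: "0 < r0" and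
    loc0: "\<forall>r. 0 < r \<and> r < r0 \<longrightarrow> closure T \<inter> cball u r = (\<Inter>i\<in>{1..L}. nonneg_set (f i)) \<inter> cball u r"
    by (elim exE conjE)
  then have loc: "closure T \<inter> cball u r = (\<Inter>i\<in>{1..L}. nonneg_set (f i)) \<inter> cball u r" if "0 < r" "r < r0" for r
    using that by simp
  \<comment> \<open>The center lies in its own ball, so the description at one radius already fixes
    the signs at \<open>u\<close>.\<close>
  have nn: "0 \<le> peval (f i) u" if "i \<in> {1..L}" for i
  proof -
    have "u \<in> closure T \<inter> cball u (r0 / 2)" using r0 u(2) by simp
    then have "u \<in> (\<Inter>i\<in>{1..L}. nonneg_set (f i)) \<inter> cball u (r0 / 2)"
      using loc[of "r0 / 2"] r0 by simp
    then show ?thesis using that by (simp add: nonneg_set_def)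
  qed
  define Z where "Z = {i \<in> {1..L}. peval (f i) u = 0}"
  have "\<forall>\<^sub>F r in at_right 0. sdp_representable (cball u r \<inter> (\<Inter>p\<in>f ` Z. nonneg_set p))"
    by (rule eventually_sdp_representable_cball) (auto simp: Z_def intro: sqc)
  moreover have "\<forall>\<^sub>F r in at_right 0. \<forall>i\<in>{1..L} - Z. cball u r \<subseteq> nonneg_set (f i)"
  proof (rule eventually_ball_finite, simp, rule ballI)
    fix i assume "i \<in> {1..L} - Z"
    then have "0 < peval (f i) u" using nn[of i] by (auto simp: Z_def)
    moreover have "open {x. 0 < peval (f i) x}"
      by (intro open_Collect_less continuous_intros)
    ultimately obtain e where e: "0 < e" "ball u e \<subseteq> {x. 0 < peval (f i) x}"
      unfolding open_contains_ball by blast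
    have "\<forall>\<^sub>F r in at_right 0. r < e"
      using e(1) by (intro order_tendstoD(2)[OF tendsto_ident_at])
    then show "\<forall>\<^sub>F r in at_right 0. cball u r \<subseteq> nonneg_set (f i)"
    proof eventually_elim
      case (elim r)
      then have "cball u r \<subseteq> ball u e" by auto
      then show ?case using e(2) by (fastforce simp: nonneg_set_def)
    qed
  qed
  moreover have "\<forall>\<^sub>F r in at_right 0. 0 < r \<and> r < r0"
    using eventually_at_right_real[OF r0] by simp
  ultimately show ?thesis
  proof eventually_elim
    case (elim r)
    have "closure T \<inter> cball u r = cball u r \<inter> (\<Inter>p\<in>f ` Z. nonneg_set p)"
      using loc[of r] elim(2,3) by (auto simp: Z_def)
    then show ?case using elim(1) by simp
  qed
qed

text \<open>The pieces only have to cover the boundary, because a compact convex set is the convex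
  hull of its frontier; compactness of the frontier makes finitely many balls enough.\<close>

theorem sdp_representable_of_local_pieces:
  fixes S :: "(real ^ 'n::finite) set"
  assumes S: "compact S" "convex S" "interior S \<noteq> {}"
    and T: "finite K" "interior S = (\<Union>k\<in>K. T k)"
    and sdp: "\<And>u k. u \<in> frontier S \<Longrightarrow> k \<in> K \<Longrightarrow> u \<in> closure (T k) \<Longrightarrow>
      \<forall>\<^sub>F r in at_right 0. sdp_representable (closure (T k) \<inter> cball u r)"
  shows "sdp_representable S"
proof -
  have closed: "closed S" using S(1) by (rule compact_imp_closed)
  have Ssub: "closure (T k) \<subseteq> S" if "k \<in> K" for k
    using that T(2) interior_subset[of S] closed by (intro closure_minimal) auto
  \<comment> \<open>A closed convex set with interior points is the closure of its interior, so no
    point of \<open>S\<close> escapes the closures of the \<open>T k\<close>.\<close>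
  have "S = closure (interior S)"
    using convex_closure_interior[OF S(2,3)] closed by simp
  also have "\<dots> \<subseteq> (\<Union>k\<in>K. closure (T k))"
    unfolding T(2) using T(1) closure_subset by (intro closure_minimal closed_UN) blast+
  finally have cover: "S \<subseteq> (\<Union>k\<in>K. closure (T k))" .
  \<comment> \<open>One radius must work for all \<open>k\<close> at once: small enough for
    representability if \<open>closure (T k)\<close> contains \<open>u\<close>, and small enough to
    miss this closed set otherwise.\<close>
  have "\<forall>u\<in>frontier S. \<exists>r>0. \<forall>k\<in>K. closure (T k) \<inter> cball u r = {} \<or>
      u \<in> closure (T k) \<and> sdp_representable (closure (T k) \<inter> cball u r)"
  proof
    fix u assume u: "u \<in> frontier S"
    have "\<forall>\<^sub>F r in at_right 0. \<forall>k\<in>K. closure (T k) \<inter> cball u r = {} \<or>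
      u \<in> closure (T k) \<and> sdp_representable (closure (T k) \<inter> cball u r)"
    proof (rule eventually_ball_finite[OF T(1)], rule ballI)
      fix k assume k: "k \<in> K"
      show "\<forall>\<^sub>F r in at_right 0. closure (T k) \<inter> cball u r = {} \<or>
        u \<in> closure (T k) \<and> sdp_representable (closure (T k) \<inter> cball u r)"
      proof (cases "u \<in> closure (T k)")
        case True
        from sdp[OF u k True] show ?thesis
          by eventually_elim (simp add: True)
      next
        case False
        then obtain e where e: "0 < e" "ball u e \<subseteq> - closure (T k)"
          using open_contains_ball[of "- closure (T k)"] by auto
        have "\<forall>\<^sub>F r in at_right 0. r < e"
          using e(1) by (intro order_tendstoD(2)[OF tendsto_ident_at])
        then show ?thesis
        proof eventually_elim
          case (elim r)
          then have "cball u r \<subseteq> ball u e" by auto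
          then show ?case using e(2) by blast
        qed
      qed
    qed
    moreover have "\<forall>\<^sub>F r :: real in at_right 0. 0 < r"
      by (rule eventually_at_right_less)
    ultimately have "\<forall>\<^sub>F r in at_right 0. 0 < r \<and> (\<forall>k\<in>K. closure (T k) \<inter> cball u r = {} \<or>
      u \<in> closure (T k) \<and> sdp_representable (closure (T k) \<inter> cball u r))"
      by eventually_elim blast
    then show "\<exists>r>0. \<forall>k\<in>K. closure (T k) \<inter> cball u r = {} \<or>
      u \<in> closure (T k) \<and> sdp_representable (closure (T k) \<inter> cball u r)"
      using eventually_happens trivial_limit_at_right_real by blast
  qed
  from bchoice[OF this] obtain r where r: "\<And>u. u \<in> frontier S \<Longrightarrow> 0 < r u"
    and rk: "\<And>u k. u \<in> frontier S \<Longrightarrow> k \<in> K \<Longrightarrow> closure (T k) \<inter> cball u (r u) = {} \<or>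
      u \<in> closure (T k) \<and> sdp_representable (closure (T k) \<inter> cball u (r u))"
    by blast
  have "frontier S \<subseteq> (\<Union>u\<in>frontier S. ball u (r u))" using r by force
  then obtain U where U: "U \<subseteq> frontier S" "finite U" "frontier S \<subseteq> (\<Union>u\<in>U. ball u (r u))"
    by (rule compactE_image[OF compact_frontier[OF S(1)] open_ball])
  \<comment> \<open>Empty intersections are left out because homogenization requires nonempty
    pieces.\<close>
  define F where "F = (\<lambda>(u, k). closure (T k) \<inter> cball u (r u)) ` {(u, k) \<in> U \<times> K. closure (T k) \<inter> cball u (r u) \<noteq> {}}"
  have "finite F"
    unfolding F_def
    by (rule finite_imageI, rule finite_subset[OF _ finite_cartesian_product[OF U(2) T(1)]]) auto
  have F: "sdp_representable P \<and> bounded P \<and> P \<noteq> {}" if PF: "P \<in> F" for P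
  proof -
    obtain u k where uk: "u \<in> U" "k \<in> K" and P: "P = closure (T k) \<inter> cball u (r u)"
      and ne: "closure (T k) \<inter> cball u (r u) \<noteq> {}"
      using PF unfolding F_def by auto
    then have "sdp_representable P" using rk[of u k] U(1) by auto
    moreover have "bounded P" unfolding P by (intro bounded_subset[OF bounded_cball[of u "r u"]]) auto
    ultimately show ?thesis using ne P by simp
  qed
  have "\<Union>F \<subseteq> S" unfolding F_def using Ssub by auto
  then have sub: "convex hull (\<Union>F) \<subseteq> S" using S(2) by (rule hull_minimal)
  have fr: "frontier S \<subseteq> \<Union>F"
  proof
    fix y assume y: "y \<in> frontier S"
    then obtain u where u: "u \<in> U" "y \<in> ball u (r u)" using U(3) by blast
    have "y \<in> S" using y closed frontier_subset_closed by blast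
    then obtain k where k: "k \<in> K" "y \<in> closure (T k)" using cover by blast
    have "y \<in> closure (T k) \<inter> cball u (r u)" using u k by auto
    then show "y \<in> \<Union>F" using u(1) k(1) unfolding F_def by blast
  qed
  have "S = convex hull (frontier S)"
    by (rule Krein_Milman_frontier[OF S(2,1)])
  also have "\<dots> \<subseteq> convex hull (\<Union>F)" using fr by (rule hull_mono)
  finally have eq: "S = convex hull (\<Union>F)" using sub by blast
  have "F \<noteq> {}" using eq S(3) by auto
  show ?thesis
    by (subst eq) (rule sdp_representable_convex_hull_Union[OF \<open>finite F\<close> \<open>F \<noteq> {}\<close> F])
qed

theorem theorem3p9:
  fixes S :: "(real ^ 'n::finite) set"
    and m :: nat and L :: "nat \<Rightarrow> nat"
    and f :: "nat \<Rightarrow> nat \<Rightarrow> 'n real_mpoly"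
  assumes "compact S" and "convex S" and "semialgebraic S" and "interior S \<noteq> {}"
    and "intrinsic_system S m L f"
    and "\<forall>k\<in>{1..m}. \<forall>i\<in>{1..L k}. \<forall>u\<in>zeros (f k i) \<inter> frontier S.
           gradient (peval (f k i)) u \<noteq> 0"
    and "\<forall>k\<in>{1..m}. \<forall>i\<in>{1..L k}. \<forall>u\<in>zeros (f k i) \<inter> frontier S.
           \<not> irredundant_at S (f k i) u \<longrightarrow> strictly_quasi_concave_at (peval (f k i)) u"
  shows "((\<forall>u\<in>frontier S. \<forall>k\<in>{1..m}. \<forall>i\<in>{1..L k}.
             peval (f k i) u = 0 \<longrightarrow> strictly_quasi_concave_at (peval (f k i)) u)
           \<longrightarrow> sdp_representable S) \<and>
         (sdp_representable S \<longrightarrow>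
          (\<forall>u\<in>frontier S. \<forall>k\<in>{1..m}. \<forall>i\<in>{1..L k}.
             peval (f k i) u = 0 \<longrightarrow> quasi_concave_at (peval (f k i)) u))"
proof (intro conjI impI ballI)
  have closed: "closed S" using assms(1) by (rule compact_imp_closed)
  obtain T where T: "interior S = (\<Union>k\<in>{1..m}. T k)"
    and piece: "\<And>k. k \<in> {1..m} \<Longrightarrow> intrinsic_piece (T k) (L k) (f k)"
    using assms(5) unfolding intrinsic_system_def by blast
  {
    assume sqc: "\<forall>u\<in>frontier S. \<forall>k\<in>{1..m}. \<forall>i\<in>{1..L k}.
      peval (f k i) u = 0 \<longrightarrow> strictly_quasi_concave_at (peval (f k i)) u"
    show "sdp_representable S"
    proof (rule sdp_representable_of_local_pieces[OF assms(1,2,4) finite_atLeastAtMost T])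
      fix u k assume u: "u \<in> frontier S" and k: "k \<in> {1..m}" and uT: "u \<in> closure (T k)"
      show "\<forall>\<^sub>F r in at_right 0. sdp_representable (closure (T k) \<inter> cball u r)"
      proof (rule eventually_sdp_representable_piece[OF piece[OF k] _ closed u uT])
        show "T k \<subseteq> interior S" using T k by blast
        show "gradient (peval (f k i)) u \<noteq> 0" if "i \<in> {1..L k}" "peval (f k i) u = 0" for i
          using assms(6) k u that by (auto simp: zeros_def)
        show "strictly_quasi_concave_at (peval (f k i)) u" if "i \<in> {1..L k}" "peval (f k i) u = 0" for i
          using sqc k u that by blast
      qed
    qed
  next
    fix u k i
    assume u: "u \<in> frontier S" and k: "k \<in> {1..m}" and i: "i \<in> {1..L k}" and "peval (f k i) u = 0"
    then have uz: "u \<in> zeros (f k i) \<inter> frontier S" by (simp add: zeros_def)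
    show "quasi_concave_at (peval (f k i)) u"
    proof (cases "irredundant_at S (f k i) u")
      case True
      show ?thesis
        by (rule irredundant_quasi_concave_at[OF closed assms(2) True uz]) (use assms(6) k i in blast)
    next
      case False
      then have "strictly_quasi_concave_at (peval (f k i)) u"
        using assms(7) k i uz by blast
      then show ?thesis
        unfolding strictly_quasi_concave_at_def quasi_concave_at_def by (meson less_imp_le)
    qed
  }
qed

end
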